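(* Let $(\Omega_n)_n$ be a sequence of convex bodies in $\mathbb{R}^3$ with vanishing relative width, i.e. $w^{(\mathrm{rel})}(\Omega_n)\to 0$ as $n\to+\infty$. Then $(\Omega_n)_n$ is a maximizing sequence for the reverse Cheeger inequality $J(\Omega)<\pi^2/4$, that is, $$\lim_{n\to+\infty} J(\Omega_n)=\frac{\pi^2}{4}.$$
   Context: A convex body in $\mathbb{R}^N$ is a bounded, closed, convex set with nonempty interior. Cheeger constant, eigenvalue and $J$. For a nonempty bounded open set $\Omega\subset\mathbb{R}^N$, $$h(\Omega)=\inf\Big\{\frac{\mathrm{Per}(E)}{|E|}: E\subset\Omega,\ |E|>0\Big\},\qquad \lambda_1(\Omega)=\inf\Big\{\frac{\|\nabla v\|_2^2}{\|v\|_2^2}: v\in H^1_0(\Omega)\setminus\{0\}\Big\},\qquad J(\Omega)=\frac{\lambda_1(\Omega)}{h(\Omega)^2},$$ where $\mathrm{Per}$ is the variational (De Giorgi) perimeter and $|\cdot|$ is Lebesgue measure. For a convex body $\Omega$, the quantities $\lambda_1(\Omega),h(\Omega),J(\Omega)$ are those of its interior. Principal widths. For a closed convex set $\Omega\subset\mathbb{R}^N$ with nonempty interior ($N\ge 2$), let $\sigma_\Omega(\nu)=\sup_{x\in\Omega}\langle x,\nu\rangle$ be the support function and $w_\nu(\Omega)=\sigma_\Omega(\nu)+\sigma_\Omega(-\nu)\in[0,+\infty]$ the width in direction $\nu\in\mathbb{S}^{N-1}$. Set $w^{(1)}(\Omega)=\min_{\nu\in\mathbb{S}^{N-1}}w_\nu(\Omega)$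 and $V^{(1)}(\Omega)=\{u\in\mathbb{S}^{N-1}: w_u(\Omega)=w^{(1)}(\Omega)\}$. Set $$w^{(2)}(\Omega)=\inf\{w_\nu(\Omega): \nu\in\mathbb{S}^{N-1},\ \langle\nu,u^{(1)}\rangle=0 \text{ for some } u^{(1)}\in V^{(1)}(\Omega)\}.$$ Relative width. $w^{(\mathrm{rel})}(\Omega)=w^{(1)}(\Omega)/w^{(2)}(\Omega)$. *)

theory Defs
  imports "HOL-Analysis.Analysis"
begin

definition convex_body :: "'a::euclidean_space set \<Rightarrow> bool" where
  "convex_body K \<longleftrightarrow> bounded K \<and> closed K \<and> convex K \<and> interior K \<noteq> {}"

primrec C_k :: "nat \<Rightarrow> ('a::euclidean_space \<Rightarrow> 'b::real_normed_vector) \<Rightarrow> bool" where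
  "C_k 0 f \<longleftrightarrow> continuous_on UNIV f"
| "C_k (Suc k) f \<longleftrightarrow> (\<forall>x. f differentiable (at x)) \<and>
     (\<forall>i\<in>Basis. C_k k (\<lambda>x. frechet_derivative f (at x) i))"

definition supp :: "('a::topological_space \<Rightarrow> 'b::zero) \<Rightarrow> 'a set" where
  "supp f = closure {x. f x \<noteq> 0}"

text \<open>Test functions on an open set \<open>\<Omega>\<close> are represented by their extension by zero to the
  whole space, which is again smooth.\<close>

definition Cc_inf :: "'a::euclidean_space set \<Rightarrow> ('a \<Rightarrow> real) set" where
  "Cc_inf \<Omega> = {\<phi>. (\<forall>k. C_k k \<phi>) \<and> compact (supp \<phi>) \<and> supp \<phi> \<subseteq> \<Omega>}"

definition grad :: "('a::euclidean_space \<Rightarrow> real) \<Rightarrow> 'a \<Rightarrow> 'a" where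
  "grad f x = (\<Sum>i\<in>Basis. frechet_derivative f (at x) i *\<^sub>R i)"

definition divergence :: "('a::euclidean_space \<Rightarrow> 'a) \<Rightarrow> 'a \<Rightarrow> real" where
  "divergence \<phi> x = (\<Sum>i\<in>Basis. frechet_derivative \<phi> (at x) i \<bullet> i)"

definition perimeter :: "'a::euclidean_space set \<Rightarrow> ereal" where
  "perimeter E =
     (SUP \<phi>\<in>{\<phi> :: 'a \<Rightarrow> 'a. C_k 1 \<phi> \<and> compact (supp \<phi>) \<and> (\<forall>x. norm (\<phi> x) \<le> 1)}.
        ereal (LINT x:E|lebesgue. divergence \<phi> x))"

definition cheeger :: "'a::euclidean_space set \<Rightarrow> ereal" where
  "cheeger \<Omega> =
     (INF E\<in>{E. E \<subseteq> \<Omega> \<and> E \<in> sets lebesgue \<and> measure lebesgue E > 0}.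
        perimeter E / ereal (measure lebesgue E))"

definition L2_on :: "'a::euclidean_space set \<Rightarrow> ('a \<Rightarrow> 'b::euclidean_space) \<Rightarrow> bool" where
  "L2_on \<Omega> f \<longleftrightarrow> set_borel_measurable lebesgue \<Omega> f \<and>
     set_integrable lebesgue \<Omega> (\<lambda>x. (norm (f x))\<^sup>2)"

definition L2_norm_sq :: "'a::euclidean_space set \<Rightarrow> ('a \<Rightarrow> 'b::euclidean_space) \<Rightarrow> real" where
  "L2_norm_sq \<Omega> f = (LINT x:\<Omega>|lebesgue. (norm (f x))\<^sup>2)"

text \<open>\<open>has_H1_grad \<Omega> v g\<close>: \<open>v \<in> H\<^sup>1(\<Omega>)\<close> with weak gradient \<open>g\<close>. The weak gradient is
  unique only up to null sets, hence a relation rather than a function.\<close>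

definition has_H1_grad :: "'a::euclidean_space set \<Rightarrow> ('a \<Rightarrow> real) \<Rightarrow> ('a \<Rightarrow> 'a) \<Rightarrow> bool" where
  "has_H1_grad \<Omega> v g \<longleftrightarrow> L2_on \<Omega> v \<and> L2_on \<Omega> g \<and>
     (\<forall>\<phi>\<in>Cc_inf \<Omega>. (LINT x:\<Omega>|lebesgue. v x *\<^sub>R grad \<phi> x) = - (LINT x:\<Omega>|lebesgue. \<phi> x *\<^sub>R g x))"

text \<open>\<open>has_H10_grad \<Omega> v g\<close>: \<open>v \<in> H\<^sup>1\<^sub>0(\<Omega>)\<close>, the closure in \<open>H\<^sup>1(\<Omega>)\<close> of the test functions,
  with weak gradient \<open>g\<close>.\<close>

definition has_H10_grad :: "'a::euclidean_space set \<Rightarrow> ('a \<Rightarrow> real) \<Rightarrow> ('a \<Rightarrow> 'a) \<Rightarrow> bool" where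
  "has_H10_grad \<Omega> v g \<longleftrightarrow> has_H1_grad \<Omega> v g \<and>
     (\<exists>\<phi>. (\<forall>n::nat. \<phi> n \<in> Cc_inf \<Omega>) \<and>
        (\<lambda>n. L2_norm_sq \<Omega> (\<lambda>x. \<phi> n x - v x) + L2_norm_sq \<Omega> (\<lambda>x. grad (\<phi> n) x - g x))
          \<longlonglongrightarrow> 0)"

definition lambda1 :: "'a::euclidean_space set \<Rightarrow> real" where
  "lambda1 \<Omega> = Inf {L2_norm_sq \<Omega> g / L2_norm_sq \<Omega> v | v g.
     has_H10_grad \<Omega> v g \<and> \<not> (AE x in lebesgue. x \<in> \<Omega> \<longrightarrow> v x = 0)}"

text \<open>For nonempty bounded open \<open>\<Omega>\<close> the Cheeger constant is finite and positive, so the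
  conversion to a real number loses nothing.\<close>

definition J :: "'a::euclidean_space set \<Rightarrow> real" where
  "J \<Omega> = lambda1 \<Omega> / (real_of_ereal (cheeger \<Omega>))\<^sup>2"

definition support_fun :: "'a::euclidean_space set \<Rightarrow> 'a \<Rightarrow> ereal" where
  "support_fun \<Omega> \<nu> = (SUP x\<in>\<Omega>. ereal (x \<bullet> \<nu>))"

definition width :: "'a::euclidean_space set \<Rightarrow> 'a \<Rightarrow> ereal" where
  "width \<Omega> \<nu> = support_fun \<Omega> \<nu> + support_fun \<Omega> (- \<nu>)"

text \<open>The infimum is attained for nonempty \<open>\<Omega>\<close>: the width is lower semicontinuous in \<open>\<nu>\<close> and
  the unit sphere is compact.\<close>

definition width1 :: "'a::euclidean_space set \<Rightarrow> ereal" where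
  "width1 \<Omega> = (INF \<nu>\<in>sphere 0 1. width \<Omega> \<nu>)"

definition min_width_dirs :: "'a::euclidean_space set \<Rightarrow> 'a set" where
  "min_width_dirs \<Omega> = {u \<in> sphere 0 1. width \<Omega> u = width1 \<Omega>}"

definition width2 :: "'a::euclidean_space set \<Rightarrow> ereal" where
  "width2 \<Omega> = (INF \<nu>\<in>{\<nu> \<in> sphere 0 1. \<exists>u\<in>min_width_dirs \<Omega>. \<nu> \<bullet> u = 0}. width \<Omega> \<nu>)"

definition rel_width :: "'a::euclidean_space set \<Rightarrow> ereal" where
  "rel_width \<Omega> = width1 \<Omega> / width2 \<Omega>"

end

theory Submission
  imports Defs
begin

text \<open>
  Let \<open>w\<close> and \<open>W\<close> be the first and second principal widths of a convex body \<open>K\<close>, and \<open>u\<close> a direction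
  of minimal width. On one hand \<open>K\<close> lies in a slab of thickness \<open>w\<close>; on the other hand, when
  \<open>w / W\<close> is small, \<open>K\<close> contains a box with one side almost \<open>w\<close>, along \<open>u\<close>, and all other sides
  much longer than \<open>w\<close>. Both functionals decrease when the domain grows, so they are squeezed between
  their values for the slab and upper bounds for the box,
  \<open>(\<pi>/w)\<^sup>2 \<le> \<lambda>\<^sub>1 \<le> \<Sum>\<^sub>e (\<pi>/L\<^sub>e)\<^sup>2\<close> and \<open>2/w \<le> h \<le> \<Sum>\<^sub>e 2/L\<^sub>e\<close>, where \<open>L\<^sub>e\<close> are the sides of the box. After
  multiplication by \<open>w\<^sup>2\<close> and \<open>w\<close> only the short side matters in the limit, whence
  \<open>\<lambda>\<^sub>1/h\<^sup>2 \<rightarrow> \<pi>\<^sup>2/4\<close>. The argument works in every dimension \<open>N \<ge> 2\<close>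
  (\<open>J_tendsto_thin_convex_bodies\<close>).

  The box (\<open>convex_body_geometry\<close>). Since every width of \<open>K\<close> is at least \<open>w\<close>, the difference body
  \<open>K - K\<close> contains the ball of radius \<open>w\<close>; so \<open>K\<close> has a chord \<open>w u\<close>. In the same way the
  projection of \<open>K - K\<close> along \<open>u\<close> contains the ball of radius \<open>W\<close> of \<open>u\<^sup>\<bottom>\<close>; so for each \<open>e\<close> of an
  orthonormal basis of \<open>u\<^sup>\<bottom>\<close> there is a chord with projection \<open>W e\<close>, and its component along \<open>u\<close> is
  at most \<open>w\<close>. The Minkowski combination with weight \<open>1 - \<epsilon>\<close> on the first chord and total weight
  \<open>\<epsilon>\<close> on the others is a parallelepiped in \<open>K\<close> which is sheared by at most \<open>\<epsilon> w\<close>. It therefore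
  contains a rectangular box.

  The analysis avoids product measures. It relies on one fact, proved by translation invariance and
  dominated convergence: the integral of a directional derivative is the limit of integrals of
  difference quotients (\<open>integral_difference_quotient_tendsto\<close>); in particular it is zero over the
  whole space for compactly supported functions. The bound \<open>\<lambda>\<^sub>1 \<ge> (\<pi>/w)\<^sup>2\<close> follows by subtracting an
  exact derivative from \<open>(\<partial>\<^sub>u \<phi>)\<^sup>2 - (\<pi>/w)\<^sup>2 \<phi>\<^sup>2\<close> that leaves a square (\<open>poincare_slab\<close>). The upper bound
  for \<open>\<lambda>\<^sub>1\<close> comes from the product of sines on the box, cut off smoothly; again an exact derivative
  accounts for everything in its energy but a vanishing boundary term (\<open>box_directional_energy\<close>).
  For the Cheeger constant, a field of divergence almost \<open>2/w\<close> and norm at most 1 gives the lower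
  bound (\<open>perimeter_ge_slab\<close>), and the box itself is the competitor for the upper bound
  (\<open>perimeter_half_open_box_le\<close>).
\<close>

section \<open>Continuously differentiable functions and integrals of their derivatives\<close>

text \<open>
  The derivative is carried as a parameter so that explicit formulas can be computed with.
\<close>
definition has_C1_derivative ::
    "('a::euclidean_space \<Rightarrow> 'b::real_normed_vector) \<Rightarrow> ('a \<Rightarrow> 'a \<Rightarrow> 'b) \<Rightarrow> bool" where
  "has_C1_derivative f f' \<longleftrightarrow>
     (\<forall>x. (f has_derivative f' x) (at x)) \<and> (\<forall>e. continuous_on UNIV (\<lambda>x. f' x e))"

lemma has_C1_derivativeI:
  assumes "\<And>x. (f has_derivative f' x) (at x)" "\<And>e. continuous_on UNIV (\<lambda>x. f' x e)"
  shows "has_C1_derivative f f'"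
  using assms by (auto simp: has_C1_derivative_def)

lemma has_C1_derivativeD:
  assumes "has_C1_derivative f f'"
  shows "(f has_derivative f' x) (at x)" "continuous_on UNIV (\<lambda>x. f' x e)"
    "continuous_on UNIV f" "linear (f' x)"
proof -
  show 1: "(f has_derivative f' x) (at x)" for x
    using assms by (auto simp: has_C1_derivative_def)
  show "continuous_on UNIV (\<lambda>x. f' x e)"
    using assms by (auto simp: has_C1_derivative_def)
  show "continuous_on UNIV f"
    by (rule continuous_at_imp_continuous_on) (use has_derivative_continuous[OF 1] in simp)
  show "linear (f' x)"
    by (rule has_derivative_linear[OF 1])
qed

lemma C_k_1_iff:
  "C_k 1 f \<longleftrightarrow> has_C1_derivative f (\<lambda>x. frechet_derivative f (at x))"
proof
  assume L: "C_k 1 f"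
  then have d: "(f has_derivative frechet_derivative f (at x)) (at x)" for x
    by (simp add: frechet_derivative_works)
  have c: "continuous_on UNIV (\<lambda>x. frechet_derivative f (at x) i)" if "i \<in> Basis" for i
    using L that by simp
  have lin: "frechet_derivative f (at x) e = (\<Sum>i\<in>Basis. (e \<bullet> i) *\<^sub>R frechet_derivative f (at x) i)" for x e
  proof -
    have "linear (frechet_derivative f (at x))"
      by (rule has_derivative_linear[OF d])
    then have "frechet_derivative f (at x) (\<Sum>i\<in>Basis. (e \<bullet> i) *\<^sub>R i)
        = (\<Sum>i\<in>Basis. (e \<bullet> i) *\<^sub>R frechet_derivative f (at x) i)"
      by (simp add: linear_sum linear_cmul)
    then show ?thesis by (simp add: euclidean_representation)
  qed
  show "has_C1_derivative f (\<lambda>x. frechet_derivative f (at x))"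
  proof (rule has_C1_derivativeI[OF d])
    show "continuous_on UNIV (\<lambda>x. frechet_derivative f (at x) e)" for e
      unfolding lin[of _ e] by (intro continuous_intros c)
  qed
next
  assume "has_C1_derivative f (\<lambda>x. frechet_derivative f (at x))"
  then show "C_k 1 f"
    by (auto simp: has_C1_derivative_def differentiable_def)
qed

lemma has_C1_derivative_frechet:
  assumes "has_C1_derivative f f'"
  shows "frechet_derivative f (at x) = f' x"
  using has_C1_derivativeD(1)[OF assms] frechet_derivative_at by metis

lemma C_k_1I:
  assumes "has_C1_derivative f f'"
  shows "C_k 1 f"
proof -
  have "(\<lambda>x. frechet_derivative f (at x)) = f'"
    by (rule ext) (rule has_C1_derivative_frechet[OF assms])
  then show ?thesis
    unfolding C_k_1_iff using assms by (simp only:)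
qed

lemma supp_outside: "x \<notin> supp f \<Longrightarrow> f x = 0"
  using subsetD[OF closure_subset, of x "{x. f x \<noteq> 0}"] by (auto simp: supp_def)

lemma closed_supp: "closed (supp f)"
  by (simp add: supp_def)

lemma supp_subset_closed:
  assumes "closed K" "\<And>x. x \<notin> K \<Longrightarrow> f x = 0"
  shows "supp f \<subseteq> K"
  unfolding supp_def using assms by (intro closure_minimal) auto

lemma compact_supp_bounded:
  fixes f :: "'a::euclidean_space \<Rightarrow> 'b::real_normed_vector"
  assumes "compact K" "\<And>x. x \<notin> K \<Longrightarrow> f x = 0"
  shows "compact (supp f)"
  using compact_Int_closed[OF assms(1) closed_supp[of f]]
    supp_subset_closed[OF compact_imp_closed[OF assms(1)], of f] assms(2)
  by (simp add: inf.absorb2)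

lemma derivative_outside_supp:
  assumes "x \<notin> supp f" and "(f has_derivative D) (at x)"
  shows "D e = 0"
proof -
  have "((\<lambda>x. 0) has_derivative D) (at x)"
    by (rule has_derivative_transform_within_open[OF assms(2), of "- supp f"])
       (use assms(1) closed_supp in \<open>auto simp: supp_outside\<close>)
  then have "D = (\<lambda>_. 0)"
    using has_derivative_unique[of "\<lambda>x. 0" D x "\<lambda>_. 0"] by auto
  then show ?thesis by simp
qed

lemma continuous_compact_support_bounded:
  fixes f :: "'a::euclidean_space \<Rightarrow> 'b::real_normed_vector"
  assumes "continuous_on UNIV f" "compact K" "\<And>x. x \<notin> K \<Longrightarrow> f x = 0"
  obtains C where "C > 0" "\<And>x. norm (f x) \<le> C"
proof -
  have "bounded (f ` K)"
    by (intro compact_imp_bounded compact_continuous_image continuous_on_subset[OF assms(1)] assms) auto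
  then obtain C where C: "C > 0" "\<And>y. y \<in> f ` K \<Longrightarrow> norm y \<le> C"
    unfolding bounded_pos by auto
  show ?thesis
  proof (rule that[OF C(1)])
    show "norm (f x) \<le> C" for x
      using C assms(3)[of x] by (cases "x \<in> K") auto
  qed
qed

lemma integrable_continuous_compact_support:
  fixes f :: "'a::euclidean_space \<Rightarrow> 'b::euclidean_space"
  assumes "continuous_on UNIV f" "compact K" "\<And>x. x \<notin> K \<Longrightarrow> f x = 0"
  shows "integrable lebesgue f"
proof -
  have "integrable lborel (\<lambda>x. indicator K x *\<^sub>R f x)"
    by (rule borel_integrable_compact[OF assms(2) continuous_on_subset[OF assms(1)]]) auto
  also have "(\<lambda>x. indicator K x *\<^sub>R f x) = f"
    using assms(3) by (auto simp: indicator_def)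
  finally show ?thesis
    by (simp add: integrable_completion assms(1) borel_measurable_continuous_onI)
qed

lemma set_integrable_continuous_bounded:
  fixes f :: "'a::euclidean_space \<Rightarrow> 'b::euclidean_space"
  assumes "continuous_on UNIV f" "bounded S" "S \<in> sets lebesgue"
  shows "set_integrable lebesgue S f"
proof -
  have "compact (closure S)" using assms(2) by simp
  then have "set_integrable lborel (closure S) f"
    unfolding set_integrable_def
    by (rule borel_integrable_compact) (rule continuous_on_subset[OF assms(1)], simp)
  then have "set_integrable lebesgue (closure S) f"
    unfolding set_integrable_def
    by (subst integrable_completion)
       (auto intro!: borel_measurable_continuous_onI assms(1))
  then show ?thesis
    by (rule set_integrable_subset) (use assms closure_subset in auto)
qed

lemma set_integral_eq_integral:
  assumes "\<And>x. x \<notin> S \<Longrightarrow> f x = 0"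
  shows "(LINT x:S|M. f x) = integral\<^sup>L M f" "set_integrable M S f \<longleftrightarrow> integrable M f"
proof -
  have "(\<lambda>x. indicator S x *\<^sub>R f x) = f"
    using assms by (auto simp: indicator_def fun_eq_iff)
  then show "(LINT x:S|M. f x) = integral\<^sup>L M f" "set_integrable M S f \<longleftrightarrow> integrable M f"
    by (simp_all add: set_lebesgue_integral_def set_integrable_def)
qed

lemma set_integral_translate:
  fixes f :: "'a::euclidean_space \<Rightarrow> real"
  assumes "f \<in> borel_measurable borel" "S \<in> sets borel"
  shows "(LINT x:S|lebesgue. f (x + c)) = (LINT x:{x. x - c \<in> S}|lebesgue. f x)"
proof -
  have T[measurable]: "{x. x - c \<in> S} \<in> sets borel"
  proof -
    have "(\<lambda>x. x - c) -` S \<inter> space borel \<in> sets borel"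
      by (rule measurable_sets[OF _ assms(2)]) simp
    then show ?thesis by (simp add: vimage_def)
  qed
  note assms[measurable]
  have "(LINT x:{x. x - c \<in> S}|lebesgue. f x) = (LINT x|lborel. indicator {x. x - c \<in> S} x *\<^sub>R f x)"
    unfolding set_lebesgue_integral_def by (rule integral_completion) simp
  also have "\<dots> = (LINT x|distr lborel borel ((+) c). indicator {x. x - c \<in> S} x *\<^sub>R f x)"
    by (simp only: lborel_distr_plus)
  also have "\<dots> = (LINT x|lborel. indicator {x. x - c \<in> S} (c + x) *\<^sub>R f (c + x))"
    by (rule integral_distr) simp_all
  also have "\<dots> = (LINT x|lborel. indicator S x *\<^sub>R f (x + c))"
    by (simp add: indicator_def add.commute)
  also have "\<dots> = (LINT x:S|lebesgue. f (x + c))"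
    unfolding set_lebesgue_integral_def by (rule integral_completion[symmetric]) simp
  finally show ?thesis by simp
qed

lemma difference_quotient_bound:
  fixes F :: "'a::euclidean_space \<Rightarrow> real"
  assumes F: "has_C1_derivative F F'" and C: "\<And>x. \<bar>F' x e\<bar> \<le> C"
  shows "\<bar>F (x + h *\<^sub>R e) - F x\<bar> \<le> C * \<bar>h\<bar>"
proof -
  have d: "((\<lambda>t. F (x + t *\<^sub>R e)) has_real_derivative F' (x + t *\<^sub>R e) e) (at t)" for t
  proof -
    have "((\<lambda>t. F (x + t *\<^sub>R e)) has_derivative (\<lambda>s. F' (x + t *\<^sub>R e) (s *\<^sub>R e))) (at t)"
      by (rule has_derivative_compose[of "\<lambda>t. x + t *\<^sub>R e", OF _ has_C1_derivativeD(1)[OF F]])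
         (auto intro!: derivative_eq_intros)
    moreover have "F' (x + t *\<^sub>R e) (s *\<^sub>R e) = F' (x + t *\<^sub>R e) e * s" for s
      using has_C1_derivativeD(4)[OF F] by (simp add: linear_cmul)
    ultimately show ?thesis by (simp add: has_field_derivative_def)
  qed
  have "norm (F (x + h *\<^sub>R e) - F (x + 0 *\<^sub>R e)) \<le> C * norm (h - 0)"
    by (rule field_differentiable_bound[of UNIV "\<lambda>t. F (x + t *\<^sub>R e)" "\<lambda>t. F' (x + t *\<^sub>R e) e"])
       (use d C in auto)
  then show ?thesis by simp
qed

text \<open>
  The difference quotients are bounded uniformly because \<open>F' x e\<close> is continuous with compact
  support, so dominated convergence applies on any bounded set. The set \<open>S\<close> is general because the lemma serves
  both a large ball, where the left-hand side vanishes, and a box, where it is a boundary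
  term.
\<close>
lemma integral_difference_quotient_tendsto:
  fixes F :: "'a::euclidean_space \<Rightarrow> real"
  assumes F: "has_C1_derivative F F'" and K: "compact (supp F)"
    and S: "bounded S" "S \<in> sets lebesgue"
    and h: "h \<longlonglongrightarrow> 0" "\<And>n. h n \<noteq> 0"
  shows "(\<lambda>n. (LINT x:S|lebesgue. (F (x + h n *\<^sub>R e) - F x)) / h n)
          \<longlonglongrightarrow> (LINT x:S|lebesgue. F' x e)"
proof -
  obtain C where C: "C > 0" "\<And>x. norm (F' x e) \<le> C"
  proof (rule continuous_compact_support_bounded[OF has_C1_derivativeD(2)[OF F, of e] K])
    show "F' x e = 0" if "x \<notin> supp F" for x
      by (rule derivative_outside_supp[OF that has_C1_derivativeD(1)[OF F]])
  qed blast
  have S': "S \<in> lmeasurable" using S by (simp add: bounded_set_imp_lmeasurable)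
  have Fm: "continuous_on UNIV (\<lambda>x. F (x + h n *\<^sub>R e))" for n
    by (intro continuous_on_compose2[OF has_C1_derivativeD(3)[OF F]] continuous_intros) auto
  have "(\<lambda>n. LINT x|lebesgue. indicator S x *\<^sub>R ((F (x + h n *\<^sub>R e) - F x) / h n))
          \<longlonglongrightarrow> (LINT x|lebesgue. indicator S x *\<^sub>R F' x e)"
  proof (rule integral_dominated_convergence[where w="\<lambda>x. indicator S x *\<^sub>R C"])
    show "(\<lambda>x. indicator S x *\<^sub>R F' x e) \<in> borel_measurable lebesgue"
      using set_integrable_continuous_bounded[OF has_C1_derivativeD(2)[OF F] S, of e]
      unfolding set_integrable_def by (rule borel_measurable_integrable)
    show "(\<lambda>x. indicator S x *\<^sub>R ((F (x + h n *\<^sub>R e) - F x) / h n)) \<in> borel_measurable lebesgue" for n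
    proof -
      have "set_integrable lebesgue S (\<lambda>x. (F (x + h n *\<^sub>R e) - F x) / h n)"
        by (rule set_integrable_continuous_bounded[OF _ S])
           (use Fm has_C1_derivativeD(3)[OF F] h in \<open>auto intro!: continuous_intros\<close>)
      then show ?thesis
        unfolding set_integrable_def by (rule borel_measurable_integrable)
    qed
    show "integrable lebesgue (\<lambda>x. indicator S x *\<^sub>R C)"
      by (rule integrable_scaleR_left, rule integrable_real_indicator)
         (use S' in \<open>auto simp: fmeasurable_def\<close>)
    show "AE x in lebesgue. (\<lambda>n. indicator S x *\<^sub>R ((F (x + h n *\<^sub>R e) - F x) / h n))
            \<longlonglongrightarrow> indicator S x *\<^sub>R F' x e"
    proof (rule AE_I2, rule tendsto_scaleR[OF tendsto_const])
      fix x
      have "((\<lambda>t. F (x + t *\<^sub>R e)) has_derivative (\<lambda>s. F' (x + 0 *\<^sub>R e) (s *\<^sub>R e))) (at 0)"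
        by (rule has_derivative_compose[of "\<lambda>t. x + t *\<^sub>R e", OF _ has_C1_derivativeD(1)[OF F]])
           (auto intro!: derivative_eq_intros)
      moreover have "F' x (s *\<^sub>R e) = F' x e * s" for s
        using has_C1_derivativeD(4)[OF F] by (simp add: linear_cmul)
      ultimately have "((\<lambda>t. F (x + t *\<^sub>R e)) has_real_derivative F' x e) (at 0)"
        by (simp add: has_field_derivative_def)
      then have "(\<lambda>t. (F (x + t *\<^sub>R e) - F x) / t) \<midarrow>0\<rightarrow> F' x e"
        by (simp add: DERIV_def)
      then show "(\<lambda>n. (F (x + h n *\<^sub>R e) - F x) / h n) \<longlonglongrightarrow> F' x e"
        by (rule filterlim_compose) (use h in \<open>auto simp: filterlim_at\<close>)
    qed
    show "AE x in lebesgue. norm (indicator S x *\<^sub>R ((F (x + h n *\<^sub>R e) - F x) / h n)) \<le> indicator S x *\<^sub>R C" for n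
    proof (rule AE_I2)
      fix x
      have "\<bar>F (x + h n *\<^sub>R e) - F x\<bar> \<le> C * \<bar>h n\<bar>"
        using difference_quotient_bound[OF F] C(2) by simp
      then have "\<bar>(F (x + h n *\<^sub>R e) - F x) / h n\<bar> \<le> C"
        using h(2)[of n] by (simp add: abs_divide divide_le_eq)
      then show "norm (indicator S x *\<^sub>R ((F (x + h n *\<^sub>R e) - F x) / h n)) \<le> indicator S x *\<^sub>R C"
        by (auto simp: indicator_def)
    qed
  qed
  then show ?thesis
    by (simp add: set_lebesgue_integral_def)
qed

text \<open>
  On a ball so large that small translates of \<open>F\<close> still live inside it, the integral of
  \<open>F (x + h e) - F x\<close> is zero by translation invariance.
\<close>
lemma integral_directional_derivative_zero:
  fixes F :: "'a::euclidean_space \<Rightarrow> real"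
  assumes F: "has_C1_derivative F F'" and K: "compact (supp F)"
  shows "(LINT x|lebesgue. F' x e) = 0"
proof -
  obtain R where R: "R > 0" "supp F \<subseteq> ball 0 R"
    using K compact_imp_bounded bounded_subset_ballD by blast
  define S :: "'a set" where "S = ball 0 (R + norm e)"
  have S: "bounded S" "S \<in> sets lebesgue" "S \<in> sets borel" by (auto simp: S_def)
  have out: "F x = 0" if "x \<notin> ball 0 R" for x
    using R that by (auto intro: supp_outside)
  have BS: "ball 0 R \<subseteq> S" by (simp add: S_def ball_subset_ball_iff)
  have out1: "F x = 0" if "x \<notin> S" for x
    using that BS by (intro out) auto
  define h where "h n = 1 / real (Suc n)" for n
  have h: "h \<longlonglongrightarrow> 0" "\<And>n. h n \<noteq> 0" "\<And>n. 0 \<le> h n \<and> h n \<le> 1"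
    using LIMSEQ_Suc[OF lim_1_over_n] by (auto simp: h_def[abs_def])
  have out2: "x + h n *\<^sub>R e \<notin> ball 0 R" if "x \<notin> S" for x n
  proof -
    have "norm x \<le> norm (x + h n *\<^sub>R e) + norm (h n *\<^sub>R e)"
      by (metis add_diff_cancel norm_triangle_ineq4)
    moreover have "norm (h n *\<^sub>R e) \<le> norm e"
      using h(3)[of n] by (simp add: mult_left_le_one_le)
    ultimately show ?thesis using that by (auto simp: S_def)
  qed
  have Fm: "continuous_on UNIV F" using F has_C1_derivativeD by blast
  have Fm': "continuous_on UNIV (\<lambda>x. F (x + h n *\<^sub>R e))" for n
    by (intro continuous_on_compose2[OF Fm] continuous_intros) auto
  have z: "(LINT x:S|lebesgue. (F (x + h n *\<^sub>R e) - F x)) = 0" for n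
  proof -
    have "(LINT x:S|lebesgue. (F (x + h n *\<^sub>R e) - F x))
        = (LINT x:S|lebesgue. F (x + h n *\<^sub>R e)) - (LINT x:S|lebesgue. F x)"
      by (intro set_integral_diff set_integrable_continuous_bounded Fm Fm' S)
    also have "(LINT x:S|lebesgue. F (x + h n *\<^sub>R e)) = (LINT x:UNIV|lebesgue. F (x + h n *\<^sub>R e))"
      by (subst (1 2) set_integral_eq_integral) (use out out2 in auto)
    also have "\<dots> = (LINT x:UNIV|lebesgue. F x)"
      by (subst set_integral_translate) (auto intro: borel_measurable_continuous_onI Fm)
    also have "\<dots> = (LINT x:S|lebesgue. F x)"
      by (subst (1 2) set_integral_eq_integral) (use out1 in auto)
    finally show ?thesis by simp
  qed
  have "(\<lambda>n. (LINT x:S|lebesgue. (F (x + h n *\<^sub>R e) - F x)) / h n)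
          \<longlonglongrightarrow> (LINT x:S|lebesgue. F' x e)"
    by (rule integral_difference_quotient_tendsto[OF F K S(1,2) h(1,2)])
  then have "(LINT x:S|lebesgue. F' x e) = 0"
    using LIMSEQ_unique[OF _ tendsto_const] by (simp add: z)
  moreover have "F' x e = 0" if "x \<notin> S" for x
  proof (rule derivative_outside_supp[OF _ has_C1_derivativeD(1)[OF F]])
    show "x \<notin> supp F" using that R BS by auto
  qed
  ultimately show ?thesis
    by (simp add: set_integral_eq_integral)
qed

lemma has_C1_derivative_affine:
  "has_C1_derivative (\<lambda>x::'a::euclidean_space. x \<bullet> v + c) (\<lambda>x e. e \<bullet> v)"
  by (rule has_C1_derivativeI) (auto intro!: derivative_eq_intros continuous_intros)

lemma has_C1_derivative_mult:
  fixes f g :: "'a::euclidean_space \<Rightarrow> real"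
  assumes f: "has_C1_derivative f f'" and g: "has_C1_derivative g g'"
  shows "has_C1_derivative (\<lambda>x. f x * g x) (\<lambda>x e. f x * g' x e + f' x e * g x)"
proof (rule has_C1_derivativeI)
  show "((\<lambda>x. f x * g x) has_derivative (\<lambda>e. f x * g' x e + f' x e * g x)) (at x)" for x
    by (rule has_derivative_mult[OF has_C1_derivativeD(1)[OF f] has_C1_derivativeD(1)[OF g]])
  show "continuous_on UNIV (\<lambda>x. f x * g' x e + f' x e * g x)" for e
    by (intro continuous_intros has_C1_derivativeD(2,3)[OF f] has_C1_derivativeD(2,3)[OF g])
qed

lemma has_C1_derivative_scaleR:
  fixes f :: "'a::euclidean_space \<Rightarrow> real"
  assumes f: "has_C1_derivative f f'"
  shows "has_C1_derivative (\<lambda>x. f x *\<^sub>R u) (\<lambda>x e. f' x e *\<^sub>R u)"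
proof (rule has_C1_derivativeI)
  show "((\<lambda>x. f x *\<^sub>R u) has_derivative (\<lambda>e. f' x e *\<^sub>R u)) (at x)" for x
    using has_C1_derivativeD(1)[OF f] by (intro derivative_intros)
  show "continuous_on UNIV (\<lambda>x. f' x e *\<^sub>R u)" for e
    by (intro continuous_intros has_C1_derivativeD(2)[OF f])
qed

lemma has_C1_derivative_inner_left:
  fixes f :: "'a::euclidean_space \<Rightarrow> 'a"
  assumes f: "has_C1_derivative f f'"
  shows "has_C1_derivative (\<lambda>x. f x \<bullet> u) (\<lambda>x e. f' x e \<bullet> u)"
proof (rule has_C1_derivativeI)
  show "((\<lambda>x. f x \<bullet> u) has_derivative (\<lambda>e. f' x e \<bullet> u)) (at x)" for x
    using has_C1_derivativeD(1)[OF f] by (rule has_derivative_inner_left)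
  show "continuous_on UNIV (\<lambda>x. f' x e \<bullet> u)" for e
    by (intro continuous_intros has_C1_derivativeD(2)[OF f])
qed

lemma has_C1_derivative_compose:
  fixes f :: "'a::euclidean_space \<Rightarrow> real"
  assumes f: "has_C1_derivative f f'"
    and h: "\<And>t. (h has_real_derivative h' t) (at t)" "continuous_on UNIV h'"
  shows "has_C1_derivative (\<lambda>x. h (f x)) (\<lambda>x e. h' (f x) * f' x e)"
proof (rule has_C1_derivativeI)
  show "((\<lambda>x. h (f x)) has_derivative (\<lambda>e. h' (f x) * f' x e)) (at x)" for x
    using has_derivative_compose[OF has_C1_derivativeD(1)[OF f, of x], of h "(*) (h' (f x))"]
      h(1)[of "f x"] by (simp add: has_field_derivative_def)
  show "continuous_on UNIV (\<lambda>x. h' (f x) * f' x e)" for e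
    by (intro continuous_intros has_C1_derivativeD(2,3)[OF f] continuous_on_compose2[OF h(2)]) auto
qed

lemma grad_inner:
  fixes f :: "'a::euclidean_space \<Rightarrow> real"
  assumes f: "has_C1_derivative f f'"
  shows "grad f x \<bullet> e = f' x e"
proof -
  have "f' x (\<Sum>i\<in>Basis. (e \<bullet> i) *\<^sub>R i) = (\<Sum>i\<in>Basis. (e \<bullet> i) *\<^sub>R f' x i)"
    using has_C1_derivativeD(4)[OF f] by (simp add: linear_sum linear_cmul)
  then show ?thesis
    by (simp add: euclidean_representation grad_def has_C1_derivative_frechet[OF f]
        inner_sum_right inner_commute[of _ e] mult.commute)
qed

lemma continuous_on_grad:
  fixes f :: "'a::euclidean_space \<Rightarrow> real"
  assumes f: "has_C1_derivative f f'"
  shows "continuous_on UNIV (grad f)"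
proof -
  have "grad f = (\<lambda>x. \<Sum>i\<in>Basis. f' x i *\<^sub>R i)"
    by (rule ext) (simp add: grad_def has_C1_derivative_frechet[OF f])
  then show ?thesis
    by (auto intro!: continuous_intros has_C1_derivativeD(2)[OF f])
qed

lemma grad_outside_supp:
  fixes f :: "'a::euclidean_space \<Rightarrow> real"
  assumes f: "has_C1_derivative f f'" and "x \<notin> supp f"
  shows "grad f x = 0"
proof (rule euclidean_eqI)
  show "grad f x \<bullet> e = 0 \<bullet> e" for e
    using derivative_outside_supp[OF assms(2) has_C1_derivativeD(1)[OF f]] grad_inner[OF f] by simp
qed

lemma Cc_infD:
  assumes "f \<in> Cc_inf \<Omega>"
  shows "has_C1_derivative f (\<lambda>x. frechet_derivative f (at x))" "compact (supp f)" "supp f \<subseteq> \<Omega>"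
proof -
  have "C_k 1 f" using assms unfolding Cc_inf_def by blast
  then show "has_C1_derivative f (\<lambda>x. frechet_derivative f (at x))" by (simp only: C_k_1_iff)
qed (use assms in \<open>auto simp: Cc_inf_def\<close>)

section \<open>Bounds for the first eigenvalue\<close>

text \<open>
  With \<open>k = \<pi>/w\<close> and \<open>c = k cot (k (x \<bullet> u - a))\<close>, which solves the Riccati equation
  \<open>\<partial>\<^sub>u c = - k\<^sup>2 - c\<^sup>2\<close> in the slab, one has
  \<open>(\<partial>\<^sub>u \<phi>)\<^sup>2 - k\<^sup>2 \<phi>\<^sup>2 - \<partial>\<^sub>u (\<phi>\<^sup>2 c) = (\<partial>\<^sub>u \<phi> - c \<phi>)\<^sup>2 \<ge> 0\<close>, and the exact derivative integrates to zero.
  The poles of \<open>c\<close> lie on the boundary of the slab, off the support of \<open>\<phi>\<close>.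
\<close>
lemma poincare_slab:
  fixes \<phi> :: "'a::euclidean_space \<Rightarrow> real"
  assumes \<phi>: "has_C1_derivative \<phi> \<phi>'" and K: "compact (supp \<phi>)"
    and slab: "supp \<phi> \<subseteq> {x. a < x \<bullet> u \<and> x \<bullet> u < a + w}" and u: "norm u = 1" and w: "w > 0"
  shows "(pi / w)\<^sup>2 * (LINT x|lebesgue. (\<phi> x)\<^sup>2) \<le> (LINT x|lebesgue. (\<phi>' x u)\<^sup>2)"
proof -
  define k where "k = pi / w"
  define c where "c x = k * cot (k * (x \<bullet> u - a))" for x
  define G where "G x = (\<phi> x)\<^sup>2 * c x" for x
  define G' where "G' x e = 2 * \<phi> x * \<phi>' x e * c x - (\<phi> x)\<^sup>2 * (k\<^sup>2 / (sin (k * (x \<bullet> u - a)))\<^sup>2 * (e \<bullet> u))"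
    for x e
  define U where "U = {x. a < x \<bullet> u \<and> x \<bullet> u < a + w}"
  have U: "open U"
    unfolding U_def by (intro open_Collect_conj open_Collect_less continuous_intros)
  have sin: "sin (k * (x \<bullet> u - a)) > 0" if "x \<in> U" for x
  proof (rule sin_gt_zero)
    show "0 < k * (x \<bullet> u - a)" using that w by (simp add: U_def k_def)
    have "k * (x \<bullet> u - a) < k * w"
      using that w by (intro mult_strict_left_mono) (auto simp: U_def k_def)
    then show "k * (x \<bullet> u - a) < pi" using w by (simp add: k_def)
  qed
  have z: "\<phi> x = 0" "\<phi>' x e = 0" if "x \<notin> supp \<phi>" for x e
    using that supp_outside derivative_outside_supp[OF _ has_C1_derivativeD(1)[OF \<phi>]] by auto
  have cover: "x \<in> U \<or> x \<in> - supp \<phi>" for x using slab by (auto simp: U_def)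
  have dU: "(G has_derivative G' x) (at x)" if "x \<in> U" for x
  proof -
    have "(c has_derivative (\<lambda>e. k * (- inverse ((sin (k * (x \<bullet> u - a)))\<^sup>2) * (k * (e \<bullet> u))))) (at x)"
    proof -
      have "((\<lambda>x. cot (k * (x \<bullet> u - a))) has_derivative
          (\<lambda>e. - inverse ((sin (k * (x \<bullet> u - a)))\<^sup>2) * (k * (e \<bullet> u)))) (at x)"
      proof (rule has_derivative_compose[where g=cot and f="\<lambda>x. k * (x \<bullet> u - a)"
            and f'="\<lambda>e. k * (e \<bullet> u)" and g'="(*) (- inverse ((sin (k * (x \<bullet> u - a)))\<^sup>2))"])
        show "((\<lambda>x. k * (x \<bullet> u - a)) has_derivative (\<lambda>e. k * (e \<bullet> u))) (at x)"
          by (auto intro!: derivative_eq_intros)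
        show "(cot has_derivative (*) (- inverse ((sin (k * (x \<bullet> u - a)))\<^sup>2))) (at (k * (x \<bullet> u - a)))"
          using DERIV_cot[of "k * (x \<bullet> u - a)"] sin[OF that] by (simp add: has_field_derivative_def)
      qed
      then show ?thesis unfolding c_def[abs_def] by (rule has_derivative_mult_right)
    qed
    then have "(G has_derivative (\<lambda>e. (\<phi> x)\<^sup>2 * (k * (- inverse ((sin (k * (x \<bullet> u - a)))\<^sup>2) * (k * (e \<bullet> u))))
        + (2 * \<phi> x * \<phi>' x e) * c x)) (at x)"
      unfolding G_def[abs_def] by (auto intro!: derivative_eq_intros has_C1_derivativeD(1)[OF \<phi>])
    moreover have "(\<lambda>e. (\<phi> x)\<^sup>2 * (k * (- inverse ((sin (k * (x \<bullet> u - a)))\<^sup>2) * (k * (e \<bullet> u))))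
        + (2 * \<phi> x * \<phi>' x e) * c x) = G' x"
      by (auto simp: G'_def fun_eq_iff power2_eq_square divide_inverse)
    ultimately show ?thesis by simp
  qed
  \<comment> \<open>Off the support both formulas vanish, whatever the value of the cotangent.\<close>
  have dS: "(G has_derivative G' x) (at x)" if "x \<in> - supp \<phi>" for x
  proof -
    have "((\<lambda>x. 0) has_derivative (\<lambda>e. 0)) (at x)" by simp
    then have "(G has_derivative (\<lambda>e. 0)) (at x)"
      by (rule has_derivative_transform_within_open[of _ _ _ _ "- supp \<phi>"])
         (use that closed_supp in \<open>auto simp: G_def z\<close>)
    then show ?thesis using that by (simp add: G'_def[abs_def] z)
  qed
  have G: "has_C1_derivative G G'"
  proof (rule has_C1_derivativeI)
    show "(G has_derivative G' x) (at x)" for x using cover[of x] dU dS by blast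
    show "continuous_on UNIV (\<lambda>x. G' x e)" for e
    proof -
      have cU: "continuous_on U (\<lambda>x. G' x e)"
        unfolding G'_def c_def cot_def
        by (intro continuous_intros continuous_on_subset[OF has_C1_derivativeD(2)[OF \<phi>]]
            continuous_on_subset[OF has_C1_derivativeD(3)[OF \<phi>]]) (auto dest!: sin)
      have cS: "continuous_on (- supp \<phi>) (\<lambda>x. G' x e)"
        by (rule continuous_on_eq[of _ "\<lambda>x. 0"]) (auto simp: G'_def z)
      have "continuous_on (U \<union> - supp \<phi>) (\<lambda>x. G' x e)"
        by (rule continuous_on_open_Un[OF U _ cU cS]) (use closed_supp in auto)
      moreover have "U \<union> - supp \<phi> = UNIV" using cover by auto
      ultimately show ?thesis by simp
    qed
  qed
  have sG: "compact (supp G)"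
    by (rule compact_supp_bounded[OF K]) (simp add: G_def z)
  have i1: "integrable lebesgue (\<lambda>x. (\<phi>' x u)\<^sup>2)"
    by (rule integrable_continuous_compact_support[OF _ K])
       (auto intro!: continuous_intros has_C1_derivativeD[OF \<phi>] simp: z)
  have i2: "integrable lebesgue (\<lambda>x. (\<phi> x)\<^sup>2)"
    by (rule integrable_continuous_compact_support[OF _ K])
       (auto intro!: continuous_intros has_C1_derivativeD[OF \<phi>] simp: z)
  have i3: "integrable lebesgue (\<lambda>x. G' x u)"
    by (rule integrable_continuous_compact_support[OF has_C1_derivativeD(2)[OF G] K])
       (simp add: z G'_def)
  \<comment> \<open>The difference of the two sides is a square, by completing it with the Riccati equation.\<close>
  have le: "k\<^sup>2 * (\<phi> x)\<^sup>2 + G' x u \<le> (\<phi>' x u)\<^sup>2" for x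
  proof (cases "x \<in> U")
    case True
    define s where "s = sin (k * (x \<bullet> u - a))"
    define C where "C = cos (k * (x \<bullet> u - a))"
    have s: "s > 0" "s\<^sup>2 + C\<^sup>2 = 1" using sin[OF True] by (auto simp: s_def C_def)
    have "u \<bullet> u = 1" using u by (simp add: dot_square_norm)
    then have "(\<phi>' x u)\<^sup>2 - k\<^sup>2 * (\<phi> x)\<^sup>2 - G' x u
        = (\<phi>' x u)\<^sup>2 - k\<^sup>2 * (\<phi> x)\<^sup>2 - 2 * \<phi> x * \<phi>' x u * (k * (C / s)) + (\<phi> x)\<^sup>2 * (k\<^sup>2 * ((s\<^sup>2 + C\<^sup>2) / s\<^sup>2))"
      using s by (simp add: G'_def c_def cot_def flip: s_def C_def)
    also have "(s\<^sup>2 + C\<^sup>2) / s\<^sup>2 = 1 + (C / s)\<^sup>2"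
      using s(1) by (simp add: field_simps)
    also have "(\<phi>' x u)\<^sup>2 - k\<^sup>2 * (\<phi> x)\<^sup>2 - 2 * \<phi> x * \<phi>' x u * (k * (C / s)) + (\<phi> x)\<^sup>2 * (k\<^sup>2 * (1 + (C / s)\<^sup>2))
        = (\<phi>' x u - k * (C / s) * \<phi> x)\<^sup>2"
      by (simp only: power2_eq_square) (simp add: algebra_simps)
    finally have "(\<phi>' x u)\<^sup>2 - k\<^sup>2 * (\<phi> x)\<^sup>2 - G' x u = (\<phi>' x u - k * (C / s) * \<phi> x)\<^sup>2" .
    then show ?thesis
      using zero_le_power2[of "\<phi>' x u - k * (C / s) * \<phi> x"] by linarith
  next
    case False
    then show ?thesis using cover[of x] by (simp add: z G'_def)
  qed
  have "k\<^sup>2 * (LINT x|lebesgue. (\<phi> x)\<^sup>2) = k\<^sup>2 * (LINT x|lebesgue. (\<phi> x)\<^sup>2) + (LINT x|lebesgue. G' x u)"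
    using integral_directional_derivative_zero[OF G sG] by simp
  also have "\<dots> = (LINT x|lebesgue. k\<^sup>2 * (\<phi> x)\<^sup>2 + G' x u)"
    using i2 i3 by simp
  also have "\<dots> \<le> (LINT x|lebesgue. (\<phi>' x u)\<^sup>2)"
    by (rule integral_mono) (use i1 i2 i3 le in auto)
  finally show ?thesis by (simp add: k_def)
qed

lemma L2_on_continuous:
  fixes f :: "'a::euclidean_space \<Rightarrow> 'b::euclidean_space"
  assumes f: "continuous_on UNIV f" "compact K" "\<And>x. x \<notin> K \<Longrightarrow> f x = 0" and "\<Omega> \<in> sets lebesgue"
  shows "L2_on \<Omega> f"
proof -
  have "f \<in> borel_measurable lebesgue"
    using f(1) by (intro measurable_completion) (simp add: borel_measurable_continuous_onI)
  then have "set_borel_measurable lebesgue \<Omega> f"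
    using assms(4) unfolding set_borel_measurable_def by simp
  moreover have "integrable lebesgue (\<lambda>x. (norm (f x))\<^sup>2)"
    by (rule integrable_continuous_compact_support[OF _ f(2)])
       (use f in \<open>auto intro!: continuous_intros\<close>)
  then have "set_integrable lebesgue \<Omega> (\<lambda>x. (norm (f x))\<^sup>2)"
    using integrable_mult_indicator[OF assms(4)] by (simp only: set_integrable_def)
  ultimately show ?thesis by (simp add: L2_on_def)
qed

text \<open>
  A triangle inequality for squared norms, by \<open>2 p q \<le> \<eta> p\<^sup>2 + q\<^sup>2 / \<eta>\<close>. With \<open>\<eta>\<close> fixed it passes to the
  limit along an approximating sequence without square roots.
\<close>
lemma L2_norm_sq_approx:
  fixes f g :: "'a::euclidean_space \<Rightarrow> 'b::euclidean_space"
  assumes f: "L2_on \<Omega> f" and g: "L2_on \<Omega> g" and \<eta>: "\<eta> > 0"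
  shows "L2_norm_sq \<Omega> f \<le> (1 + \<eta>) * L2_norm_sq \<Omega> g + (1 + 1 / \<eta>) * L2_norm_sq \<Omega> (\<lambda>x. g x - f x)"
proof -
  have sq: "(p + q)\<^sup>2 \<le> (1 + \<eta>) * p\<^sup>2 + (1 + 1 / \<eta>) * q\<^sup>2" for p q :: real
  proof -
    have "0 \<le> (\<eta> * p - q)\<^sup>2 / \<eta>" using \<eta> by simp
    also have "\<dots> = \<eta> * p\<^sup>2 + 1 / \<eta> * q\<^sup>2 - 2 * p * q"
      using \<eta> by (simp add: field_simps power2_eq_square)
    finally show ?thesis by (simp add: algebra_simps power2_sum)
  qed
  have pt: "(norm (f x))\<^sup>2 \<le> (1 + \<eta>) * (norm (g x))\<^sup>2 + (1 + 1 / \<eta>) * (norm (g x - f x))\<^sup>2" for x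
  proof -
    have "norm (f x) \<le> norm (g x) + norm (g x - f x)"
      by (metis norm_minus_commute norm_triangle_sub)
    then have "(norm (f x))\<^sup>2 \<le> (norm (g x) + norm (g x - f x))\<^sup>2"
      by (intro power_mono) auto
    then show ?thesis using sq[of "norm (g x)" "norm (g x - f x)"] by linarith
  qed
  have pt2: "(norm (g x - f x))\<^sup>2 \<le> 2 * (norm (g x))\<^sup>2 + 2 * (norm (f x))\<^sup>2" for x
  proof -
    have "(norm (g x - f x))\<^sup>2 \<le> (norm (g x) + norm (f x))\<^sup>2"
      by (intro power_mono norm_triangle_ineq4) auto
    also have "\<dots> \<le> 2 * (norm (g x))\<^sup>2 + 2 * (norm (f x))\<^sup>2"
      using sum_squares_ge_zero zero_le_power2[of "norm (g x) - norm (f x)"]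
      by (simp add: power2_eq_square algebra_simps)
    finally show ?thesis .
  qed
  have f2: "set_integrable lebesgue \<Omega> (\<lambda>x. (norm (f x))\<^sup>2)"
    and g2: "set_integrable lebesgue \<Omega> (\<lambda>x. (norm (g x))\<^sup>2)"
    and fm: "(\<lambda>x. indicator \<Omega> x *\<^sub>R f x) \<in> borel_measurable lebesgue"
    and gm: "(\<lambda>x. indicator \<Omega> x *\<^sub>R g x) \<in> borel_measurable lebesgue"
    using f g by (auto simp: L2_on_def set_borel_measurable_def)
  have d2: "set_integrable lebesgue \<Omega> (\<lambda>x. (norm (g x - f x))\<^sup>2)"
    unfolding set_integrable_def
  proof (rule Bochner_Integration.integrable_bound)
    show "integrable lebesgue (\<lambda>x. 2 * (indicator \<Omega> x *\<^sub>R (norm (g x))\<^sup>2) + 2 * (indicator \<Omega> x *\<^sub>R (norm (f x))\<^sup>2))"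
      using f2 g2 unfolding set_integrable_def by simp
    have "(\<lambda>x. indicator \<Omega> x *\<^sub>R (norm (g x - f x))\<^sup>2)
        = (\<lambda>x. (norm (indicator \<Omega> x *\<^sub>R g x - indicator \<Omega> x *\<^sub>R f x))\<^sup>2)"
      by (auto simp: indicator_def)
    then show "(\<lambda>x. indicator \<Omega> x *\<^sub>R (norm (g x - f x))\<^sup>2) \<in> borel_measurable lebesgue"
      using fm gm by simp
    show "AE x in lebesgue. norm (indicator \<Omega> x *\<^sub>R (norm (g x - f x))\<^sup>2)
        \<le> norm (2 * (indicator \<Omega> x *\<^sub>R (norm (g x))\<^sup>2) + 2 * (indicator \<Omega> x *\<^sub>R (norm (f x))\<^sup>2))"
      by (rule AE_I2) (use pt2 in \<open>auto simp: indicator_def\<close>)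
  qed
  have "L2_norm_sq \<Omega> f
      \<le> (LINT x:\<Omega>|lebesgue. (1 + \<eta>) * (norm (g x))\<^sup>2 + (1 + 1 / \<eta>) * (norm (g x - f x))\<^sup>2)"
    unfolding L2_norm_sq_def by (rule set_integral_mono) (use f2 g2 d2 pt in auto)
  also have "\<dots> = (1 + \<eta>) * L2_norm_sq \<Omega> g + (1 + 1 / \<eta>) * L2_norm_sq \<Omega> (\<lambda>x. g x - f x)"
    unfolding L2_norm_sq_def using g2 d2 by (subst set_integral_add) auto
  finally show ?thesis .
qed

lemma L2_norm_sq_nonneg: "L2_norm_sq \<Omega> f \<ge> 0"
  unfolding L2_norm_sq_def set_lebesgue_integral_def by (rule integral_nonneg_AE) (simp add: indicator_def)

lemma L2_norm_sq_pos:
  assumes "L2_on \<Omega> v" "\<not> (AE x in lebesgue. x \<in> \<Omega> \<longrightarrow> v x = 0)"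
  shows "L2_norm_sq \<Omega> v > 0"
proof -
  have "L2_norm_sq \<Omega> v = 0 \<longleftrightarrow> (AE x in lebesgue. indicator \<Omega> x *\<^sub>R (norm (v x))\<^sup>2 = 0)"
    unfolding L2_norm_sq_def set_lebesgue_integral_def
    by (rule integral_nonneg_eq_0_iff_AE)
       (use assms(1) in \<open>auto simp: L2_on_def set_integrable_def indicator_def\<close>)
  also have "\<dots> \<longleftrightarrow> (AE x in lebesgue. x \<in> \<Omega> \<longrightarrow> v x = 0)"
    by (intro AE_cong) (auto simp: indicator_def)
  finally show ?thesis using assms(2) L2_norm_sq_nonneg[of \<Omega> v] by linarith
qed

lemma L2_norm_sq_supp:
  assumes "\<And>x. x \<notin> \<Omega> \<Longrightarrow> f x = 0"
  shows "L2_norm_sq \<Omega> f = (LINT x|lebesgue. (norm (f x))\<^sup>2)"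
  unfolding L2_norm_sq_def by (rule set_integral_eq_integral) (simp add: assms)

lemma poincare_slab_Cc_inf:
  assumes \<phi>: "\<phi> \<in> Cc_inf \<Omega>" and slab: "\<Omega> \<subseteq> {x. a < x \<bullet> u \<and> x \<bullet> u < a + w}"
    and u: "norm u = 1" and w: "w > 0"
  shows "(pi / w)\<^sup>2 * L2_norm_sq \<Omega> \<phi> \<le> L2_norm_sq \<Omega> (grad \<phi>)"
proof -
  note D = Cc_infD[OF \<phi>]
  have out: "\<phi> x = 0" "grad \<phi> x = 0" if "x \<notin> \<Omega>" for x
    using that D(3) supp_outside grad_outside_supp[OF D(1)] by auto
  have i1: "integrable lebesgue (\<lambda>x. (norm (grad \<phi> x))\<^sup>2)"
    by (rule integrable_continuous_compact_support[OF _ D(2)])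
       (use continuous_on_grad[OF D(1)] grad_outside_supp[OF D(1)] in \<open>auto intro!: continuous_intros\<close>)
  have i2: "integrable lebesgue (\<lambda>x. (grad \<phi> x \<bullet> u)\<^sup>2)"
    by (rule integrable_continuous_compact_support[OF _ D(2)])
       (use continuous_on_grad[OF D(1)] grad_outside_supp[OF D(1)] in \<open>auto intro!: continuous_intros\<close>)
  have "(pi / w)\<^sup>2 * L2_norm_sq \<Omega> \<phi> = (pi / w)\<^sup>2 * (LINT x|lebesgue. (\<phi> x)\<^sup>2)"
    by (simp add: L2_norm_sq_supp out)
  also have "\<dots> \<le> (LINT x|lebesgue. (grad \<phi> x \<bullet> u)\<^sup>2)"
    using poincare_slab[OF D(1,2) subset_trans[OF D(3) slab] u w] by (simp add: grad_inner[OF D(1)])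
  also have "\<dots> \<le> (LINT x|lebesgue. (norm (grad \<phi> x))\<^sup>2)"
  proof (rule integral_mono[OF i2 i1])
    show "(grad \<phi> x \<bullet> u)\<^sup>2 \<le> (norm (grad \<phi> x))\<^sup>2" for x
      using Cauchy_Schwarz_ineq2[of "grad \<phi> x" u] u by (simp add: power2_le_iff_abs_le)
  qed
  also have "\<dots> = L2_norm_sq \<Omega> (grad \<phi>)"
    by (simp add: L2_norm_sq_supp out)
  finally show ?thesis .
qed

text \<open>
  The inequality for test functions survives the closure: it holds up to a factor \<open>(1 + \<eta>)\<^sup>2\<close> after
  the limit of the approximating sequence, and then \<open>\<eta> \<rightarrow> 0\<close>.
\<close>
lemma poincare_slab_H10:
  assumes v: "has_H10_grad \<Omega> v g" and \<Omega>: "\<Omega> \<in> sets lebesgue"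
    and slab: "\<Omega> \<subseteq> {x. a < x \<bullet> u \<and> x \<bullet> u < a + w}" and u: "norm u = 1" and w: "w > 0"
  shows "(pi / w)\<^sup>2 * L2_norm_sq \<Omega> v \<le> L2_norm_sq \<Omega> g"
proof -
  define k where "k = (pi / w)\<^sup>2"
  have k: "k \<ge> 0" by (simp add: k_def)
  obtain \<phi> where \<phi>: "\<And>n::nat. \<phi> n \<in> Cc_inf \<Omega>"
    and lim: "(\<lambda>n. L2_norm_sq \<Omega> (\<lambda>x. \<phi> n x - v x) + L2_norm_sq \<Omega> (\<lambda>x. grad (\<phi> n) x - g x)) \<longlonglongrightarrow> 0"
    using v by (auto simp: has_H10_grad_def)
  have v2: "L2_on \<Omega> v" and g2: "L2_on \<Omega> g"
    using v by (auto simp: has_H10_grad_def has_H1_grad_def)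
  define A where "A n = L2_norm_sq \<Omega> (\<lambda>x. \<phi> n x - v x)" for n
  define B where "B n = L2_norm_sq \<Omega> (\<lambda>x. grad (\<phi> n) x - g x)" for n
  have AB: "(\<lambda>n. A n + B n) \<longlonglongrightarrow> 0" using lim by (simp add: A_def B_def)
  have A: "A \<longlonglongrightarrow> 0" and B: "B \<longlonglongrightarrow> 0"
    by (rule tendsto_sandwich[OF _ _ tendsto_const AB];
        simp add: A_def B_def L2_norm_sq_nonneg)+
  have main: "k * L2_norm_sq \<Omega> v \<le> (1 + \<eta>)\<^sup>2 * L2_norm_sq \<Omega> g" if \<eta>: "\<eta> > 0" for \<eta>
  proof (rule LIMSEQ_le_const)
    define C where "C n = k * (1 + 1 / \<eta>) * A n + (1 + \<eta>) * (1 + 1 / \<eta>) * B n + (1 + \<eta>)\<^sup>2 * L2_norm_sq \<Omega> g" for n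
    have "C \<longlonglongrightarrow> k * (1 + 1 / \<eta>) * 0 + (1 + \<eta>) * (1 + 1 / \<eta>) * 0 + (1 + \<eta>)\<^sup>2 * L2_norm_sq \<Omega> g"
      unfolding C_def by (intro tendsto_intros A B)
    then show "C \<longlonglongrightarrow> (1 + \<eta>)\<^sup>2 * L2_norm_sq \<Omega> g" by simp
    show "\<exists>N. \<forall>n\<ge>N. k * L2_norm_sq \<Omega> v \<le> C n"
    proof (intro exI allI impI)
      fix n :: nat
      note D = Cc_infD[OF \<phi>[of n]]
      have p2: "L2_on \<Omega> (\<phi> n)"
        by (rule L2_on_continuous[OF has_C1_derivativeD(3)[OF D(1)] D(2) _ \<Omega>]) (rule supp_outside)
      have q2: "L2_on \<Omega> (grad (\<phi> n))"
        by (rule L2_on_continuous[OF continuous_on_grad[OF D(1)] D(2) grad_outside_supp[OF D(1)] \<Omega>])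
      have "L2_norm_sq \<Omega> v \<le> (1 + \<eta>) * L2_norm_sq \<Omega> (\<phi> n) + (1 + 1 / \<eta>) * A n"
        unfolding A_def by (rule L2_norm_sq_approx[OF v2 p2 \<eta>])
      then have 1: "k * L2_norm_sq \<Omega> v \<le> (1 + \<eta>) * (k * L2_norm_sq \<Omega> (\<phi> n)) + k * (1 + 1 / \<eta>) * A n"
        using mult_left_mono[OF _ k] by (fastforce simp: algebra_simps)
      have "(1 + \<eta>) * (k * L2_norm_sq \<Omega> (\<phi> n)) \<le> (1 + \<eta>) * L2_norm_sq \<Omega> (grad (\<phi> n))"
        using poincare_slab_Cc_inf[OF \<phi> slab u w] \<eta> by (intro mult_left_mono) (auto simp: k_def)
      also have "\<dots> \<le> (1 + \<eta>) * ((1 + \<eta>) * L2_norm_sq \<Omega> g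
          + (1 + 1 / \<eta>) * L2_norm_sq \<Omega> (\<lambda>x. g x - grad (\<phi> n) x))"
        using L2_norm_sq_approx[OF q2 g2 \<eta>] \<eta> by (intro mult_left_mono) auto
      also have "L2_norm_sq \<Omega> (\<lambda>x. g x - grad (\<phi> n) x) = B n"
        by (simp add: B_def L2_norm_sq_def norm_minus_commute)
      also have "p * (p * G + q * b) = p\<^sup>2 * G + p * q * b" for p q G b :: real
        by (simp add: power2_eq_square algebra_simps)
      finally show "k * L2_norm_sq \<Omega> v \<le> C n"
        using 1 unfolding C_def by linarith
    qed
  qed
  have "k * L2_norm_sq \<Omega> v \<le> L2_norm_sq \<Omega> g"
  proof (rule LIMSEQ_le_const)
    have "(\<lambda>n. (1 + 1 / real (Suc n))\<^sup>2 * L2_norm_sq \<Omega> g) \<longlonglongrightarrow> (1 + 0)\<^sup>2 * L2_norm_sq \<Omega> g"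
      by (intro tendsto_intros LIMSEQ_Suc[OF lim_1_over_n])
    then show "(\<lambda>n. (1 + 1 / real (Suc n))\<^sup>2 * L2_norm_sq \<Omega> g) \<longlonglongrightarrow> L2_norm_sq \<Omega> g" by simp
    show "\<exists>N. \<forall>n\<ge>N. k * L2_norm_sq \<Omega> v \<le> (1 + 1 / real (Suc n))\<^sup>2 * L2_norm_sq \<Omega> g"
      using main by auto
  qed
  then show ?thesis by (simp add: k_def)
qed

text \<open>
  Integration by parts is the vanishing of the integral of \<open>\<nabla>(v \<phi>)\<close>, tested against each
  direction.
\<close>
lemma has_H10_grad_Cc_inf:
  assumes v: "v \<in> Cc_inf \<Omega>" and \<Omega>: "\<Omega> \<in> sets lebesgue"
  shows "has_H10_grad \<Omega> v (grad v)"
proof -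
  note D = Cc_infD[OF v]
  have v2: "L2_on \<Omega> v"
    by (rule L2_on_continuous[OF has_C1_derivativeD(3)[OF D(1)] D(2) _ \<Omega>]) (rule supp_outside)
  have g2: "L2_on \<Omega> (grad v)"
    by (rule L2_on_continuous[OF continuous_on_grad[OF D(1)] D(2) grad_outside_supp[OF D(1)] \<Omega>])
  have parts: "(LINT x:\<Omega>|lebesgue. v x *\<^sub>R grad \<phi> x) = - (LINT x:\<Omega>|lebesgue. \<phi> x *\<^sub>R grad v x)"
    if \<phi>: "\<phi> \<in> Cc_inf \<Omega>" for \<phi>
  proof -
    note E = Cc_infD[OF \<phi>]
    have i1: "integrable lebesgue (\<lambda>x. v x *\<^sub>R grad \<phi> x)"
      by (rule integrable_continuous_compact_support[OF _ D(2)])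
         (auto intro!: continuous_intros continuous_on_grad[OF E(1)] has_C1_derivativeD(3)[OF D(1)] simp: supp_outside)
    have i2: "integrable lebesgue (\<lambda>x. \<phi> x *\<^sub>R grad v x)"
      by (rule integrable_continuous_compact_support[OF _ E(2)])
         (auto intro!: continuous_intros continuous_on_grad[OF D(1)] has_C1_derivativeD(3)[OF E(1)] simp: supp_outside)
    have C: "compact (supp (\<lambda>x. v x * \<phi> x))"
      by (rule compact_supp_bounded[OF D(2)]) (simp add: supp_outside)
    have "(LINT x|lebesgue. v x *\<^sub>R grad \<phi> x) + (LINT x|lebesgue. \<phi> x *\<^sub>R grad v x) = 0"
    proof (rule euclidean_eqI)
      fix e :: 'a
      have "((LINT x|lebesgue. v x *\<^sub>R grad \<phi> x) + (LINT x|lebesgue. \<phi> x *\<^sub>R grad v x)) \<bullet> e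
          = (LINT x|lebesgue. v x *\<^sub>R grad \<phi> x + \<phi> x *\<^sub>R grad v x) \<bullet> e"
        using i1 i2 by simp
      also have "\<dots> = (LINT x|lebesgue. (v x *\<^sub>R grad \<phi> x + \<phi> x *\<^sub>R grad v x) \<bullet> e)"
        using i1 i2 by (intro integral_inner_left[symmetric]) simp
      also have "\<dots> = (LINT x|lebesgue. v x * frechet_derivative \<phi> (at x) e + frechet_derivative v (at x) e * \<phi> x)"
        by (simp add: inner_add_left grad_inner[OF D(1)] grad_inner[OF E(1)] mult.commute)
      also have "\<dots> = 0"
        by (rule integral_directional_derivative_zero[OF has_C1_derivative_mult[OF D(1) E(1)] C])
      finally show "((LINT x|lebesgue. v x *\<^sub>R grad \<phi> x) + (LINT x|lebesgue. \<phi> x *\<^sub>R grad v x)) \<bullet> e = 0 \<bullet> e"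
        by simp
    qed
    moreover have "v x = 0" "\<phi> x = 0" if "x \<notin> \<Omega>" for x
      using D(3) E(3) that by (auto intro: supp_outside)
    ultimately show ?thesis
      by (simp add: set_integral_eq_integral eq_neg_iff_add_eq_0)
  qed
  show ?thesis
    unfolding has_H10_grad_def has_H1_grad_def
    using v v2 g2 parts by (auto intro!: exI[of _ "\<lambda>_. v"] simp: L2_norm_sq_def)
qed

text \<open>
  The function \<open>v\<close> shows that the infimum ranges over a nonempty set, on which the infimum of the reals
  is meaningful.
\<close>
lemma lambda1_ge_slab:
  assumes \<Omega>: "open \<Omega>" and slab: "\<Omega> \<subseteq> {x. a < x \<bullet> u \<and> x \<bullet> u < a + w}" and u: "norm u = 1" and w: "w > 0"
    and v: "v \<in> Cc_inf \<Omega>" "\<not> (AE x in lebesgue. x \<in> \<Omega> \<longrightarrow> v x = 0)"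
  shows "(pi / w)\<^sup>2 \<le> lambda1 \<Omega>"
  unfolding lambda1_def
proof (rule cInf_greatest)
  have \<Omega>': "\<Omega> \<in> sets lebesgue" using \<Omega> by simp
  show "{L2_norm_sq \<Omega> g / L2_norm_sq \<Omega> v |v g.
     has_H10_grad \<Omega> v g \<and> \<not> (AE x in lebesgue. x \<in> \<Omega> \<longrightarrow> v x = 0)} \<noteq> {}"
    using has_H10_grad_Cc_inf[OF v(1) \<Omega>'] v(2) by auto
  fix r
  assume "r \<in> {L2_norm_sq \<Omega> g / L2_norm_sq \<Omega> v |v g.
     has_H10_grad \<Omega> v g \<and> \<not> (AE x in lebesgue. x \<in> \<Omega> \<longrightarrow> v x = 0)}"
  then obtain v g where r: "r = L2_norm_sq \<Omega> g / L2_norm_sq \<Omega> v" and H: "has_H10_grad \<Omega> v g"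
    and nz: "\<not> (AE x in lebesgue. x \<in> \<Omega> \<longrightarrow> v x = 0)" by auto
  have "L2_norm_sq \<Omega> v > 0"
    using H nz by (intro L2_norm_sq_pos) (auto simp: has_H10_grad_def has_H1_grad_def)
  then show "(pi / w)\<^sup>2 \<le> r"
    using poincare_slab_H10[OF H \<Omega>' slab u w] by (simp add: r field_simps)
qed

lemma lambda1_le_Cc_inf:
  assumes \<Omega>: "open \<Omega>" and v: "v \<in> Cc_inf \<Omega>" "(LINT x|lebesgue. (v x)\<^sup>2) > 0"
  shows "lambda1 \<Omega> \<le> (LINT x|lebesgue. (norm (grad v x))\<^sup>2) / (LINT x|lebesgue. (v x)\<^sup>2)"
    and "\<not> (AE x in lebesgue. x \<in> \<Omega> \<longrightarrow> v x = 0)"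
proof -
  have \<Omega>': "\<Omega> \<in> sets lebesgue" using \<Omega> by simp
  note D = Cc_infD[OF v(1)]
  have out: "v x = 0" "grad v x = 0" if "x \<notin> \<Omega>" for x
    using that D(3) supp_outside grad_outside_supp[OF D(1)] by auto
  show nz: "\<not> (AE x in lebesgue. x \<in> \<Omega> \<longrightarrow> v x = 0)"
  proof
    assume "AE x in lebesgue. x \<in> \<Omega> \<longrightarrow> v x = 0"
    then have "AE x in lebesgue. (v x)\<^sup>2 = 0"
      by (rule AE_mp) (use out in auto)
    then have "(LINT x|lebesgue. (v x)\<^sup>2) = 0" by (rule integral_eq_zero_AE)
    then show False using v(2) by simp
  qed
  have "lambda1 \<Omega> \<le> L2_norm_sq \<Omega> (grad v) / L2_norm_sq \<Omega> v"
    unfolding lambda1_def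
  proof (rule cInf_lower)
    show "L2_norm_sq \<Omega> (grad v) / L2_norm_sq \<Omega> v \<in> {L2_norm_sq \<Omega> g / L2_norm_sq \<Omega> v |v g.
       has_H10_grad \<Omega> v g \<and> \<not> (AE x in lebesgue. x \<in> \<Omega> \<longrightarrow> v x = 0)}"
      using has_H10_grad_Cc_inf[OF v(1) \<Omega>'] nz by auto
    show "bdd_below {L2_norm_sq \<Omega> g / L2_norm_sq \<Omega> v |v g.
       has_H10_grad \<Omega> v g \<and> \<not> (AE x in lebesgue. x \<in> \<Omega> \<longrightarrow> v x = 0)}"
      by (rule bdd_belowI[of _ 0]) (auto intro!: divide_nonneg_nonneg L2_norm_sq_nonneg)
  qed
  then show "lambda1 \<Omega> \<le> (LINT x|lebesgue. (norm (grad v x))\<^sup>2) / (LINT x|lebesgue. (v x)\<^sup>2)"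
    by (simp add: L2_norm_sq_supp out)
qed

section \<open>Lower bound for the Cheeger constant in a slab\<close>

text \<open>
  A \<open>C\<^sup>1\<close> transition from 1 on the negative axis to 0 beyond 1. It is built from
  \<open>(max 0 t)\<^sup>2\<close>, which is the simplest one-sided \<open>C\<^sup>1\<close> function.
\<close>
definition cutoff :: "real \<Rightarrow> real" where
  "cutoff r = (max 0 (1 - (max 0 r)\<^sup>2))\<^sup>2"

definition cutoff' :: "real \<Rightarrow> real" where
  "cutoff' r = - 4 * max 0 (1 - (max 0 r)\<^sup>2) * max 0 r"

lemma DERIV_max_0_squared:
  "((\<lambda>t::real. (max 0 t)\<^sup>2) has_real_derivative 2 * max 0 t) (at t)"
proof -
  consider "t > 0" | "t < 0" | "t = 0" by linarith
  then show ?thesis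
  proof cases
    case 1
    have "((\<lambda>t::real. t\<^sup>2) has_real_derivative 2 * max 0 t) (at t)"
      using 1 by (auto intro!: derivative_eq_intros)
    then show ?thesis
      by (rule DERIV_cong_ev[THEN iffD1, rotated -1])
         (use 1 eventually_nhds_in_open[of "{0<..}" t] in \<open>auto elim!: eventually_mono\<close>)
  next
    case 2
    have "((\<lambda>t::real. 0) has_real_derivative 2 * max 0 t) (at t)"
      using 2 by (auto intro!: derivative_eq_intros)
    then show ?thesis
      by (rule DERIV_cong_ev[THEN iffD1, rotated -1])
         (use 2 eventually_nhds_in_open[of "{..<0}" t] in \<open>auto elim!: eventually_mono\<close>)
  next
    case 3
    have "(\<lambda>h::real. (max 0 h)\<^sup>2 / h) \<midarrow>0\<rightarrow> 0"
    proof (rule Lim_null_comparison)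
      have "norm ((max 0 h)\<^sup>2 / h) \<le> \<bar>h\<bar>" for h :: real
        by (cases "h > 0") (auto simp: power2_eq_square)
      then show "eventually (\<lambda>h::real. norm ((max 0 h)\<^sup>2 / h) \<le> \<bar>h\<bar>) (at 0)" by simp
      show "((\<lambda>h::real. \<bar>h\<bar>) \<longlongrightarrow> 0) (at 0)"
        using tendsto_rabs[OF tendsto_ident_at[of "0::real" UNIV]] by simp
    qed
    then show ?thesis using 3 by (simp add: DERIV_def)
  qed
qed

lemma cutoff_has_derivative: "(cutoff has_real_derivative cutoff' r) (at r)"
proof -
  have "((\<lambda>r. (max 0 (1 - (max 0 r)\<^sup>2))\<^sup>2) has_real_derivative
      2 * max 0 (1 - (max 0 r)\<^sup>2) * (0 - 2 * max 0 r)) (at r)"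
    by (rule DERIV_chain2[OF DERIV_max_0_squared]) (intro derivative_intros DERIV_max_0_squared)
  then show ?thesis by (simp add: cutoff_def[abs_def] cutoff'_def algebra_simps)
qed

lemma continuous_on_cutoff': "continuous_on UNIV cutoff'"
  unfolding cutoff'_def[abs_def] by (intro continuous_intros)

lemma cutoff_le_1: "0 \<le> cutoff r" "cutoff r \<le> 1"
  unfolding cutoff_def by (auto simp: power_le_one)

lemma cutoff_left: "r \<le> 0 \<Longrightarrow> cutoff r = 1" "r \<le> 0 \<Longrightarrow> cutoff' r = 0"
  by (auto simp: cutoff_def cutoff'_def max_def)

lemma cutoff_right: "r \<ge> 1 \<Longrightarrow> cutoff r = 0"
  using one_le_power[of r 2] by (simp add: cutoff_def max_absorb1)

lemma has_C1_derivative_inner_self: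
  "has_C1_derivative (\<lambda>x::'a::euclidean_space. x \<bullet> x) (\<lambda>x e. 2 * (x \<bullet> e))"
  by (rule has_C1_derivativeI) (auto intro!: derivative_eq_intros continuous_intros simp: inner_commute)

lemma has_C1_derivative_add:
  assumes f: "has_C1_derivative f f'" and g: "has_C1_derivative g g'"
  shows "has_C1_derivative (\<lambda>x. f x + g x) (\<lambda>x e. f' x e + g' x e)"
  by (rule has_C1_derivativeI)
     (intro derivative_intros continuous_intros has_C1_derivativeD[OF f] has_C1_derivativeD[OF g])+

text \<open>
  On a slab of thickness \<open>w\<close> the field \<open>s u\<close>, where \<open>s\<close> runs affinely from \<open>-1\<close> to \<open>1\<close> across the
  slab, has divergence \<open>2/w\<close> and norm at most 1. To make it an admissible test field on the whole space
  it is cut off where \<open>s\<^sup>2 + (\<delta>/R\<^sup>2) |x|\<^sup>2\<close> runs from \<open>1 + \<delta>\<close> to \<open>1 + 2\<delta>\<close>: the set \<open>E\<close> lies where this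
  quantity is at most \<open>1 + \<delta>\<close>, and \<open>|s| \<le> sqrt (1 + 2\<delta>)\<close> on the support, which is compensated by
  the factor \<open>c\<close>.
\<close>
lemma perimeter_ge_slab_approx:
  fixes E :: "'a::euclidean_space set"
  assumes slab: "E \<subseteq> {x. a \<le> x \<bullet> u \<and> x \<bullet> u \<le> a + w}" and E: "E \<in> sets lebesgue" "bounded E"
    and u: "norm u = 1" and w: "w > 0" and \<delta>: "\<delta> > 0"
  shows "ereal (2 / (w * sqrt (1 + 2 * \<delta>)) * measure lebesgue E) \<le> perimeter E"
proof -
  obtain R where R: "R > 0" "\<And>x. x \<in> E \<Longrightarrow> norm x \<le> R"
    using E(2) bounded_pos by metis
  define c where "c = 1 / sqrt (1 + 2 * \<delta>)"
  have c: "c > 0" using \<delta> by (simp add: c_def)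
  define s where "s = (\<lambda>x::'a. x \<bullet> ((2 / w) *\<^sub>R u) + (- 2 * a / w - 1))"
  have s_eq: "s x = (2 / w) * (x \<bullet> u - a) - 1" for x
    using w by (simp add: s_def field_simps)
  have Cs: "has_C1_derivative s (\<lambda>x e. e \<bullet> ((2 / w) *\<^sub>R u))"
    unfolding s_def by (rule has_C1_derivative_affine)
  define Q where "Q = (\<lambda>x. (1 / \<delta>) * ((s x * s x + (\<delta> / R\<^sup>2) * (x \<bullet> x)) + (- 1 - \<delta>)))"
  obtain Q' where CQ: "has_C1_derivative Q Q'"
  proof -
    have const: "has_C1_derivative (\<lambda>x::'a. k::real) (\<lambda>x e. 0)" for k
      by (rule has_C1_derivativeI) auto
    show ?thesis
      by (rule that, unfold Q_def)
         (rule has_C1_derivative_mult[OF const has_C1_derivative_add[OF has_C1_derivative_add[OF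
            has_C1_derivative_mult[OF Cs Cs] has_C1_derivative_mult[OF const has_C1_derivative_inner_self]] const]])
  qed
  define g where "g = (\<lambda>x. (c * s x) * cutoff (Q x))"
  define g' where "g' = (\<lambda>x e. (c * s x) * (cutoff' (Q x) * Q' x e) + (c * (e \<bullet> ((2 / w) *\<^sub>R u))) * cutoff (Q x))"
  have Cg: "has_C1_derivative g g'"
  proof -
    have "has_C1_derivative (\<lambda>x. c * s x) (\<lambda>x e. c * (e \<bullet> ((2 / w) *\<^sub>R u)))"
      using has_C1_derivative_compose[OF Cs, of "(*) c" "\<lambda>_. c"]
      by (auto intro!: derivative_eq_intros)
    from has_C1_derivative_mult[OF this
        has_C1_derivative_compose[OF CQ cutoff_has_derivative continuous_on_cutoff']]
    show ?thesis by (simp add: g_def g'_def)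
  qed
  define X where "X x = g x *\<^sub>R u" for x
  have CX: "has_C1_derivative X (\<lambda>x e. g' x e *\<^sub>R u)"
    unfolding X_def[abs_def] by (rule has_C1_derivative_scaleR[OF Cg])
  have Qlarge: "cutoff (Q x) = 0" if "s x * s x + (\<delta> / R\<^sup>2) * (x \<bullet> x) \<ge> 1 + 2 * \<delta>" for x
    using that \<delta> by (intro cutoff_right) (simp add: Q_def field_simps)
  have Qsmall: "Q x \<le> 0" if "x \<in> E" for x
  proof -
    have "\<bar>s x\<bar> \<le> 1"
      using slab that w by (auto simp: s_eq abs_le_iff field_simps)
    then have "s x * s x \<le> 1" using abs_square_le_1[of "s x"] by (simp add: power2_eq_square)
    moreover have "x \<bullet> x \<le> R\<^sup>2"
      using R(2)[OF that] by (simp add: dot_square_norm power_mono)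
    then have "(\<delta> / R\<^sup>2) * (x \<bullet> x) \<le> (\<delta> / R\<^sup>2) * R\<^sup>2"
      using \<delta> by (intro mult_left_mono) auto
    then have "(\<delta> / R\<^sup>2) * (x \<bullet> x) \<le> \<delta>" using R(1) by simp
    ultimately show ?thesis
      using \<delta> unfolding Q_def by (intro mult_nonneg_nonpos) (simp, linarith)
  qed
  have norm_X: "norm (X x) \<le> 1" for x
  proof (cases "s x * s x \<ge> 1 + 2 * \<delta>")
    case True
    have "(\<delta> / R\<^sup>2) * (x \<bullet> x) \<ge> 0" using \<delta> by simp
    with True have "cutoff (Q x) = 0" by (intro Qlarge) linarith
    then show ?thesis by (simp add: X_def g_def)
  next
    case False
    then have "\<bar>s x\<bar> \<le> sqrt (1 + 2 * \<delta>)"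
      by (intro real_le_rsqrt) (simp add: power2_eq_square)
    then have "c * \<bar>s x\<bar> \<le> c * sqrt (1 + 2 * \<delta>)" using c by (intro mult_left_mono) auto
    also have "\<dots> = 1" using \<delta> by (simp add: c_def)
    finally have "c * \<bar>s x\<bar> * cutoff (Q x) \<le> 1 * 1"
      using cutoff_le_1 c by (intro mult_mono) auto
    then show ?thesis
      using u c cutoff_le_1[of "Q x"] by (simp add: X_def g_def abs_mult)
  qed
  have supp_X: "compact (supp X)"
  proof (rule compact_supp_bounded)
    \<comment> \<open>The radius at which the term \<open>(\<delta>/R\<^sup>2) |x|\<^sup>2\<close> alone reaches \<open>1 + 2 \<delta>\<close>.\<close>
    define M where "M = R * sqrt ((1 + 2 * \<delta>) / \<delta>)"
    show "compact (cball (0::'a) M)" by simp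
    show "X x = 0" if "x \<notin> cball 0 M" for x
    proof -
      have "M\<^sup>2 \<le> (norm x)\<^sup>2" using that R(1) \<delta> by (intro power_mono) (auto simp: M_def)
      moreover have "M\<^sup>2 = R\<^sup>2 * ((1 + 2 * \<delta>) / \<delta>)" using \<delta> by (simp add: M_def power_mult_distrib)
      ultimately have "(\<delta> / R\<^sup>2) * (R\<^sup>2 * ((1 + 2 * \<delta>) / \<delta>)) \<le> (\<delta> / R\<^sup>2) * (x \<bullet> x)"
        using \<delta> by (intro mult_left_mono) (auto simp: dot_square_norm)
      then have "1 + 2 * \<delta> \<le> (\<delta> / R\<^sup>2) * (x \<bullet> x)" using R(1) \<delta> by simp
      then have "cutoff (Q x) = 0" by (intro Qlarge) (simp add: add_increasing)
      then show ?thesis by (simp add: X_def g_def)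
    qed
  qed
  have div: "divergence X x = 2 / (w * sqrt (1 + 2 * \<delta>))" if "x \<in> E" for x
  proof -
    have "divergence X x = (\<Sum>i\<in>Basis. (u \<bullet> i) * g' x i)"
      unfolding divergence_def has_C1_derivative_frechet[OF CX] by (simp add: mult.commute)
    also have "\<dots> = g' x (\<Sum>i\<in>Basis. (u \<bullet> i) *\<^sub>R i)"
      using has_C1_derivativeD(4)[OF Cg] by (simp add: linear_sum linear_cmul)
    also have "\<dots> = g' x u" by (simp add: euclidean_representation)
    also have "\<dots> = c * (2 / w)"
      using u Qsmall[OF that] by (simp add: g'_def cutoff_left dot_square_norm)
    finally show ?thesis by (simp add: c_def)
  qed
  have "E \<in> lmeasurable" using E by (rule bounded_set_imp_lmeasurable[rotated])
  then have "(LINT x:E|lebesgue. divergence X x) = 2 / (w * sqrt (1 + 2 * \<delta>)) * measure lebesgue E"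
  proof -
    have "(LINT x:E|lebesgue. divergence X x) = (LINT x:E|lebesgue. 2 / (w * sqrt (1 + 2 * \<delta>)))"
      by (rule set_lebesgue_integral_cong) (use E div in auto)
    also have "(LINT x:E|lebesgue. d) = d * measure lebesgue E" for d :: real
      using \<open>E \<in> lmeasurable\<close> by (simp add: set_lebesgue_integral_def fmeasurable_def)
    finally show ?thesis .
  qed
  moreover have "ereal (LINT x:E|lebesgue. divergence X x) \<le> perimeter E"
    unfolding perimeter_def using C_k_1I[OF CX] supp_X norm_X by (intro SUP_upper) blast
  ultimately show ?thesis by simp
qed

lemma perimeter_ge_slab:
  fixes E :: "'a::euclidean_space set"
  assumes slab: "E \<subseteq> {x. a \<le> x \<bullet> u \<and> x \<bullet> u \<le> a + w}" and E: "E \<in> sets lebesgue" "bounded E"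
    and u: "norm u = 1" and w: "w > 0"
  shows "ereal (2 / w * measure lebesgue E) \<le> perimeter E"
proof (rule Lim_bounded)
  have "(\<lambda>n. 2 / (w * sqrt (1 + 2 * (1 / real (Suc n)))) * measure lebesgue E)
      \<longlonglongrightarrow> 2 / (w * sqrt (1 + 2 * 0)) * measure lebesgue E"
    using w by (intro tendsto_intros LIMSEQ_Suc[OF lim_1_over_n]) auto
  then show "(\<lambda>n. ereal (2 / (w * sqrt (1 + 2 * (1 / real (Suc n)))) * measure lebesgue E))
      \<longlonglongrightarrow> ereal (2 / w * measure lebesgue E)" by simp
  show "\<forall>n\<ge>0. ereal (2 / (w * sqrt (1 + 2 * (1 / real (Suc n)))) * measure lebesgue E) \<le> perimeter E"
    by (intro allI impI perimeter_ge_slab_approx[OF slab E u w]) simp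
qed

lemma cheeger_ge_slab:
  fixes \<Omega> :: "'a::euclidean_space set"
  assumes slab: "\<Omega> \<subseteq> {x. a \<le> x \<bullet> u \<and> x \<bullet> u \<le> a + w}" and \<Omega>: "bounded \<Omega>"
    and u: "norm u = 1" and w: "w > 0"
  shows "ereal (2 / w) \<le> cheeger \<Omega>"
  unfolding cheeger_def
proof (rule INF_greatest, clarify)
  fix E assume E: "E \<subseteq> \<Omega>" "E \<in> sets lebesgue" "measure lebesgue E > 0"
  have "ereal (2 / w * measure lebesgue E) \<le> perimeter E"
    by (rule perimeter_ge_slab[OF _ E(2) bounded_subset[OF \<Omega> E(1)] u w]) (use E(1) slab in blast)
  then show "ereal (2 / w) \<le> perimeter E / ereal (measure lebesgue E)"
    using E(3) by (subst ereal_le_divide_pos) (auto simp: mult.commute)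
qed

section \<open>Boxes inside thin convex bodies\<close>

definition orthonormal_basis :: "'a::euclidean_space set \<Rightarrow> bool" where
  "orthonormal_basis B \<longleftrightarrow> pairwise orthogonal B \<and> (\<forall>e\<in>B. norm e = 1) \<and> span B = UNIV"

lemma orthonormal_basis_exists:
  fixes u :: "'a::euclidean_space"
  assumes "norm u = 1"
  obtains B where "orthonormal_basis B" "u \<in> B" "card B = DIM('a)"
  using vector_in_orthonormal_basis[OF assms] by (metis orthonormal_basis_def)

lemma orthonormal_basis_finite: "orthonormal_basis B \<Longrightarrow> finite B"
  by (auto simp: orthonormal_basis_def pairwise_orthogonal_imp_finite)

lemma orthonormal_basis_norm: "orthonormal_basis B \<Longrightarrow> e \<in> B \<Longrightarrow> norm e = 1"
  by (simp add: orthonormal_basis_def)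

lemma orthonormal_basis_inner:
  assumes "orthonormal_basis B" "e \<in> B" "f \<in> B"
  shows "e \<bullet> f = (if e = f then 1 else 0)"
  using assms by (auto simp: orthonormal_basis_def pairwise_def orthogonal_def dot_square_norm)

lemma orthonormal_basis_sum:
  assumes "orthonormal_basis B"
  shows "(\<Sum>e\<in>B. (x \<bullet> e) *\<^sub>R e) = x"
  using assms orthonormal_basis_finite[OF assms]
  by (intro orthonormal_basis_expand) (auto simp: orthonormal_basis_def)

lemma orthonormal_basis_parseval:
  assumes "orthonormal_basis B"
  shows "x \<bullet> y = (\<Sum>e\<in>B. (x \<bullet> e) * (y \<bullet> e))"
proof -
  have "x \<bullet> y = x \<bullet> (\<Sum>e\<in>B. (y \<bullet> e) *\<^sub>R e)"
    by (simp only: orthonormal_basis_sum[OF assms])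
  then show ?thesis by (simp add: inner_sum_right mult.commute)
qed

lemma orthonormal_basis_norm_sq:
  assumes "orthonormal_basis B"
  shows "(norm x)\<^sup>2 = (\<Sum>e\<in>B. (x \<bullet> e)\<^sup>2)"
  using orthonormal_basis_parseval[OF assms, of x x] by (simp add: dot_square_norm power2_eq_square)

lemma orthonormal_basis_norm_le:
  assumes "orthonormal_basis B"
  shows "norm x \<le> (\<Sum>e\<in>B. \<bar>x \<bullet> e\<bar>)"
proof -
  have "norm (\<Sum>e\<in>B. (x \<bullet> e) *\<^sub>R e) \<le> (\<Sum>e\<in>B. norm ((x \<bullet> e) *\<^sub>R e))" by (rule norm_sum)
  then show ?thesis
    using orthonormal_basis_norm[OF assms] by (simp add: orthonormal_basis_sum[OF assms])
qed

lemma width_attained: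
  fixes K :: "'a::euclidean_space set"
  assumes "compact K" "K \<noteq> {}"
  obtains p q where "p \<in> K" "q \<in> K" "width K \<nu> = ereal ((q - p) \<bullet> \<nu>)"
    "\<And>x. x \<in> K \<Longrightarrow> p \<bullet> \<nu> \<le> x \<bullet> \<nu> \<and> x \<bullet> \<nu> \<le> q \<bullet> \<nu>"
proof -
  have c: "continuous_on K (\<lambda>x. x \<bullet> \<nu>)" by (intro continuous_intros)
  obtain q where q: "q \<in> K" "\<And>x. x \<in> K \<Longrightarrow> x \<bullet> \<nu> \<le> q \<bullet> \<nu>"
    using continuous_attains_sup[OF assms c] by blast
  obtain p where p: "p \<in> K" "\<And>x. x \<in> K \<Longrightarrow> p \<bullet> \<nu> \<le> x \<bullet> \<nu>"
    using continuous_attains_inf[OF assms c] by blast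
  have "support_fun K \<nu> = ereal (q \<bullet> \<nu>)"
    unfolding support_fun_def by (rule antisym) (auto intro!: SUP_least SUP_upper q)
  moreover have "support_fun K (- \<nu>) = ereal (- (p \<bullet> \<nu>))"
    unfolding support_fun_def
  proof (rule antisym)
    show "(SUP x\<in>K. ereal (x \<bullet> - \<nu>)) \<le> ereal (- (p \<bullet> \<nu>))"
      by (rule SUP_least) (use p in auto)
    show "ereal (- (p \<bullet> \<nu>)) \<le> (SUP x\<in>K. ereal (x \<bullet> - \<nu>))"
      by (rule SUP_upper2[OF p(1)]) simp
  qed
  ultimately have "width K \<nu> = ereal ((q - p) \<bullet> \<nu>)"
    by (simp add: width_def inner_diff_left)
  then show ?thesis using that p q by blast
qed

text \<open>
  The width is a Lipschitz function of the direction, and the sphere is compact.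
\<close>
lemma min_width_dirs_nonempty:
  fixes K :: "'a::euclidean_space set"
  assumes K: "compact K" "K \<noteq> {}"
  shows "min_width_dirs K \<noteq> {}"
proof -
  define f where "f \<nu> = real_of_ereal (width K \<nu>)" for \<nu>
  have f: "width K \<nu> = ereal (f \<nu>)" for \<nu>
    by (rule width_attained[OF K, of \<nu>]) (simp add: f_def)
  obtain D where D: "D > 0" "\<And>x. x \<in> K \<Longrightarrow> norm x \<le> D"
    using compact_imp_bounded[OF K(1)] bounded_pos by metis
  have "f \<nu> \<le> f \<mu> + 2 * D * norm (\<nu> - \<mu>)" for \<nu> \<mu>
  proof -
    obtain p q where pq: "p \<in> K" "q \<in> K" "width K \<nu> = ereal ((q - p) \<bullet> \<nu>)"
      using width_attained[OF K, of \<nu>] by metis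
    obtain p' q' where pq': "p' \<in> K" "q' \<in> K" "width K \<mu> = ereal ((q' - p') \<bullet> \<mu>)"
      "\<And>x. x \<in> K \<Longrightarrow> p' \<bullet> \<mu> \<le> x \<bullet> \<mu> \<and> x \<bullet> \<mu> \<le> q' \<bullet> \<mu>"
      using width_attained[OF K, of \<mu>] by metis
    have "f \<nu> = (q - p) \<bullet> \<mu> + (q - p) \<bullet> (\<nu> - \<mu>)"
      using pq(3) f[of \<nu>] by (simp add: inner_diff_right)
    also have "(q - p) \<bullet> \<mu> \<le> f \<mu>"
      using pq'(3) f[of \<mu>] pq'(4)[OF pq(1)] pq'(4)[OF pq(2)] by (simp add: inner_diff_left)
    also have "(q - p) \<bullet> (\<nu> - \<mu>) \<le> norm (q - p) * norm (\<nu> - \<mu>)" by (rule norm_cauchy_schwarz)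
    also have "\<dots> \<le> 2 * D * norm (\<nu> - \<mu>)"
      using D(2)[OF pq(1)] D(2)[OF pq(2)] norm_triangle_ineq4[of q p]
      by (intro mult_right_mono) auto
    finally show ?thesis by simp
  qed
  then have lip: "\<bar>f \<nu> - f \<mu>\<bar> \<le> 2 * D * norm (\<nu> - \<mu>)" for \<nu> \<mu>
    using norm_minus_commute by (metis abs_diff_le_iff diff_le_eq add.commute abs_le_iff minus_diff_eq)
  have "(2 * D)-lipschitz_on UNIV f"
    by (rule lipschitz_onI) (use lip D in \<open>auto simp: dist_norm\<close>)
  then have "continuous_on (sphere 0 1) f"
    using lipschitz_on_continuous_on continuous_on_subset by blast
  moreover have "sphere (0::'a) 1 \<noteq> {}"
    using vector_choose_size[of 1] by auto
  ultimately obtain u where u: "u \<in> sphere 0 1" "\<And>\<nu>. \<nu> \<in> sphere 0 1 \<Longrightarrow> f u \<le> f \<nu>"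
    using continuous_attains_inf[OF compact_sphere] by blast
  have "width1 K = width K u"
    unfolding width1_def by (rule antisym) (auto intro!: INF_lower INF_greatest u simp: f)
  then show ?thesis using u(1) by (auto simp: min_width_dirs_def)
qed

text \<open>
  If \<open>v\<close> were not in the compact convex set \<open>P ` (K - K)\<close>, a separating direction \<open>a\<close> would make
  the width of \<open>K\<close> in direction \<open>P a\<close> smaller than \<open>\<omega>\<close>, or contradict \<open>0 \<in> K - K\<close> if \<open>P a = 0\<close>. With \<open>P\<close> the identity
  the chord itself is \<open>v\<close>; with \<open>P\<close> the projection along a minimal direction it gives the transversal chords.
\<close>
lemma chord_with_prescribed_projection:
  fixes K :: "'a::euclidean_space set" and P :: "'a \<Rightarrow> 'a"
  assumes K: "compact K" "convex K" "K \<noteq> {}"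
    and P: "linear P" "\<And>x y. P x \<bullet> y = x \<bullet> P y" "\<And>x. P (P x) = P x"
    and wide: "\<And>\<nu>. norm \<nu> = 1 \<Longrightarrow> P \<nu> = \<nu> \<Longrightarrow> \<exists>p\<in>K. \<exists>q\<in>K. \<omega> \<le> (q - p) \<bullet> \<nu>"
    and v: "P v = v" "norm v \<le> \<omega>"
  obtains p q where "p \<in> K" "q \<in> K" "P (q - p) = v"
proof -
  define S where "S = P ` {x - y |x y. x \<in> K \<and> y \<in> K}"
  have "{x - y |x y. x \<in> K \<and> y \<in> K} = (\<Union>x\<in>K. \<Union>y\<in>K. {x - y})" by auto
  then have "convex {x - y |x y. x \<in> K \<and> y \<in> K}"
    using convex_differences[OF K(2) K(2)] by simp
  then have S: "convex S" "closed S"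
    unfolding S_def using P(1) K(1)
    by (auto intro!: convex_linear_image compact_imp_closed compact_continuous_image compact_differences
        linear_continuous_on simp: linear_conv_bounded_linear)
  have "v \<in> S"
  proof (rule ccontr)
    assume "v \<notin> S"
    from separating_hyperplane_closed_point[OF S this]
    obtain a b where ab: "a \<bullet> v < b" "\<And>x. x \<in> S \<Longrightarrow> b < a \<bullet> x" by blast
    have av: "a \<bullet> v = P a \<bullet> v" using P(2) v(1) by metis
    show False
    proof (cases "P a = 0")
      case True
      obtain x where "x \<in> K" using K(3) by blast
      then have "P (x - x) \<in> S" unfolding S_def by blast
      then have "b < a \<bullet> P (x - x)" by (rule ab(2))
      moreover have "a \<bullet> P (x - x) = 0" using True by (simp flip: P(2))
      ultimately show False using ab(1) av True by simp
    next
      case False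
      \<comment> \<open>The chord that is wide in the direction \<open>- P a\<close> gives a point of \<open>S\<close> on the wrong side of the hyperplane.\<close>
      define \<nu> where "\<nu> = (- 1 / norm (P a)) *\<^sub>R P a"
      have "norm \<nu> = 1" "P \<nu> = \<nu>"
        using False P(1,3) linear_cmul[OF P(1), of "- 1 / norm (P a)" "P a"] by (simp_all add: \<nu>_def)
      from wide[OF this] obtain p q where pq: "p \<in> K" "q \<in> K" "\<omega> \<le> (q - p) \<bullet> \<nu>" by blast
      have "a \<bullet> P (q - p) = P a \<bullet> (q - p)" by (simp add: P(2))
      also have "\<dots> = - norm (P a) * ((q - p) \<bullet> \<nu>)"
        using False by (simp add: \<nu>_def inner_commute)
      also have "\<dots> \<le> - norm (P a) * \<omega>"
        using pq(3) by (intro mult_left_mono_neg) auto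
      also have "\<dots> \<le> - norm (P a) * norm v"
        using v(2) by (intro mult_left_mono_neg) auto
      also have "\<dots> \<le> P a \<bullet> v"
        using norm_cauchy_schwarz[of "- P a" v] by simp
      finally have "a \<bullet> P (q - p) \<le> a \<bullet> v" using av by simp
      moreover have "P (q - p) \<in> S" unfolding S_def using pq by blast
      ultimately show False using ab by fastforce
    qed
  qed
  then show ?thesis using that unfolding S_def by blast
qed

text \<open>
  The point of \<open>K\<close> with parameters \<open>t e \<in> [0, 1]\<close> on the chords, combined with weights \<open>1 - \<epsilon>\<close> for the
  chord along \<open>u\<close> and \<open>\<epsilon>/(card B - 1)\<close> for each other chord, has, for \<open>e \<noteq> u\<close>, a coordinate along
  \<open>e\<close> that depends on \<open>t e\<close> alone. Its coordinate along \<open>u\<close> is that of the first chord, which ranges over an interval of length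
  \<open>(1 - \<epsilon>) w\<close>, plus a shift of size at most \<open>\<epsilon> w\<close> that depends on the other parameters. The heights
  common to all shifts form an interval of length \<open>(1 - 3 \<epsilon>) w\<close>.
\<close>
lemma box_in_convex_hull_of_chords:
  fixes K :: "'a::euclidean_space set"
  assumes K: "convex K" and B: "orthonormal_basis B" "u \<in> B" "card B \<ge> 2"
    and pq: "\<And>e. e \<in> B \<Longrightarrow> p e \<in> K" "\<And>e. e \<in> B \<Longrightarrow> q e \<in> K"
    and vert: "q u - p u = w *\<^sub>R u"
    and hor: "\<And>e. e \<in> B \<Longrightarrow> e \<noteq> u \<Longrightarrow> q e - p e = W *\<^sub>R e + c e *\<^sub>R u"
    and c: "\<And>e. e \<in> B \<Longrightarrow> e \<noteq> u \<Longrightarrow> \<bar>c e\<bar> \<le> w"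
    and w: "w > 0" and W: "W > 0" and \<epsilon>: "0 < \<epsilon>" "\<epsilon> < 1"
  obtains a where "\<And>x. 0 \<le> (x - a) \<bullet> u \<Longrightarrow> (x - a) \<bullet> u \<le> (1 - 3 * \<epsilon>) * w \<Longrightarrow>
      (\<And>e. e \<in> B \<Longrightarrow> e \<noteq> u \<Longrightarrow> 0 \<le> (x - a) \<bullet> e \<and> (x - a) \<bullet> e \<le> \<epsilon> / (real (card B) - 1) * W) \<Longrightarrow> x \<in> K"
proof -
  define m where "m = real (card B) - 1"
  have m: "m > 0" using B(3) by (simp add: m_def)
  define H where "H = B - {u}"
  have fin: "finite B" "finite H" using orthonormal_basis_finite[OF B(1)] by (auto simp: H_def)
  have cardH: "real (card H) = m" using fin B(2,3) by (simp add: H_def m_def of_nat_diff)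
  have split: "(\<Sum>e\<in>B. g e) = g u + (\<Sum>e\<in>H. g e)" for g :: "'a \<Rightarrow> 'b::comm_monoid_add"
    unfolding H_def using fin(1) B(2) by (rule sum.remove)
  define l where "l e = (if e = u then 1 - \<epsilon> else \<epsilon> / m)" for e
  have l: "l e > 0" for e using \<epsilon> m by (simp add: l_def)
  have lH: "l e = \<epsilon> / m" if "e \<in> H" for e using that by (auto simp: l_def H_def)
  have suml: "sum l B = 1"
    using m cardH by (simp add: split lH) (simp add: l_def)
  define A where "A = (\<Sum>e\<in>B. l e *\<^sub>R p e)"
  \<comment> \<open>The lowest height that every shift, of size at most \<open>\<epsilon> w\<close>, leaves inside the parallelepiped.\<close>
  define a where "a = A + (\<epsilon> * w) *\<^sub>R u"
  show ?thesis
  proof (rule that[of a])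
    fix x
    assume x1: "0 \<le> (x - a) \<bullet> u" "(x - a) \<bullet> u \<le> (1 - 3 * \<epsilon>) * w"
      and x2: "\<And>e. e \<in> B \<Longrightarrow> e \<noteq> u \<Longrightarrow> 0 \<le> (x - a) \<bullet> e \<and> (x - a) \<bullet> e \<le> \<epsilon> / (real (card B) - 1) * W"
    \<comment> \<open>Solve for the chord parameters: first those transversal to \<open>u\<close>, then, knowing the shift \<open>S\<close>
      that they cause along \<open>u\<close>, the parameter \<open>su\<close> of the chord along \<open>u\<close>.\<close>
    define s where "s e = ((x - A) \<bullet> e) / (l e * W)" for e
    define S where "S = (\<Sum>e\<in>H. l e * s e * c e)"
    define su where "su = ((x - A) \<bullet> u - S) / (l u * w)"
    have xA: "(x - A) \<bullet> e = (x - a) \<bullet> e" if "e \<in> H" for e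
      using that orthonormal_basis_inner[OF B(1) B(2), of e] by (auto simp: H_def a_def inner_diff_left inner_add_left)
    have xAu: "(x - A) \<bullet> u = (x - a) \<bullet> u + \<epsilon> * w"
      using orthonormal_basis_inner[OF B(1) B(2) B(2)] by (simp add: a_def inner_diff_left inner_add_left)
    have s01: "0 \<le> s e" "s e \<le> 1" if "e \<in> H" for e
    proof -
      have "0 \<le> (x - A) \<bullet> e" "(x - A) \<bullet> e \<le> l e * W"
        using x2[of e] that xA[OF that] lH[OF that] by (auto simp: H_def m_def)
      then show "0 \<le> s e" "s e \<le> 1"
        using l[of e] W by (auto simp: s_def divide_le_eq)
    qed
    have "\<bar>S\<bar> \<le> (\<Sum>e\<in>H. \<epsilon> / m * w)"
      unfolding S_def
    proof (rule order_trans[OF sum_abs], rule sum_mono)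
      fix e assume e: "e \<in> H"
      have "\<bar>l e * s e * c e\<bar> = l e * (s e * \<bar>c e\<bar>)"
        using s01[OF e] l[of e] by (simp add: abs_mult)
      also have "s e * \<bar>c e\<bar> \<le> 1 * w"
        using s01[OF e] c[of e] e w by (intro mult_mono) (auto simp: H_def)
      finally have "\<bar>l e * s e * c e\<bar> \<le> l e * (1 * w)"
        using l[of e] by simp
      then show "\<bar>l e * s e * c e\<bar> \<le> \<epsilon> / m * w"
        by (simp only: lH[OF e] mult_1)
    qed
    also have "\<dots> = \<epsilon> * w" using cardH m by simp
    finally have S: "\<bar>S\<bar> \<le> \<epsilon> * w" .
    have "0 \<le> (x - A) \<bullet> u - S" "(x - A) \<bullet> u - S \<le> l u * w"
      using S x1 xAu by (auto simp: l_def algebra_simps)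
    then have su01: "0 \<le> su" "su \<le> 1"
      using l[of u] w by (auto simp: su_def divide_le_eq)
    define t where "t e = (if e = u then su else s e)" for e
    have t01: "0 \<le> t e" "t e \<le> 1" if "e \<in> B" for e
      using su01 s01[of e] that by (auto simp: t_def H_def)
    have "(\<Sum>e\<in>B. l e *\<^sub>R (p e + t e *\<^sub>R (q e - p e))) \<in> K"
    proof (rule convex_sum[OF fin(1) K suml])
      show "0 \<le> l i" for i using l[of i] by simp
      show "p e + t e *\<^sub>R (q e - p e) \<in> K" if "e \<in> B" for e
        using convexD_alt[OF K pq(1)[OF that] pq(2)[OF that] t01[OF that]]
        by (simp add: algebra_simps)
    qed
    also have "(\<Sum>e\<in>B. l e *\<^sub>R (p e + t e *\<^sub>R (q e - p e)))
        = A + (\<Sum>e\<in>B. (l e * t e) *\<^sub>R (q e - p e))"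
      by (simp add: A_def scaleR_add_right sum.distrib)
    also have "(\<Sum>e\<in>B. (l e * t e) *\<^sub>R (q e - p e)) = x - A"
    proof -
      have "(\<Sum>e\<in>B. (l e * t e) *\<^sub>R (q e - p e))
          = (l u * su * w) *\<^sub>R u + (\<Sum>e\<in>H. (l e * s e) *\<^sub>R (W *\<^sub>R e + c e *\<^sub>R u))"
        unfolding split by (simp add: t_def vert) (auto intro!: sum.cong simp: H_def hor)
      also have "(\<Sum>e\<in>H. (l e * s e) *\<^sub>R (W *\<^sub>R e + c e *\<^sub>R u))
          = (\<Sum>e\<in>H. ((x - A) \<bullet> e) *\<^sub>R e + (l e * s e * c e) *\<^sub>R u)"
      proof (rule sum.cong[OF refl])
        fix e
        have "l e * s e * W = (x - A) \<bullet> e" using l[of e] W by (simp add: s_def)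
        then show "(l e * s e) *\<^sub>R (W *\<^sub>R e + c e *\<^sub>R u) = ((x - A) \<bullet> e) *\<^sub>R e + (l e * s e * c e) *\<^sub>R u"
          by (simp add: scaleR_add_right)
      qed
      also have "\<dots> = (\<Sum>e\<in>H. ((x - A) \<bullet> e) *\<^sub>R e) + S *\<^sub>R u"
        by (simp add: sum.distrib S_def scaleR_sum_left)
      also have "(l u * su * w) *\<^sub>R u + ((\<Sum>e\<in>H. ((x - A) \<bullet> e) *\<^sub>R e) + S *\<^sub>R u)
          = (l u * su * w + S) *\<^sub>R u + (\<Sum>e\<in>H. ((x - A) \<bullet> e) *\<^sub>R e)"
        by (simp add: algebra_simps)
      also have "l u * su * w + S = (x - A) \<bullet> u"
        using l[of u] w by (simp add: su_def)
      also have "((x - A) \<bullet> u) *\<^sub>R u + (\<Sum>e\<in>H. ((x - A) \<bullet> e) *\<^sub>R e) = x - A"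
        using orthonormal_basis_sum[OF B(1), of "x - A"] by (simp only: split)
      finally show ?thesis .
    qed
    finally show "x \<in> K" by simp
  qed
qed

text \<open>
  The additional factor \<open>1 - 2 \<epsilon>\<close> shrinks the box so that it lies in the interior.
\<close>
lemma convex_body_geometry:
  fixes K :: "'a::euclidean_space set"
  assumes K: "convex_body K" and dim: "DIM('a) \<ge> 2"
  obtains w W u B a0 where "w > 0" "W > 0" "rel_width K = ereal (w / W)"
    "orthonormal_basis B" "u \<in> B" "card B = DIM('a)"
    "interior K \<subseteq> {x. a0 < x \<bullet> u \<and> x \<bullet> u < a0 + w}"
    "\<And>\<epsilon>. 0 < \<epsilon> \<Longrightarrow> \<epsilon> < 1/3 \<Longrightarrow> \<exists>a. {x. \<forall>e\<in>B. 0 \<le> (x - a) \<bullet> e \<and> (x - a) \<bullet> e \<le>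
        (1 - 2 * \<epsilon>) * (if e = u then (1 - 3 * \<epsilon>) * w else \<epsilon> / (real DIM('a) - 1) * W)} \<subseteq> interior K"
proof -
  have K': "compact K" "convex K" "K \<noteq> {}" "interior K \<noteq> {}"
    using K interior_subset[of K] by (auto simp: convex_body_def compact_eq_bounded_closed)
  obtain u where u: "u \<in> min_width_dirs K"
    using min_width_dirs_nonempty[OF K'(1,3)] by blast
  have un: "norm u = 1" and w1: "width K u = width1 K"
    using u by (auto simp: min_width_dirs_def)
  obtain p0 q0 where pq0: "p0 \<in> K" "q0 \<in> K" "width K u = ereal ((q0 - p0) \<bullet> u)"
    "\<And>x. x \<in> K \<Longrightarrow> p0 \<bullet> u \<le> x \<bullet> u \<and> x \<bullet> u \<le> q0 \<bullet> u"
    using width_attained[OF K'(1,3), of u] by metis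
  define w where "w = (q0 - p0) \<bullet> u"
  have w: "width1 K = ereal w" using pq0(3) w1 by (simp add: w_def)
  have wpos: "w > 0"
  proof -
    obtain x where "x \<in> interior K" using K'(4) by blast
    then obtain r where r: "r > 0" "cball x r \<subseteq> K"
      using mem_interior_cball by blast
    then have "x \<in> K" "x + r *\<^sub>R u \<in> K" using un by (auto simp: dist_norm)
    from pq0(4)[OF this(1)] pq0(4)[OF this(2)] show ?thesis
      using r(1) un by (simp add: w_def inner_add_left inner_diff_left dot_square_norm)
  qed
  obtain B where B: "orthonormal_basis B" "u \<in> B" "card B = DIM('a)"
    using orthonormal_basis_exists[OF un] by blast
  have wide1: "ereal w \<le> width K \<nu>" if "norm \<nu> = 1" for \<nu>
    unfolding w[symmetric] width1_def using that by (intro INF_lower) auto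
  have wide2: "width2 K \<le> width K \<nu>" if "norm \<nu> = 1" "\<nu> \<bullet> u = 0" for \<nu>
    unfolding width2_def using that u by (intro INF_lower) auto
  have w12: "ereal w \<le> width2 K"
    unfolding width2_def by (intro INF_greatest) (auto intro: wide1)
  have "B - {u} \<noteq> {}"
  proof
    assume "B - {u} = {}"
    then have "B = {u}" using B(2) by auto
    then show False using B(3) dim by simp
  qed
  then obtain e1 where e1: "e1 \<in> B" "e1 \<noteq> u" by blast
  have "width2 K \<le> width K e1"
    using orthonormal_basis_norm[OF B(1) e1(1)] orthonormal_basis_inner[OF B(1) e1(1) B(2)] e1
    by (intro wide2) auto
  then have "width2 K \<noteq> \<infinity>"
    using width_attained[OF K'(1,3), of e1] by (metis PInfty_neq_ereal(1) ereal_infty_less_eq(1))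
  moreover have "width2 K \<noteq> - \<infinity>" using w12 by auto
  ultimately obtain W where W: "width2 K = ereal W" by (cases "width2 K") auto
  have Wpos: "W > 0" using w12 W wpos by simp
  have "\<exists>p q. p \<in> K \<and> q \<in> K \<and> q - p = w *\<^sub>R u"
  proof (rule chord_with_prescribed_projection[OF K'(1-3), of "\<lambda>x. x" w "w *\<^sub>R u"])
    show "\<exists>p\<in>K. \<exists>q\<in>K. w \<le> (q - p) \<bullet> \<nu>" if "norm \<nu> = 1" for \<nu>
      using wide1[OF that] by (metis width_attained[OF K'(1,3), of \<nu>] ereal_less_eq(3))
  qed (use un wpos in \<open>auto simp: linear_id[unfolded id_def]\<close>)
  then obtain pu qu where puqu: "pu \<in> K" "qu \<in> K" "qu - pu = w *\<^sub>R u" by blast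
  have "\<exists>p q. p \<in> K \<and> q \<in> K \<and> (\<exists>c. q - p = W *\<^sub>R e + c *\<^sub>R u \<and> \<bar>c\<bar> \<le> w)" if e: "e \<in> B" "e \<noteq> u" for e
  proof -
    define P where "P x = x - (x \<bullet> u) *\<^sub>R u" for x
    have eu: "e \<bullet> u = 0" using orthonormal_basis_inner[OF B(1) e(1) B(2)] e by simp
    have uu: "u \<bullet> u = 1" using un by (simp add: dot_square_norm)
    obtain p q where pq: "p \<in> K" "q \<in> K" "P (q - p) = W *\<^sub>R e"
    proof (rule chord_with_prescribed_projection[OF K'(1-3), of P W "W *\<^sub>R e"])
      show "linear P" unfolding P_def[abs_def]
        by (intro linearI) (auto simp: algebra_simps inner_add_left)
      show "P x \<bullet> y = x \<bullet> P y" for x y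
        by (simp add: P_def inner_diff_left inner_diff_right inner_commute)
      show "P (P x) = P x" for x by (simp add: P_def inner_diff_left uu)
      show "P (W *\<^sub>R e) = W *\<^sub>R e" by (simp add: P_def eu)
      show "norm (W *\<^sub>R e) \<le> W" using Wpos orthonormal_basis_norm[OF B(1) e(1)] by simp
      show "\<exists>p\<in>K. \<exists>q\<in>K. W \<le> (q - p) \<bullet> \<nu>" if \<nu>: "norm \<nu> = 1" "P \<nu> = \<nu>" for \<nu>
      proof -
        have "\<nu> \<bullet> u = P \<nu> \<bullet> u" using \<nu> by simp
        also have "\<dots> = 0" by (simp add: P_def inner_diff_left uu)
        finally have "ereal W \<le> width K \<nu>" using wide2[OF \<nu>(1)] W by simp
        then show ?thesis by (metis width_attained[OF K'(1,3), of \<nu>] ereal_less_eq(3))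
      qed
    qed
    define c where "c = (q - p) \<bullet> u"
    have "q - p = W *\<^sub>R e + c *\<^sub>R u"
      using pq(3) by (simp add: P_def c_def algebra_simps)
    moreover have "\<bar>c\<bar> \<le> w"
      using pq0(4)[OF pq(1)] pq0(4)[OF pq(2)] by (simp add: c_def w_def inner_diff_left abs_le_iff)
    ultimately show ?thesis using pq by blast
  qed
  then obtain p q c where hor: "\<And>e. e \<in> B \<Longrightarrow> e \<noteq> u \<Longrightarrow> p e \<in> K \<and> q e \<in> K \<and>
      q e - p e = W *\<^sub>R e + c e *\<^sub>R u \<and> \<bar>c e\<bar> \<le> w" by metis
  have box: "\<exists>a. {x. \<forall>e\<in>B. 0 \<le> (x - a) \<bullet> e \<and> (x - a) \<bullet> e \<le>
        (1 - 2 * \<epsilon>) * (if e = u then (1 - 3 * \<epsilon>) * w else \<epsilon> / (real DIM('a) - 1) * W)} \<subseteq> interior K"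
    if \<epsilon>: "0 < \<epsilon>" "\<epsilon> < 1/3" for \<epsilon> :: real
  proof -
    define L where "L e = (if e = u then (1 - 3 * \<epsilon>) * w else \<epsilon> / (real DIM('a) - 1) * W)" for e
    have L: "L e > 0" for e using \<epsilon> wpos Wpos dim by (simp add: L_def)
    obtain a where a: "\<And>x. 0 \<le> (x - a) \<bullet> u \<Longrightarrow> (x - a) \<bullet> u \<le> (1 - 3 * \<epsilon>) * w \<Longrightarrow>
      (\<And>e. e \<in> B \<Longrightarrow> e \<noteq> u \<Longrightarrow> 0 \<le> (x - a) \<bullet> e \<and> (x - a) \<bullet> e \<le> \<epsilon> / (real (card B) - 1) * W) \<Longrightarrow> x \<in> K"
    proof (rule box_in_convex_hull_of_chords[OF K'(2) B(1,2), of "p(u := pu)" "q(u := qu)" w W c \<epsilon>])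
      show "(p(u := pu)) e \<in> K" "(q(u := qu)) e \<in> K" if "e \<in> B" for e
        using hor[OF that] puqu by auto
    qed (use hor puqu wpos Wpos \<epsilon> dim B(3) in auto)
    define D where "D = {x. \<forall>e\<in>B. 0 < (x - a) \<bullet> e \<and> (x - a) \<bullet> e < L e}"
    have "open D"
    proof -
      have "D = (\<Inter>e\<in>B. {x. 0 < (x - a) \<bullet> e} \<inter> {x. (x - a) \<bullet> e < L e})" by (auto simp: D_def)
      then show ?thesis
        using orthonormal_basis_finite[OF B(1)]
        by (auto intro!: open_INT open_Int open_Collect_less continuous_intros)
    qed
    moreover have "D \<subseteq> K"
    proof
      fix x assume "x \<in> D"
      then have x: "0 \<le> (x - a) \<bullet> e \<and> (x - a) \<bullet> e \<le> L e" if "e \<in> B" for e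
        using that by (force simp: D_def)
      show "x \<in> K"
      proof (rule a)
        show "0 \<le> (x - a) \<bullet> u" "(x - a) \<bullet> u \<le> (1 - 3 * \<epsilon>) * w"
          using x[OF B(2)] by (auto simp: L_def)
        show "0 \<le> (x - a) \<bullet> e \<and> (x - a) \<bullet> e \<le> \<epsilon> / (real (card B) - 1) * W"
          if "e \<in> B" "e \<noteq> u" for e
          using x[OF that(1)] that(2) unfolding L_def B(3) by simp
      qed
    qed
    ultimately have D: "D \<subseteq> interior K" by (rule interior_maximal[rotated])
    define b where "b = a + (\<Sum>e\<in>B. (\<epsilon> * L e) *\<^sub>R e)"
    have b: "(x - a) \<bullet> e = (x - b) \<bullet> e + \<epsilon> * L e" if "e \<in> B" for x e
    proof -
      have "(\<Sum>f\<in>B. (\<epsilon> * L f) *\<^sub>R f) \<bullet> e = (\<Sum>f\<in>B. (\<epsilon> * L f) * (if f = e then 1 else 0))"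
        using that by (simp add: inner_sum_left orthonormal_basis_inner[OF B(1)])
      also have "\<dots> = \<epsilon> * L e"
        using that orthonormal_basis_finite[OF B(1)] by (simp add: if_distrib sum.delta cong: if_cong)
      finally show ?thesis by (simp add: b_def inner_diff_left inner_add_left)
    qed
    have "{x. \<forall>e\<in>B. 0 \<le> (x - b) \<bullet> e \<and> (x - b) \<bullet> e \<le> (1 - 2 * \<epsilon>) * L e} \<subseteq> D"
    proof clarify
      fix x assume x: "\<forall>e\<in>B. 0 \<le> (x - b) \<bullet> e \<and> (x - b) \<bullet> e \<le> (1 - 2 * \<epsilon>) * L e"
      show "x \<in> D"
        unfolding D_def
      proof clarify
        fix e assume e: "e \<in> B"
        have "\<epsilon> * L e > 0" using \<epsilon> L by simp
        then show "0 < (x - a) \<bullet> e \<and> (x - a) \<bullet> e < L e"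
          using b[OF e, of x] bspec[OF x e] by (simp add: algebra_simps)
      qed
    qed
    then show ?thesis using D unfolding L_def by blast
  qed
  have slab: "interior K \<subseteq> {x. p0 \<bullet> u < x \<bullet> u \<and> x \<bullet> u < p0 \<bullet> u + w}"
  proof -
    have "u \<noteq> 0" using un by auto
    have "K \<subseteq> {x. u \<bullet> x \<le> p0 \<bullet> u + w}" "K \<subseteq> {x. u \<bullet> x \<ge> p0 \<bullet> u}"
      using pq0(4) by (auto simp: w_def inner_diff_left inner_diff_right inner_commute)
    from this[THEN interior_mono] show ?thesis
      unfolding interior_halfspace_le[OF \<open>u \<noteq> 0\<close>] interior_halfspace_ge[OF \<open>u \<noteq> 0\<close>]
      by (auto simp: inner_commute)
  qed
  show ?thesis
    by (rule that[OF wpos Wpos _ B slab box]) (use wpos Wpos in \<open>simp_all add: rel_width_def w W\<close>)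
qed

section \<open>Upper bound for the Cheeger constant of a set containing a box\<close>

lemma box_bounded:
  fixes a :: "'a::euclidean_space"
  assumes B: "orthonormal_basis B"
  shows "bounded {x. \<forall>e\<in>B. 0 \<le> (x - a) \<bullet> e \<and> (x - a) \<bullet> e \<le> L e}"
proof (rule bounded_subset[OF bounded_cball])
  show "{x. \<forall>e\<in>B. 0 \<le> (x - a) \<bullet> e \<and> (x - a) \<bullet> e \<le> L e} \<subseteq> cball a (\<Sum>e\<in>B. \<bar>L e\<bar>)"
  proof clarify
    fix x assume x: "\<forall>e\<in>B. 0 \<le> (x - a) \<bullet> e \<and> (x - a) \<bullet> e \<le> L e"
    have "norm (x - a) \<le> (\<Sum>e\<in>B. \<bar>(x - a) \<bullet> e\<bar>)"
      by (rule orthonormal_basis_norm_le[OF B])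
    also have "\<dots> \<le> (\<Sum>e\<in>B. \<bar>L e\<bar>)"
      using x by (intro sum_mono) force
    finally show "x \<in> cball a (\<Sum>e\<in>B. \<bar>L e\<bar>)" by (simp add: dist_norm norm_minus_commute)
  qed
qed

lemma box_closed:
  fixes a :: "'a::euclidean_space"
  shows "closed {x. \<forall>e\<in>B. 0 \<le> (x - a) \<bullet> e \<and> (x - a) \<bullet> e \<le> L e}"
proof -
  have "{x. \<forall>e\<in>B. 0 \<le> (x - a) \<bullet> e \<and> (x - a) \<bullet> e \<le> L e}
      = (\<Inter>e\<in>B. {x. 0 \<le> (x - a) \<bullet> e} \<inter> {x. (x - a) \<bullet> e \<le> L e})" by auto
  then show ?thesis
    by (auto intro!: closed_INT closed_Int closed_Collect_le continuous_intros)
qed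

lemma open_box_open:
  fixes a :: "'a::euclidean_space"
  assumes B: "orthonormal_basis B"
  shows "open {x. \<forall>e\<in>B. 0 < (x - a) \<bullet> e \<and> (x - a) \<bullet> e < L e}"
proof -
  have "{x. \<forall>e\<in>B. 0 < (x - a) \<bullet> e \<and> (x - a) \<bullet> e < L e}
      = (\<Inter>e\<in>B. {x. 0 < (x - a) \<bullet> e} \<inter> {x. (x - a) \<bullet> e < L e})" by auto
  then show ?thesis
    using orthonormal_basis_finite[OF B]
    by (auto intro!: open_INT open_Int open_Collect_less continuous_intros)
qed

lemma open_box_nonempty:
  fixes a :: "'a::euclidean_space"
  assumes B: "orthonormal_basis B" and L: "\<And>e. e \<in> B \<Longrightarrow> L e > 0"
  shows "{x. \<forall>e\<in>B. 0 < (x - a) \<bullet> e \<and> (x - a) \<bullet> e < L e} \<noteq> {}"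
proof -
  define x where "x = a + (\<Sum>e\<in>B. (L e / 2) *\<^sub>R e)"
  have "(x - a) \<bullet> e = L e / 2" if "e \<in> B" for e
  proof -
    have "(x - a) \<bullet> e = (\<Sum>f\<in>B. (L f / 2) * (if f = e then 1 else 0))"
      using that by (simp add: x_def inner_sum_left orthonormal_basis_inner[OF B])
    then show ?thesis
      using that orthonormal_basis_finite[OF B] by (simp add: if_distrib sum.delta cong: if_cong)
  qed
  then have "\<forall>e\<in>B. 0 < (x - a) \<bullet> e \<and> (x - a) \<bullet> e < L e" using L by (metis field_sum_of_halves half_gt_zero less_add_same_cancel1)
  then show ?thesis by blast
qed

text \<open>
  Half-open boxes tile: a box is the disjoint union of translates of a thin slice of it.
\<close>
definition half_open_box :: "'a::euclidean_space set \<Rightarrow> 'a \<Rightarrow> ('a \<Rightarrow> real) \<Rightarrow> 'a set" where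
  "half_open_box B a L = {x. \<forall>e\<in>B. 0 \<le> (x - a) \<bullet> e \<and> (x - a) \<bullet> e < L e}"

lemma half_open_box_subset:
  "half_open_box B a L \<subseteq> {x. \<forall>e\<in>B. 0 \<le> (x - a) \<bullet> e \<and> (x - a) \<bullet> e \<le> L e}"
  by (force simp: half_open_box_def)

lemma half_open_box_bounded: "orthonormal_basis B \<Longrightarrow> bounded (half_open_box B a L)"
  using bounded_subset[OF box_bounded half_open_box_subset] .

lemma half_open_box_borel:
  assumes "orthonormal_basis B"
  shows "half_open_box B a L \<in> sets borel"
proof -
  have "half_open_box B a L = (\<Inter>e\<in>B. {x. 0 \<le> (x - a) \<bullet> e} \<inter> {x. (x - a) \<bullet> e < L e})"
    if "B \<noteq> {}" using that by (auto simp: half_open_box_def)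
  moreover have "(\<Inter>e\<in>B. {x. 0 \<le> (x - a) \<bullet> e} \<inter> {x. (x - a) \<bullet> e < L e}) \<in> sets borel" if "B \<noteq> {}"
    using orthonormal_basis_finite[OF assms] that
    by (intro sets.finite_INT sets.Int borel_closed borel_open closed_Collect_le open_Collect_less
        continuous_intros) auto
  moreover have "half_open_box {} a L = UNIV" by (simp add: half_open_box_def)
  ultimately show ?thesis by (cases "B = {}") auto
qed

lemma half_open_box_lmeasurable: "orthonormal_basis B \<Longrightarrow> half_open_box B a L \<in> lmeasurable"
  using half_open_box_borel[of B a L] half_open_box_bounded[of B a L]
  by (intro bounded_set_imp_lmeasurable) auto

lemma half_open_box_measure_pos:
  fixes a :: "'a::euclidean_space"
  assumes B: "orthonormal_basis B" and L: "\<And>e. e \<in> B \<Longrightarrow> L e > 0"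
  shows "measure lebesgue (half_open_box B a L) > 0"
proof -
  define U where "U = {x. \<forall>e\<in>B. 0 < (x - a) \<bullet> e \<and> (x - a) \<bullet> e < L e}"
  have U: "open U" "U \<noteq> {}"
    unfolding U_def using open_box_open[OF B] open_box_nonempty[OF B L] by auto
  have sub: "U \<subseteq> half_open_box B a L" by (force simp: U_def half_open_box_def)
  have "U \<in> lmeasurable"
    using U(1) bounded_subset[OF half_open_box_bounded[OF B] sub] by (intro bounded_set_imp_lmeasurable) auto
  moreover have "\<not> negligible U" using open_not_negligible[OF U] .
  ultimately have "measure lebesgue U > 0"
    using negligible_iff_measure[of U] measure_nonneg[of lebesgue U] by linarith
  also have "measure lebesgue U \<le> measure lebesgue (half_open_box B a L)"
    using sub \<open>U \<in> lmeasurable\<close> by (intro measure_mono_fmeasurable half_open_box_lmeasurable B) auto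
  finally show ?thesis .
qed

lemma half_open_box_translate:
  "half_open_box B (a + c) L = (+) c ` half_open_box B a L"
proof -
  have "x \<in> half_open_box B (a + c) L \<longleftrightarrow> x - c \<in> half_open_box B a L" for x
    by (simp add: half_open_box_def algebra_simps)
  moreover have "x \<in> (+) c ` half_open_box B a L \<longleftrightarrow> x - c \<in> half_open_box B a L" for x
    using image_eqI[of x "(+) c" "x - c" "half_open_box B a L"] by auto
  ultimately show ?thesis by (intro set_eqI) simp
qed

lemma measure_half_open_box_translate:
  "measure lebesgue (half_open_box B (a + c) L) = measure lebesgue (half_open_box B a L)"
  by (simp add: half_open_box_translate measure_translation)

text \<open>
  Tiling by \<open>n\<close> translates replaces the product formula for the measure of a box in a
  rotated frame.
\<close>
lemma measure_half_open_box_slice: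
  fixes a :: "'a::euclidean_space"
  assumes B: "orthonormal_basis B" "f \<in> B" and L: "L f > 0" and n: "n > 0"
  shows "real n * measure lebesgue (half_open_box B a (L(f := L f / real n)))
      = measure lebesgue (half_open_box B a L)"
proof -
  define h where "h = L f / real n"
  have h: "h > 0" "real n * h = L f" using L n by (auto simp: h_def)
  define T where "T i = half_open_box B (a + (real i * h) *\<^sub>R f) (L(f := h))" for i
  have ff: "f \<bullet> f = 1" and fe: "e \<in> B \<Longrightarrow> e \<noteq> f \<Longrightarrow> f \<bullet> e = 0" for e
    using orthonormal_basis_inner[OF B(1) B(2)] B(2) by auto
  have T_iff: "x \<in> T i \<longleftrightarrow> (\<forall>e\<in>B - {f}. 0 \<le> (x - a) \<bullet> e \<and> (x - a) \<bullet> e < L e) \<and>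
      real i * h \<le> (x - a) \<bullet> f \<and> (x - a) \<bullet> f < real (Suc i) * h" for x i
  proof -
    have "x \<in> T i \<longleftrightarrow> (\<forall>e\<in>B - {f}. 0 \<le> (x - (a + (real i * h) *\<^sub>R f)) \<bullet> e \<and> (x - (a + (real i * h) *\<^sub>R f)) \<bullet> e < L e) \<and>
      0 \<le> (x - (a + (real i * h) *\<^sub>R f)) \<bullet> f \<and> (x - (a + (real i * h) *\<^sub>R f)) \<bullet> f < h"
      using B(2) by (auto simp: T_def half_open_box_def)
    also have "\<dots> \<longleftrightarrow> (\<forall>e\<in>B - {f}. 0 \<le> (x - a) \<bullet> e \<and> (x - a) \<bullet> e < L e) \<and>
      real i * h \<le> (x - a) \<bullet> f \<and> (x - a) \<bullet> f < real (Suc i) * h"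
      using fe ff by (auto simp: inner_diff_left inner_add_left algebra_simps)
    finally show ?thesis .
  qed
  have "measure lebesgue (\<Union>i\<in>{..<n}. T i) = (\<Sum>i\<in>{..<n}. measure lebesgue (T i))"
  proof (rule measure_UNION_AE[THEN trans, OF _ _ _ refl])
    show "finite {..<n}" by simp
    show "T i \<in> fmeasurable lebesgue" for i
      unfolding T_def by (rule half_open_box_lmeasurable[OF B(1)])
    have "T i \<inter> T j = {}" if "i < j" for i j
    proof -
      have "real (Suc i) * h \<le> real j * h" using that h by (intro mult_right_mono) auto
      then show ?thesis by (auto simp: T_iff)
    qed
    then have "T i \<inter> T j = {}" if "i \<noteq> j" for i j
      using that by (metis Int_commute nat_neq_iff)
    then show "pairwise (\<lambda>i j. AE x in lebesgue. x \<notin> T i \<or> x \<notin> T j) {..<n}"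
      by (auto simp: pairwise_def)
  qed
  also have "(\<Union>i\<in>{..<n}. T i) = half_open_box B a L"
  proof (rule antisym; rule subsetI)
    fix x assume "x \<in> (\<Union>i\<in>{..<n}. T i)"
    then obtain i where i: "i < n" "x \<in> T i" by auto
    have "real (Suc i) * h \<le> real n * h" using i h by (intro mult_right_mono) auto
    moreover have "0 \<le> real i * h" using h by simp
    ultimately have "0 \<le> (x - a) \<bullet> f \<and> (x - a) \<bullet> f < L f"
      using i(2) h(2) unfolding T_iff by linarith
    then show "x \<in> half_open_box B a L"
      using i(2) unfolding T_iff half_open_box_def by blast
  next
    fix x assume x: "x \<in> half_open_box B a L"
    define i where "i = nat \<lfloor>((x - a) \<bullet> f) / h\<rfloor>"
    have xf: "0 \<le> (x - a) \<bullet> f" "(x - a) \<bullet> f < L f" using x B(2) by (auto simp: half_open_box_def)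
    have fl: "real i = of_int \<lfloor>((x - a) \<bullet> f) / h\<rfloor>"
      using xf h by (simp add: i_def)
    have "real i \<le> ((x - a) \<bullet> f) / h" "((x - a) \<bullet> f) / h < real i + 1"
      unfolding fl by linarith+
    then have i1: "real i * h \<le> (x - a) \<bullet> f" "(x - a) \<bullet> f < real (Suc i) * h"
      using h by (auto simp: field_simps)
    then have "real i * h < real n * h" using xf h by linarith
    then have "real i < real n" using h(1) by (rule mult_right_less_imp_less[OF _ less_imp_le])
    then have "i < n" by simp
    moreover have "x \<in> T i"
      unfolding T_iff using i1 x by (auto simp: half_open_box_def)
    ultimately show "x \<in> (\<Union>i\<in>{..<n}. T i)" by blast
  qed
  also have "(\<Sum>i\<in>{..<n}. measure lebesgue (T i)) = real n * measure lebesgue (half_open_box B a (L(f := h)))"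
    by (simp add: T_def measure_half_open_box_translate)
  finally show ?thesis by (simp add: h_def)
qed

text \<open>
  The difference quotient of step \<open>h\<close> integrates over the box to \<open>1/h\<close> times the integral of
  \<open>F\<close> over the translated box minus the box. These two sets differ only by a slice of thickness \<open>h\<close> at
  each end, and each slice has \<open>h / L f\<close> of the measure of the box. Steps of the form \<open>L f / n\<close> suffice.
\<close>
lemma integral_derivative_half_open_box_le:
  fixes F :: "'a::euclidean_space \<Rightarrow> real"
  assumes B: "orthonormal_basis B" "f \<in> B" and L: "L f > 0"
    and F: "has_C1_derivative F F'" and K: "compact (supp F)" and bd: "\<And>x. \<bar>F x\<bar> \<le> 1"
  shows "(LINT x:half_open_box B a L|lebesgue. F' x f) \<le> 2 / L f * measure lebesgue (half_open_box B a L)"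
proof -
  define S where "S = half_open_box B a L"
  have S: "bounded S" "S \<in> sets borel" "S \<in> sets lebesgue"
    unfolding S_def using half_open_box_bounded[OF B(1)] half_open_box_borel[OF B(1)] by auto
  have ff: "f \<bullet> f = 1" and fe: "e \<in> B \<Longrightarrow> e \<noteq> f \<Longrightarrow> f \<bullet> e = 0" for e
    using orthonormal_basis_inner[OF B(1) B(2)] B(2) by auto
  define h where "h n = L f / real (Suc n)" for n
  have h: "h \<longlonglongrightarrow> 0" "\<And>n. h n \<noteq> 0" "\<And>n. h n > 0" "\<And>n. h n \<le> L f"
  proof -
    have "(\<lambda>n. L f * (1 / real (Suc n))) \<longlonglongrightarrow> L f * 0"
      by (intro tendsto_intros LIMSEQ_Suc[OF lim_1_over_n])
    then show "h \<longlonglongrightarrow> 0" by (simp add: h_def[abs_def])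
    show hp: "h n > 0" for n using L by (simp add: h_def)
    then show "h n \<noteq> 0" for n by (metis less_irrefl)
    show "h n \<le> L f" for n using L by (simp add: h_def field_simps)
  qed
  have Fc: "continuous_on UNIV F" using has_C1_derivativeD[OF F] by blast
  have Fc': "continuous_on UNIV (\<lambda>x. F (x + h n *\<^sub>R f))" for n
    by (intro continuous_on_compose2[OF Fc] continuous_intros) auto
  have main: "(LINT x:S|lebesgue. (F (x + h n *\<^sub>R f) - F x)) / h n \<le> 2 / L f * measure lebesgue S" for n
  proof -
    define S' where "S' = {x. x - h n *\<^sub>R f \<in> S}"
    have S'_eq: "S' = half_open_box B (a + h n *\<^sub>R f) L"
      by (auto simp: S'_def S_def half_open_box_def algebra_simps)
    have S': "bounded S'" "S' \<in> sets borel" "S' \<in> sets lebesgue"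
      unfolding S'_eq using half_open_box_bounded[OF B(1)] half_open_box_borel[OF B(1)] by auto
    define bot where "bot = half_open_box B a (L(f := h n))"
    define top where "top = half_open_box B (a + L f *\<^sub>R f) (L(f := h n))"
    have S_iff: "x \<in> S \<longleftrightarrow> (\<forall>e\<in>B - {f}. 0 \<le> (x - a) \<bullet> e \<and> (x - a) \<bullet> e < L e) \<and> 0 \<le> (x - a) \<bullet> f \<and> (x - a) \<bullet> f < L f" for x
      using B(2) by (auto simp: S_def half_open_box_def)
    have S'_iff: "x \<in> S' \<longleftrightarrow> (\<forall>e\<in>B - {f}. 0 \<le> (x - a) \<bullet> e \<and> (x - a) \<bullet> e < L e) \<and> h n \<le> (x - a) \<bullet> f \<and> (x - a) \<bullet> f < L f + h n" for x
    proof -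
      have "x \<in> S' \<longleftrightarrow> (\<forall>e\<in>B - {f}. 0 \<le> (x - h n *\<^sub>R f - a) \<bullet> e \<and> (x - h n *\<^sub>R f - a) \<bullet> e < L e)
          \<and> 0 \<le> (x - h n *\<^sub>R f - a) \<bullet> f \<and> (x - h n *\<^sub>R f - a) \<bullet> f < L f"
        by (simp add: S'_def S_iff)
      then show ?thesis
        using fe ff by (auto simp: inner_diff_left algebra_simps)
    qed
    have bot_iff: "x \<in> bot \<longleftrightarrow> (\<forall>e\<in>B - {f}. 0 \<le> (x - a) \<bullet> e \<and> (x - a) \<bullet> e < L e) \<and> 0 \<le> (x - a) \<bullet> f \<and> (x - a) \<bullet> f < h n" for x
      using B(2) by (auto simp: bot_def half_open_box_def)
    have top_iff: "x \<in> top \<longleftrightarrow> (\<forall>e\<in>B - {f}. 0 \<le> (x - a) \<bullet> e \<and> (x - a) \<bullet> e < L e) \<and> L f \<le> (x - a) \<bullet> f \<and> (x - a) \<bullet> f < L f + h n" for x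
    proof -
      have "x \<in> top \<longleftrightarrow> (\<forall>e\<in>B - {f}. 0 \<le> (x - (a + L f *\<^sub>R f)) \<bullet> e \<and> (x - (a + L f *\<^sub>R f)) \<bullet> e < L e)
          \<and> 0 \<le> (x - (a + L f *\<^sub>R f)) \<bullet> f \<and> (x - (a + L f *\<^sub>R f)) \<bullet> f < h n"
        using B(2) by (auto simp: top_def half_open_box_def)
      then show ?thesis
        using fe ff by (auto simp: inner_diff_left inner_add_left algebra_simps)
    qed
    have tb: "top \<in> lmeasurable" "bot \<in> lmeasurable"
      unfolding top_def bot_def by (auto intro: half_open_box_lmeasurable[OF B(1)])
    have m: "measure lebesgue bot = h n / L f * measure lebesgue S" "measure lebesgue top = h n / L f * measure lebesgue S"
    proof -
      have "real (Suc n) * measure lebesgue bot = measure lebesgue S"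
        unfolding S_def bot_def h_def by (rule measure_half_open_box_slice[where L=L, OF B L]) simp
      then show bot: "measure lebesgue bot = h n / L f * measure lebesgue S"
        using L by (simp add: h_def nonzero_eq_divide_eq mult.commute del: of_nat_Suc)
      show "measure lebesgue top = h n / L f * measure lebesgue S"
        unfolding top_def measure_half_open_box_translate using bot by (simp add: bot_def)
    qed
    have "(LINT x:S|lebesgue. (F (x + h n *\<^sub>R f) - F x))
        = (LINT x:S|lebesgue. F (x + h n *\<^sub>R f)) - (LINT x:S|lebesgue. F x)"
      by (intro set_integral_diff set_integrable_continuous_bounded Fc Fc' S)
    also have "(LINT x:S|lebesgue. F (x + h n *\<^sub>R f)) = (LINT x:S'|lebesgue. F x)"
      unfolding S'_def by (rule set_integral_translate) (auto intro: borel_measurable_continuous_onI Fc S)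
    also have "(LINT x:S'|lebesgue. F x) - (LINT x:S|lebesgue. F x)
        = (LINT x|lebesgue. indicator S' x *\<^sub>R F x - indicator S x *\<^sub>R F x)"
      using set_integrable_continuous_bounded[OF Fc S'(1,3)] set_integrable_continuous_bounded[OF Fc S(1,3)]
      unfolding set_integrable_def set_lebesgue_integral_def by simp
    also have "\<dots> \<le> (LINT x|lebesgue. indicator top x + indicator bot x)"
    proof (rule integral_mono)
      show "integrable lebesgue (\<lambda>x. indicator S' x *\<^sub>R F x - indicator S x *\<^sub>R F x)"
        using set_integrable_continuous_bounded[OF Fc S'(1,3)] set_integrable_continuous_bounded[OF Fc S(1,3)]
        unfolding set_integrable_def by simp
      show "integrable lebesgue (\<lambda>x. indicator top x + indicator bot x :: real)"
        using tb by (auto simp: fmeasurable_def)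
      show "indicator S' x *\<^sub>R F x - indicator S x *\<^sub>R F x \<le> indicator top x + indicator bot x" for x
      proof -
        have "S' - S \<subseteq> top" "S - S' \<subseteq> bot" using h(3,4)[of n] by (auto simp: S_iff S'_iff top_iff bot_iff)
        then show ?thesis using bd[of x] by (auto simp: indicator_def)
      qed
    qed
    also have "\<dots> = measure lebesgue top + measure lebesgue bot"
      using tb by (subst Bochner_Integration.integral_add) (auto simp: fmeasurable_def)
    also have "\<dots> = h n * (2 / L f * measure lebesgue S)" by (simp add: m)
    finally show ?thesis
      using h(3)[of n] by (simp add: divide_le_eq mult.commute)
  qed
  have "(\<lambda>n. (LINT x:S|lebesgue. (F (x + h n *\<^sub>R f) - F x)) / h n)
          \<longlonglongrightarrow> (LINT x:S|lebesgue. F' x f)"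
    by (rule integral_difference_quotient_tendsto[OF F K S(1,3) h(1,2)])
  then show ?thesis
    unfolding S_def[symmetric] by (rule LIMSEQ_le_const2) (use main in auto)
qed

lemma divergence_orthonormal_basis:
  fixes \<phi> :: "'a::euclidean_space \<Rightarrow> 'a"
  assumes \<phi>: "has_C1_derivative \<phi> \<phi>'" and B: "orthonormal_basis B"
  shows "divergence \<phi> x = (\<Sum>e\<in>B. \<phi>' x e \<bullet> e)"
proof -
  have lin: "\<phi>' x y = (\<Sum>e\<in>B. (y \<bullet> e) *\<^sub>R \<phi>' x e)" for y
  proof -
    have "\<phi>' x (\<Sum>e\<in>B. (y \<bullet> e) *\<^sub>R e) = (\<Sum>e\<in>B. (y \<bullet> e) *\<^sub>R \<phi>' x e)"
      using has_C1_derivativeD(4)[OF \<phi>] by (simp add: linear_sum linear_cmul)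
    then show ?thesis by (simp only: orthonormal_basis_sum[OF B])
  qed
  have "divergence \<phi> x = (\<Sum>i\<in>Basis. \<Sum>e\<in>B. (i \<bullet> e) * (\<phi>' x e \<bullet> i))"
    unfolding divergence_def has_C1_derivative_frechet[OF \<phi>]
    by (subst lin) (simp add: inner_sum_left)
  also have "\<dots> = (\<Sum>e\<in>B. \<Sum>i\<in>Basis. (i \<bullet> e) * (\<phi>' x e \<bullet> i))" by (rule sum.swap)
  also have "\<dots> = (\<Sum>e\<in>B. \<phi>' x e \<bullet> e)"
    by (rule sum.cong[OF refl], subst euclidean_inner) (simp add: inner_commute mult.commute)
  finally show ?thesis .
qed

text \<open>
  The divergence is a trace, so it can be computed in the basis \<open>B\<close>; each coordinate contributes the
  flux through one pair of opposite faces.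
\<close>
lemma perimeter_half_open_box_le:
  fixes a :: "'a::euclidean_space"
  assumes B: "orthonormal_basis B" and L: "\<And>e. e \<in> B \<Longrightarrow> L e > 0"
  shows "perimeter (half_open_box B a L) \<le> ereal ((\<Sum>e\<in>B. 2 / L e) * measure lebesgue (half_open_box B a L))"
  unfolding perimeter_def
proof (rule SUP_least, clarify)
  fix \<phi> :: "'a \<Rightarrow> 'a"
  assume "C_k 1 \<phi>" and K: "compact (supp \<phi>)" and bd: "\<forall>x. norm (\<phi> x) \<le> 1"
  define \<phi>' where "\<phi>' x = frechet_derivative \<phi> (at x)" for x
  have \<phi>: "has_C1_derivative \<phi> \<phi>'"
    using \<open>C_k 1 \<phi>\<close> by (simp only: C_k_1_iff \<phi>'_def[abs_def])
  define S where "S = half_open_box B a L"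
  have S: "bounded S" "S \<in> sets lebesgue"
    unfolding S_def using half_open_box_bounded[OF B] half_open_box_borel[OF B] by auto
  have C: "has_C1_derivative (\<lambda>x. \<phi> x \<bullet> e) (\<lambda>x v. \<phi>' x v \<bullet> e)" for e
    by (rule has_C1_derivative_inner_left[OF \<phi>])
  have "(LINT x:S|lebesgue. divergence \<phi> x) = (LINT x:S|lebesgue. \<Sum>e\<in>B. \<phi>' x e \<bullet> e)"
    by (simp add: divergence_orthonormal_basis[OF \<phi> B])
  also have "\<dots> = (\<Sum>e\<in>B. LINT x:S|lebesgue. \<phi>' x e \<bullet> e)"
  proof -
    have "integrable lebesgue (\<lambda>x. indicator S x *\<^sub>R (\<phi>' x e \<bullet> e))" for e
      using set_integrable_continuous_bounded[OF has_C1_derivativeD(2)[OF C] S] unfolding set_integrable_def .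
    then show ?thesis
      unfolding set_lebesgue_integral_def by (simp add: sum_distrib_left)
  qed
  also have "\<dots> \<le> (\<Sum>e\<in>B. 2 / L e * measure lebesgue S)"
  proof (rule sum_mono)
    fix e assume e: "e \<in> B"
    have "compact (supp (\<lambda>x. \<phi> x \<bullet> e))"
      by (rule compact_supp_bounded[OF K]) (simp add: supp_outside)
    moreover have "\<bar>\<phi> x \<bullet> e\<bar> \<le> 1" for x
      using Cauchy_Schwarz_ineq2[of "\<phi> x" e] bd orthonormal_basis_norm[OF B e] by (metis mult.right_neutral order_trans)
    ultimately show "(LINT x:S|lebesgue. \<phi>' x e \<bullet> e) \<le> 2 / L e * measure lebesgue S"
      unfolding S_def by (rule integral_derivative_half_open_box_le[where L=L, OF B e L[OF e] C[of e]])
  qed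
  also have "\<dots> = (\<Sum>e\<in>B. 2 / L e) * measure lebesgue S" by (simp add: sum_distrib_right)
  finally show "ereal (LINT x:half_open_box B a L|lebesgue. divergence \<phi> x)
      \<le> ereal ((\<Sum>e\<in>B. 2 / L e) * measure lebesgue (half_open_box B a L))"
    by (simp add: S_def)
qed

lemma cheeger_le_box:
  fixes a :: "'a::euclidean_space"
  assumes B: "orthonormal_basis B" and L: "\<And>e. e \<in> B \<Longrightarrow> L e > 0"
    and sub: "{x. \<forall>e\<in>B. 0 \<le> (x - a) \<bullet> e \<and> (x - a) \<bullet> e \<le> L e} \<subseteq> \<Omega>"
  shows "cheeger \<Omega> \<le> ereal (\<Sum>e\<in>B. 2 / L e)"
proof -
  define S where "S = half_open_box B a L"
  have pos: "measure lebesgue S > 0" unfolding S_def by (rule half_open_box_measure_pos[OF B L])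
  have "cheeger \<Omega> \<le> perimeter S / ereal (measure lebesgue S)"
    unfolding cheeger_def
    by (rule INF_lower)
       (use pos subset_trans[OF half_open_box_subset sub] half_open_box_borel[OF B] in \<open>auto simp: S_def\<close>)
  also have "\<dots> \<le> ereal ((\<Sum>e\<in>B. 2 / L e) * measure lebesgue S) / ereal (measure lebesgue S)"
    using perimeter_half_open_box_le[OF B L] pos by (intro ereal_divide_right_mono) (auto simp: S_def)
  also have "\<dots> = ereal (\<Sum>e\<in>B. 2 / L e)" using pos by simp
  finally show ?thesis .
qed

section \<open>A smooth function supported in a box\<close>

lemma C_k_SucI:
  assumes "\<And>x. (f has_derivative f' x) (at x)" "\<And>i. i \<in> Basis \<Longrightarrow> C_k k (\<lambda>x. f' x i)"
  shows "C_k (Suc k) f"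
proof -
  have "frechet_derivative f (at x) = f' x" for x
    using frechet_derivative_at[OF assms(1)] by metis
  then show ?thesis using assms by (auto simp: differentiable_def)
qed

lemma C_k_Suc_has_derivative:
  "C_k (Suc k) f \<Longrightarrow> (f has_derivative frechet_derivative f (at x)) (at x)"
  by (simp add: frechet_derivative_works)

lemma C_k_Suc_imp: "C_k (Suc k) f \<Longrightarrow> C_k k f"
proof (induction k arbitrary: f)
  case 0
  then have "continuous (at x) f" for x
    by (simp add: differentiable_imp_continuous_within)
  then show ?case by (simp add: continuous_at_imp_continuous_on)
next
  case (Suc k)
  from Suc.prems have d: "\<forall>x. f differentiable (at x)"
    and c: "\<forall>i\<in>Basis. C_k (Suc k) (\<lambda>x. frechet_derivative f (at x) i)" by simp_all
  have "\<forall>i\<in>Basis. C_k k (\<lambda>x. frechet_derivative f (at x) i)"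
    using c Suc.IH by blast
  then show ?case using d by simp
qed

lemma C_k_const: "C_k k (\<lambda>x. c)"
proof (induction k arbitrary: c)
  case (Suc k)
  show ?case by (rule C_k_SucI[where f'="\<lambda>x e. 0"]) (auto intro: Suc)
qed simp

lemma C_k_add: "C_k k f \<Longrightarrow> C_k k g \<Longrightarrow> C_k k (\<lambda>x. f x + g x)"
proof (induction k arbitrary: f g)
  case 0
  then show ?case by (auto intro: continuous_intros)
next
  case (Suc k)
  show ?case
  proof (rule C_k_SucI)
    show "((\<lambda>x. f x + g x) has_derivative
        (\<lambda>e. frechet_derivative f (at x) e + frechet_derivative g (at x) e)) (at x)" for x
      by (intro has_derivative_add C_k_Suc_has_derivative[OF Suc.prems(1)] C_k_Suc_has_derivative[OF Suc.prems(2)])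
    show "C_k k (\<lambda>x. frechet_derivative f (at x) i + frechet_derivative g (at x) i)" if "i \<in> Basis" for i
      using Suc.prems that by (intro Suc.IH) auto
  qed
qed

lemma C_k_mult:
  fixes f g :: "'a::euclidean_space \<Rightarrow> real"
  shows "C_k k f \<Longrightarrow> C_k k g \<Longrightarrow> C_k k (\<lambda>x. f x * g x)"
proof (induction k arbitrary: f g)
  case 0
  then show ?case by (auto intro: continuous_intros)
next
  case (Suc k)
  show ?case
  proof (rule C_k_SucI)
    show "((\<lambda>x. f x * g x) has_derivative
        (\<lambda>e. f x * frechet_derivative g (at x) e + frechet_derivative f (at x) e * g x)) (at x)" for x
      by (intro has_derivative_mult C_k_Suc_has_derivative[OF Suc.prems(1)] C_k_Suc_has_derivative[OF Suc.prems(2)])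
    show "C_k k (\<lambda>x. f x * frechet_derivative g (at x) i + frechet_derivative f (at x) i * g x)"
      if "i \<in> Basis" for i
      using Suc.prems that by (intro C_k_add Suc.IH C_k_Suc_imp[OF Suc.prems(1)] C_k_Suc_imp[OF Suc.prems(2)]) auto
  qed
qed

lemma C_k_prod:
  fixes f :: "'i \<Rightarrow> 'a::euclidean_space \<Rightarrow> real"
  assumes "finite I" "\<And>i. i \<in> I \<Longrightarrow> C_k k (f i)"
  shows "C_k k (\<lambda>x. \<Prod>i\<in>I. f i x)"
  using assms by (induction I rule: finite_induct) (auto intro: C_k_const C_k_mult)

text \<open>
  Smoothness in one real variable with every derivative named: the partial derivatives in \<open>C_k\<close>, taken
  one order at a time, only move along the sequence.
\<close>
definition derivative_tower :: "(nat \<Rightarrow> real \<Rightarrow> real) \<Rightarrow> bool" where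
  "derivative_tower h \<longleftrightarrow> (\<forall>n t. (h n has_real_derivative h (Suc n) t) (at t))"

lemma C_k_derivative_tower:
  fixes v :: "'a::euclidean_space"
  assumes h: "derivative_tower h"
  shows "C_k k (\<lambda>x. h n (x \<bullet> v + c))"
proof (induction k arbitrary: n)
  case 0
  have "isCont (h n) t" for t
    using h DERIV_isCont unfolding derivative_tower_def by blast
  then have "continuous_on UNIV (h n)" by (simp add: continuous_at_imp_continuous_on)
  then have "continuous_on UNIV (\<lambda>x. h n (x \<bullet> v + c))"
    by (rule continuous_on_compose2) (auto intro!: continuous_intros)
  then show ?case by simp
next
  case (Suc k)
  show ?case
  proof (rule C_k_SucI)
    fix x
    have "(h n has_derivative (*) (h (Suc n) (x \<bullet> v + c))) (at (x \<bullet> v + c))"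
      using h by (auto simp: derivative_tower_def has_field_derivative_def)
    then show "((\<lambda>x. h n (x \<bullet> v + c)) has_derivative (\<lambda>e. h (Suc n) (x \<bullet> v + c) * (e \<bullet> v))) (at x)"
      by (rule has_derivative_compose[rotated]) (auto intro!: derivative_eq_intros)
    show "C_k k (\<lambda>x. h (Suc n) (x \<bullet> v + c) * (i \<bullet> v))" for i
      by (intro C_k_mult Suc.IH C_k_const)
  qed
qed

lemma sin_derivative_tower: "derivative_tower (\<lambda>n t. sin (t + real n * (pi / 2)))"
  unfolding derivative_tower_def
proof (intro allI)
  fix n and t :: real
  have "((\<lambda>t. sin (t + real n * (pi / 2))) has_real_derivative cos (t + real n * (pi / 2))) (at t)"
    by (auto intro!: derivative_eq_intros)
  also have "cos (t + real n * (pi / 2)) = sin ((t + real n * (pi / 2)) + pi / 2)"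
    by (simp add: sin_add)
  also have "(t + real n * (pi / 2)) + pi / 2 = t + real (Suc n) * (pi / 2)"
    by (simp add: algebra_simps)
  finally show "((\<lambda>t. sin (t + real n * (pi / 2))) has_real_derivative sin (t + real (Suc n) * (pi / 2))) (at t)" .
qed

text \<open>
  The classical smooth function which is flat at the origin; all its derivatives have the form
  \<open>p (1/t) exp (- 1/t)\<close> for \<open>t > 0\<close>, with a polynomial \<open>p\<close>.
\<close>
definition flat :: "real \<Rightarrow> real" where
  "flat t = (if t > 0 then exp (- (1 / t)) else 0)"

definition flat' :: "real \<Rightarrow> real" where
  "flat' t = (if t > 0 then exp (- (1 / t)) / t\<^sup>2 else 0)"

lemma poly_exp_tendsto_0: "((\<lambda>y::real. poly p y * exp (- y)) \<longlongrightarrow> 0) at_top"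
proof -
  have "((\<lambda>y::real. \<Sum>i\<le>degree p. coeff p i * (y ^ i / exp y)) \<longlongrightarrow> (\<Sum>i\<le>degree p. coeff p i * 0)) at_top"
    by (intro tendsto_intros tendsto_power_div_exp_0)
  moreover have "(\<Sum>i\<le>degree p. coeff p i * (y ^ i / exp y)) = poly p y * exp (- y)" for y :: real
    by (simp add: poly_altdef exp_minus field_simps sum_distrib_right sum_divide_distrib)
  ultimately show ?thesis by simp
qed

lemma poly_flat_tendsto_0:
  "((\<lambda>t::real. if t > 0 then poly p (1 / t) * exp (- (1 / t)) else 0) \<longlongrightarrow> 0) (at 0)"
proof (rule filterlim_split_at)
  show "((\<lambda>t::real. if t > 0 then poly p (1 / t) * exp (- (1 / t)) else 0) \<longlongrightarrow> 0) (at_left 0)"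
  proof (rule tendsto_eventually)
    have "eventually (\<lambda>t::real. t < 0) (at_left 0)" by (simp add: eventually_at_filter)
    then show "eventually (\<lambda>t::real. (if t > 0 then poly p (1 / t) * exp (- (1 / t)) else 0) = 0) (at_left 0)"
      by eventually_elim auto
  qed
  have "((\<lambda>t::real. poly p (inverse t) * exp (- (inverse t))) \<longlongrightarrow> 0) (at_right 0)"
    by (rule filterlim_compose[OF poly_exp_tendsto_0 filterlim_inverse_at_top_right])
  moreover have "eventually (\<lambda>t::real. t > 0) (at_right 0)" by (simp add: eventually_at_filter)
  then have "eventually (\<lambda>t::real. poly p (inverse t) * exp (- (inverse t))
      = (if t > 0 then poly p (1 / t) * exp (- (1 / t)) else 0)) (at_right 0)"
    by eventually_elim (simp add: inverse_eq_divide)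
  ultimately show "((\<lambda>t::real. if t > 0 then poly p (1 / t) * exp (- (1 / t)) else 0) \<longlongrightarrow> 0) (at_right 0)"
    by (rule Lim_transform_eventually)
qed

lemma flat_derivative_step:
  fixes p :: "real poly"
  defines "g \<equiv> \<lambda>p t. if t > 0 then poly p (1 / t) * exp (- (1 / t)) else 0"
  shows "(g p has_real_derivative g ([:0, 0, 1:] * (p - pderiv p)) t) (at t)"
proof -
  consider "t > 0" | "t < 0" | "t = 0" by linarith
  then show ?thesis
  proof cases
    case 1
    have "((\<lambda>t. poly p (1 / t) * exp (- (1 / t))) has_real_derivative
        g ([:0, 0, 1:] * (p - pderiv p)) t) (at t)"
      using 1 by (auto intro!: derivative_eq_intros DERIV_chain2[OF poly_DERIV]
          simp: g_def field_simps power2_eq_square)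
    then show ?thesis
      by (rule has_field_derivative_transform_within_open[of _ _ _ "{0<..}"])
         (use 1 in \<open>auto simp: g_def\<close>)
  next
    case 2
    have "((\<lambda>t. 0) has_real_derivative g ([:0, 0, 1:] * (p - pderiv p)) t) (at t)"
      using 2 by (simp add: g_def)
    then show ?thesis
      by (rule has_field_derivative_transform_within_open[of _ _ _ "{..<0}"])
         (use 2 in \<open>auto simp: g_def\<close>)
  next
    case 3
    \<comment> \<open>Dividing by \<open>h\<close> multiplies the polynomial in \<open>1/h\<close> by its variable.\<close>
    have "g p h / h = g (pCons 0 p) h" for h
      by (simp add: g_def)
    then have "(\<lambda>h. g p h / h) \<midarrow>0\<rightarrow> 0"
      using poly_flat_tendsto_0[of "pCons 0 p"] by (simp add: g_def)
    moreover have "g r 0 = 0" for r by (simp add: g_def)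
    ultimately show ?thesis using 3 by (simp add: DERIV_def)
  qed
qed

lemma flat_derivative_tower: "\<exists>h. derivative_tower h \<and> h 0 = flat \<and> h 1 = flat'"
proof -
  define q where "q = rec_nat 1 (\<lambda>_ p. [:0, 0, 1:] * (p - pderiv p :: real poly))"
  define h where "h n t = (if t > 0 then poly (q n) (1 / t) * exp (- (1 / t)) else 0)" for n t
  have "q (Suc n) = [:0, 0, 1:] * (q n - pderiv (q n))" for n by (simp add: q_def)
  then have "(h n has_real_derivative h (Suc n) t) (at t)" for n t
    using flat_derivative_step[of "q n" t] unfolding h_def[abs_def] by (simp only:)
  then have "derivative_tower h" by (simp add: derivative_tower_def)
  moreover have "h 0 = flat" by (auto simp: h_def q_def flat_def)
  moreover have "h 1 = flat'" by (auto simp: h_def q_def flat'_def power2_eq_square fun_eq_iff)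
  ultimately show ?thesis by blast
qed

lemma flat_has_derivative: "(flat has_real_derivative flat' t) (at t)"
  using flat_derivative_tower unfolding derivative_tower_def by (metis One_nat_def)

lemma continuous_on_flat': "continuous_on UNIV flat'"
proof -
  obtain h where h: "derivative_tower h" "h 1 = flat'" using flat_derivative_tower by blast
  have "isCont (h 1) t" for t
    using h(1) DERIV_isCont unfolding derivative_tower_def by blast
  then show ?thesis using h(2) by (simp add: continuous_at_imp_continuous_on)
qed

lemma flat_bounds: "0 \<le> flat t" "flat t \<le> 1"
  by (auto simp: flat_def)

lemma flat_pos: "t > 0 \<Longrightarrow> flat t > 0"
  by (simp add: flat_def)

lemma flat_nonpos: "t \<le> 0 \<Longrightarrow> flat t = 0" "t \<le> 0 \<Longrightarrow> flat' t = 0"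
  by (auto simp: flat_def flat'_def)

lemma flat_mono: "s \<le> t \<Longrightarrow> flat s \<le> flat t"
  by (auto simp: flat_def frac_le)

lemma flat'_bounds:
  assumes "\<delta> > 0" "t > 0"
  shows "0 \<le> flat' (t / \<delta>) / \<delta>" "t * (flat' (t / \<delta>) / \<delta>) \<le> 1" "t * (flat' (t / \<delta>) / \<delta>) \<le> \<delta> / t"
proof -
  define y where "y = \<delta> / t"
  have y: "y > 0" using assms by (simp add: y_def)
  have eq: "t * (flat' (t / \<delta>) / \<delta>) = y * exp (- y)"
    using assms by (simp add: flat'_def y_def field_simps power2_eq_square)
  have "y \<le> exp y" using exp_ge_add_one_self[of y] by linarith
  then have "y * exp (- y) \<le> exp y * exp (- y)" by (intro mult_right_mono) auto
  also have "\<dots> = 1" by (simp flip: exp_add)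
  finally show "t * (flat' (t / \<delta>) / \<delta>) \<le> 1" using eq by simp
  have "y * exp (- y) \<le> y * 1" using y by (intro mult_left_mono) auto
  then show "t * (flat' (t / \<delta>) / \<delta>) \<le> \<delta> / t" using eq by (simp add: y_def)
  show "0 \<le> flat' (t / \<delta>) / \<delta>" using assms by (simp add: flat'_def)
qed

text \<open>
  Smooth, positive exactly on \<open>(0, L)\<close>, and increasing to 1 there as \<open>\<delta>\<close> decreases to 0.
\<close>
definition bump :: "real \<Rightarrow> real \<Rightarrow> real \<Rightarrow> real" where
  "bump \<delta> L t = flat (t / \<delta>) * flat ((L - t) / \<delta>)"

definition bump' :: "real \<Rightarrow> real \<Rightarrow> real \<Rightarrow> real" where
  "bump' \<delta> L t = flat' (t / \<delta>) / \<delta> * flat ((L - t) / \<delta>) - flat (t / \<delta>) * (flat' ((L - t) / \<delta>) / \<delta>)"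

lemma bump_has_derivative:
  assumes "\<delta> > 0"
  shows "(bump \<delta> L has_real_derivative bump' \<delta> L t) (at t)"
proof -
  have 1: "((\<lambda>t. flat (t / \<delta>)) has_real_derivative flat' (t / \<delta>) * (1 / \<delta>)) (at t)"
    by (rule DERIV_chain2[OF flat_has_derivative]) (use assms in \<open>auto intro!: derivative_eq_intros\<close>)
  have 2: "((\<lambda>t. flat ((L - t) / \<delta>)) has_real_derivative flat' ((L - t) / \<delta>) * (- 1 / \<delta>)) (at t)"
    by (rule DERIV_chain2[OF flat_has_derivative]) (use assms in \<open>auto intro!: derivative_eq_intros\<close>)
  show ?thesis
    using DERIV_mult[OF 1 2] by (simp add: bump_def[abs_def] bump'_def algebra_simps)
qed

lemma continuous_on_bump':
  assumes "\<delta> > 0"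
  shows "continuous_on UNIV (bump' \<delta> L)"
proof -
  have f: "continuous_on UNIV flat"
    using flat_has_derivative DERIV_isCont continuous_at_imp_continuous_on by blast
  show ?thesis
    unfolding bump'_def[abs_def]
    by (intro continuous_intros continuous_on_compose2[OF f] continuous_on_compose2[OF continuous_on_flat'])
       (use assms in auto)
qed

lemma bump_bounds: "0 \<le> bump \<delta> L t" "bump \<delta> L t \<le> 1"
  unfolding bump_def using flat_bounds by (auto intro: mult_le_one)

lemma bump_pos: "\<delta> > 0 \<Longrightarrow> 0 < t \<Longrightarrow> t < L \<Longrightarrow> bump \<delta> L t > 0"
  by (simp add: bump_def flat_pos)

lemma bump_outside:
  assumes "\<delta> > 0" "\<not> (0 < t \<and> t < L)"
  shows "bump \<delta> L t = 0" "bump' \<delta> L t = 0"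
proof -
  have "t / \<delta> \<le> 0 \<or> (L - t) / \<delta> \<le> 0" using assms by (auto simp: divide_le_0_iff)
  then show "bump \<delta> L t = 0" "bump' \<delta> L t = 0"
    by (auto simp: bump_def bump'_def flat_nonpos)
qed

lemma bump_antimono:
  assumes "0 < \<delta>" "\<delta> \<le> \<delta>'"
  shows "bump \<delta>' L t \<le> bump \<delta> L t"
proof (cases "0 < t \<and> t < L")
  case True
  then have "t / \<delta>' \<le> t / \<delta>" "(L - t) / \<delta>' \<le> (L - t) / \<delta>"
    using assms by (auto intro!: divide_left_mono)
  then show ?thesis
    unfolding bump_def by (intro mult_mono flat_mono flat_bounds)
next
  case False
  then show ?thesis using assms bump_outside(1)[of _ t L] by simp
qed

text \<open>
  The derivative of the cutoff is concentrated near the ends of \<open>(0, L)\<close>, where it has size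
  \<open>\<delta>/t\<^sup>2 exp (- \<delta>/t)\<close>; the zero of the sine there gains a factor \<open>t\<close>. What remains,
  \<open>(\<delta>/t) exp (- \<delta>/t)\<close>, is bounded and tends to 0 pointwise. These are the two conditions for dominated
  convergence.
\<close>
lemma sin_bump'_bound:
  assumes "\<delta> > 0" "0 < t" "t < L"
  shows "\<bar>sin (pi / L * t) * bump' \<delta> L t\<bar> \<le> 2 * (pi / L)"
    "\<bar>sin (pi / L * t) * bump' \<delta> L t\<bar> \<le> pi / L * (\<delta> / t + \<delta> / (L - t))"
proof -
  define k where "k = pi / L"
  have k: "k > 0" "k * L = pi" using assms by (auto simp: k_def)
  define A where "A = flat' (t / \<delta>) / \<delta>"
  define C where "C = flat' ((L - t) / \<delta>) / \<delta>"
  have A: "0 \<le> A" "t * A \<le> 1" "t * A \<le> \<delta> / t"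
    using flat'_bounds[OF assms(1,2)] by (auto simp: A_def)
  have C: "0 \<le> C" "(L - t) * C \<le> 1" "(L - t) * C \<le> \<delta> / (L - t)"
    using flat'_bounds[OF assms(1), of "L - t"] assms(3) by (auto simp: C_def)
  have s1: "\<bar>sin (k * t)\<bar> \<le> k * t"
    using abs_sin_x_le_abs_x[of "k * t"] k assms by (simp add: abs_mult)
  have "sin (k * t) = sin (k * (L - t))"
    using k sin_pi_minus[of "k * t"] by (simp add: right_diff_distrib)
  then have s2: "\<bar>sin (k * t)\<bar> \<le> k * (L - t)"
    using abs_sin_x_le_abs_x[of "k * (L - t)"] k assms by (simp add: abs_mult)
  have "\<bar>sin (k * t) * bump' \<delta> L t\<bar> = \<bar>sin (k * t)\<bar> * \<bar>A * flat ((L - t) / \<delta>) - flat (t / \<delta>) * C\<bar>"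
    by (simp add: abs_mult bump'_def A_def C_def)
  also have "\<dots> \<le> \<bar>sin (k * t)\<bar> * (A + C)"
  proof (rule mult_left_mono)
    have "A * flat ((L - t) / \<delta>) \<le> A" "flat (t / \<delta>) * C \<le> C"
      using A(1) C(1) flat_bounds by (auto intro: mult_left_le mult_left_le_one_le)
    moreover have "0 \<le> A * flat ((L - t) / \<delta>)" "0 \<le> flat (t / \<delta>) * C"
      using A(1) C(1) flat_bounds by auto
    ultimately show "\<bar>A * flat ((L - t) / \<delta>) - flat (t / \<delta>) * C\<bar> \<le> A + C" by linarith
  qed simp
  also have "\<dots> \<le> k * (t * A + (L - t) * C)"
    using mult_right_mono[OF s1 A(1)] mult_right_mono[OF s2 C(1)] by (simp add: algebra_simps)
  finally have main: "\<bar>sin (k * t) * bump' \<delta> L t\<bar> \<le> k * (t * A + (L - t) * C)" .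
  also have "\<dots> \<le> k * 2" using A(2) C(2) k by (intro mult_left_mono) auto
  finally show "\<bar>sin (pi / L * t) * bump' \<delta> L t\<bar> \<le> 2 * (pi / L)" by (simp only: k_def mult.commute[of _ 2])
  note main
  also have "k * (t * A + (L - t) * C) \<le> k * (\<delta> / t + \<delta> / (L - t))"
    using A(3) C(3) k by (intro mult_left_mono add_mono) auto
  finally show "\<bar>sin (pi / L * t) * bump' \<delta> L t\<bar> \<le> pi / L * (\<delta> / t + \<delta> / (L - t))" by (simp add: k_def)
qed

definition sine_bump :: "real \<Rightarrow> real \<Rightarrow> real \<Rightarrow> real" where
  "sine_bump \<delta> L t = sin (pi / L * t) * bump \<delta> L t"

text \<open>
  The ground state of the box with corner \<open>a\<close> and sides \<open>L\<close> along \<open>B\<close>, cut off smoothly near the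
  faces.
\<close>
definition box_test_function ::
    "'a::euclidean_space set \<Rightarrow> 'a \<Rightarrow> ('a \<Rightarrow> real) \<Rightarrow> real \<Rightarrow> 'a \<Rightarrow> real" where
  "box_test_function B a L \<delta> x = (\<Prod>e\<in>B. sine_bump \<delta> (L e) ((x - a) \<bullet> e))"

lemma C_k_sine_bump:
  fixes a :: "'a::euclidean_space"
  assumes "\<delta> > 0"
  shows "C_k k (\<lambda>x. sine_bump \<delta> L ((x - a) \<bullet> e))"
proof -
  obtain h where h: "derivative_tower h" "h 0 = flat" using flat_derivative_tower by blast
  have "C_k k (\<lambda>x. sin (x \<bullet> ((pi / L) *\<^sub>R e) + - (pi / L) * (a \<bullet> e) + real 0 * (pi / 2)))"
    by (rule C_k_derivative_tower[OF sin_derivative_tower, where n=0])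
  moreover have "C_k k (\<lambda>x. h 0 (x \<bullet> ((1 / \<delta>) *\<^sub>R e) + - (a \<bullet> e) / \<delta>))"
    "C_k k (\<lambda>x. h 0 (x \<bullet> ((- 1 / \<delta>) *\<^sub>R e) + (L + a \<bullet> e) / \<delta>))"
    by (rule C_k_derivative_tower[OF h(1)])+
  ultimately have "C_k k (\<lambda>x. sin (x \<bullet> ((pi / L) *\<^sub>R e) + - (pi / L) * (a \<bullet> e) + real 0 * (pi / 2)) *
      (h 0 (x \<bullet> ((1 / \<delta>) *\<^sub>R e) + - (a \<bullet> e) / \<delta>) * h 0 (x \<bullet> ((- 1 / \<delta>) *\<^sub>R e) + (L + a \<bullet> e) / \<delta>)))"
    by (intro C_k_mult)
  moreover have "x \<bullet> ((pi / L) *\<^sub>R e) + - (pi / L) * (a \<bullet> e) + real 0 * (pi / 2) = pi / L * ((x - a) \<bullet> e)"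
    "x \<bullet> ((1 / \<delta>) *\<^sub>R e) + - (a \<bullet> e) / \<delta> = (x - a) \<bullet> e / \<delta>"
    "x \<bullet> ((- 1 / \<delta>) *\<^sub>R e) + (L + a \<bullet> e) / \<delta> = (L - (x - a) \<bullet> e) / \<delta>" for x
    using assms by (simp_all add: inner_diff_left diff_divide_distrib add_divide_distrib right_diff_distrib)
  ultimately show ?thesis
    by (simp only: sine_bump_def bump_def h(2))
qed

lemma C_k_box_factor:
  assumes "orthonormal_basis B" "\<delta> > 0" "A \<subseteq> B"
  shows "C_k k (\<lambda>x. \<Prod>e\<in>A. sine_bump \<delta> (L e) ((x - a) \<bullet> e))"
  using finite_subset[OF assms(3) orthonormal_basis_finite[OF assms(1)]]
  by (intro C_k_prod C_k_sine_bump assms)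

lemma sine_bump_outside: "\<delta> > 0 \<Longrightarrow> \<not> (0 < t \<and> t < L) \<Longrightarrow> sine_bump \<delta> L t = 0"
  by (simp add: sine_bump_def bump_outside)

lemma box_test_function_outside:
  assumes "orthonormal_basis B" "\<delta> > 0" "\<not> (\<forall>e\<in>B. 0 < (x - a) \<bullet> e \<and> (x - a) \<bullet> e < L e)"
  shows "box_test_function B a L \<delta> x = 0"
proof -
  obtain e where "e \<in> B" "\<not> (0 < (x - a) \<bullet> e \<and> (x - a) \<bullet> e < L e)" using assms(3) by blast
  then show ?thesis
    unfolding box_test_function_def using orthonormal_basis_finite[OF assms(1)] assms(2)
    by (intro prod_zero) (auto intro: sine_bump_outside)
qed

lemma box_test_function_Cc_inf:
  fixes a :: "'a::euclidean_space"
  assumes B: "orthonormal_basis B" and \<delta>: "\<delta> > 0"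
    and sub: "{x. \<forall>e\<in>B. 0 \<le> (x - a) \<bullet> e \<and> (x - a) \<bullet> e \<le> L e} \<subseteq> \<Omega>"
  shows "box_test_function B a L \<delta> \<in> Cc_inf \<Omega>"
proof -
  define S where "S = {x. \<forall>e\<in>B. 0 \<le> (x - a) \<bullet> e \<and> (x - a) \<bullet> e \<le> L e}"
  have S: "compact S"
    unfolding S_def using box_bounded[OF B] box_closed by (simp add: compact_eq_bounded_closed)
  have z: "box_test_function B a L \<delta> x = 0" if "x \<notin> S" for x
    by (rule box_test_function_outside[OF B \<delta>]) (use that in \<open>force simp: S_def\<close>)
  have "C_k k (box_test_function B a L \<delta>)" for k
    unfolding box_test_function_def[abs_def] by (rule C_k_box_factor[OF B \<delta> subset_refl])
  moreover have "compact (supp (box_test_function B a L \<delta>))"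
    by (rule compact_supp_bounded[OF S z])
  moreover have "supp (box_test_function B a L \<delta>) \<subseteq> \<Omega>"
    using supp_subset_closed[OF compact_imp_closed[OF S], of "box_test_function B a L \<delta>"] z sub
    by (auto simp: S_def)
  ultimately show ?thesis by (simp add: Cc_inf_def)
qed

section \<open>Upper bound for the eigenvalue of a set containing a box\<close>

lemma derivative_along_invariant_direction:
  fixes f :: "'a::euclidean_space \<Rightarrow> real"
  assumes f: "has_C1_derivative f f'" and inv: "\<And>s. f (x + s *\<^sub>R e) = f x"
  shows "f' x e = 0"
proof -
  have "((\<lambda>s. f (x + s *\<^sub>R e)) has_derivative (\<lambda>s. f' (x + 0 *\<^sub>R e) (s *\<^sub>R e))) (at 0)"
    by (rule has_derivative_compose[of "\<lambda>s. x + s *\<^sub>R e", OF _ has_C1_derivativeD(1)[OF f]])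
       (auto intro!: derivative_eq_intros)
  then have "((\<lambda>s. f x) has_derivative (\<lambda>s. f' x (s *\<^sub>R e))) (at (0::real))"
    by (simp add: inv)
  from has_derivative_unique[OF this has_derivative_const] have "(\<lambda>s. f' x (s *\<^sub>R e)) = (\<lambda>s. 0)" .
  from fun_cong[OF this, of 1] show ?thesis by simp
qed

lemma has_C1_derivative_coordinate:
  fixes a :: "'a::euclidean_space"
  assumes h: "\<And>t. (h has_real_derivative h' t) (at t)" "continuous_on UNIV h'"
  shows "has_C1_derivative (\<lambda>x. h ((x - a) \<bullet> e)) (\<lambda>x v. h' ((x - a) \<bullet> e) * (v \<bullet> e))"
proof -
  have eq: "x \<bullet> e + - (a \<bullet> e) = (x - a) \<bullet> e" for x by (simp add: inner_diff_left)
  show ?thesis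
    using has_C1_derivative_compose[OF has_C1_derivative_affine[of e "- (a \<bullet> e)"] h]
    unfolding eq .
qed

text \<open>
  Write \<open>\<phi> = \<psi> P\<close> with \<open>\<psi> = s \<beta>\<close> the factor in the variable \<open>t = (x - a) \<bullet> e\<close>, where \<open>s = sin (k t)\<close>, and
  \<open>P\<close> independent of \<open>t\<close>. Then \<open>\<psi>'\<^sup>2 = k\<^sup>2 \<psi>\<^sup>2 + (s \<beta>')\<^sup>2 + (\<beta>\<^sup>2 s s')'\<close> because \<open>s'' = - k\<^sup>2 s\<close>, and the last
  term times \<open>P\<^sup>2\<close> is a directional derivative along \<open>e\<close>.
\<close>
lemma box_directional_energy:
  fixes a :: "'a::euclidean_space"
  assumes B: "orthonormal_basis B" and e: "e \<in> B" and L: "\<And>e. e \<in> B \<Longrightarrow> L e > 0" and \<delta>: "\<delta> > 0"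
  defines "\<phi> \<equiv> box_test_function B a L \<delta>"
  shows "(LINT x|lebesgue. (grad \<phi> x \<bullet> e)\<^sup>2) \<le> (pi / L e)\<^sup>2 * (LINT x|lebesgue. (\<phi> x)\<^sup>2)
      + (LINT x:half_open_box B a L|lebesgue. (sin (pi / L e * ((x - a) \<bullet> e)) * bump' \<delta> (L e) ((x - a) \<bullet> e))\<^sup>2)"
proof -
  define k where "k = pi / L e"
  define \<beta> where "\<beta> = bump \<delta> (L e)"
  define \<beta>' where "\<beta>' = bump' \<delta> (L e)"
  define \<psi> where "\<psi> t = sin (k * t) * \<beta> t" for t
  define \<psi>' where "\<psi>' t = sin (k * t) * \<beta>' t + (cos (k * t) * k) * \<beta> t" for t
  define q where "q t = (\<beta> t * \<beta> t) * (sin (k * t) * (cos (k * t) * k))" for t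
  define q' where "q' t = (2 * \<beta> t * \<beta>' t) * (sin (k * t) * (cos (k * t) * k))
      + (\<beta> t * \<beta> t) * ((cos (k * t) * k) * (cos (k * t) * k) - k * k * (sin (k * t) * sin (k * t)))" for t
  define P where "P x = (\<Prod>f\<in>B - {e}. sine_bump \<delta> (L f) ((x - a) \<bullet> f))" for x
  have d\<beta>: "(\<beta> has_real_derivative \<beta>' t) (at t)" for t
    unfolding \<beta>_def \<beta>'_def by (rule bump_has_derivative[OF \<delta>])
  have c\<beta>': "continuous_on UNIV \<beta>'" unfolding \<beta>'_def by (rule continuous_on_bump'[OF \<delta>])
  have c\<beta>: "continuous_on UNIV \<beta>"
    by (rule DERIV_continuous_on[of UNIV \<beta> \<beta>']) (use d\<beta> in auto)
  have d\<psi>: "(\<psi> has_real_derivative \<psi>' t) (at t)" for t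
    unfolding \<psi>_def[abs_def] \<psi>'_def
    by (auto intro!: derivative_eq_intros d\<beta> simp: algebra_simps)
  have c\<psi>': "continuous_on UNIV \<psi>'"
    unfolding \<psi>'_def[abs_def] by (intro continuous_intros c\<beta> c\<beta>')
  have dq: "(q has_real_derivative q' t) (at t)" for t
    unfolding q_def[abs_def] q'_def
    by (auto intro!: derivative_eq_intros d\<beta> simp: algebra_simps)
  have cq': "continuous_on UNIV q'"
    unfolding q'_def[abs_def] by (intro continuous_intros c\<beta> c\<beta>')
  have identity: "(\<psi>' t)\<^sup>2 = k\<^sup>2 * (\<psi> t)\<^sup>2 + (sin (k * t) * \<beta>' t)\<^sup>2 + q' t" for t
    unfolding \<psi>'_def \<psi>_def q'_def power2_eq_square by (simp add: algebra_simps)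
  have "C_k 1 P"
    unfolding P_def[abs_def] by (rule C_k_box_factor[OF B \<delta>]) auto
  then obtain P' where CP: "has_C1_derivative P P'" unfolding C_k_1_iff by blast
  have Pinv: "P (x + s *\<^sub>R e) = P x" for x s
    unfolding P_def
  proof (rule prod.cong[OF refl])
    fix f assume "f \<in> B - {e}"
    then have "e \<bullet> f = 0" using orthonormal_basis_inner[OF B e, of f] by auto
    then show "sine_bump \<delta> (L f) ((x + s *\<^sub>R e - a) \<bullet> f) = sine_bump \<delta> (L f) ((x - a) \<bullet> f)"
      by (simp add: inner_diff_left inner_add_left)
  qed
  have P'0: "P' x e = 0" for x
    by (rule derivative_along_invariant_direction[OF CP Pinv])
  have P1: "\<bar>P x\<bar> \<le> 1" for x
  proof -
    have "\<bar>sine_bump \<delta> (L f) t\<bar> \<le> 1" for f t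
      using bump_bounds[of \<delta> "L f" t] unfolding sine_bump_def abs_mult by (intro mult_le_one) auto
    then show ?thesis unfolding P_def abs_prod by (intro prod_le_1) auto
  qed
  have \<phi>_eq: "\<phi> x = \<psi> ((x - a) \<bullet> e) * P x" for x
    unfolding \<phi>_def box_test_function_def P_def
    by (subst prod.remove[OF orthonormal_basis_finite[OF B] e]) (simp add: sine_bump_def \<psi>_def \<beta>_def k_def)
  have ee: "e \<bullet> e = 1" using orthonormal_basis_inner[OF B e e] by simp
  have C\<phi>: "has_C1_derivative \<phi> (\<lambda>x v. \<psi> ((x - a) \<bullet> e) * P' x v + (\<psi>' ((x - a) \<bullet> e) * (v \<bullet> e)) * P x)"
    unfolding \<phi>_eq[abs_def] by (rule has_C1_derivative_mult[OF has_C1_derivative_coordinate[OF d\<psi> c\<psi>'] CP])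
  have grad_e: "grad \<phi> x \<bullet> e = \<psi>' ((x - a) \<bullet> e) * P x" for x
    unfolding grad_inner[OF C\<phi>] by (simp add: P'0 ee)
  \<comment> \<open>Multiplying by \<open>P\<^sup>2\<close>, which is constant along \<open>e\<close>, keeps \<open>q'\<close> an exact derivative.\<close>
  define F where "F x = q ((x - a) \<bullet> e) * (P x * P x)" for x
  define F' where "F' = (\<lambda>x v. q ((x - a) \<bullet> e) * (P x * P' x v + P' x v * P x) + (q' ((x - a) \<bullet> e) * (v \<bullet> e)) * (P x * P x))"
  have CF: "has_C1_derivative F F'"
    unfolding F_def[abs_def] F'_def
    by (rule has_C1_derivative_mult[OF has_C1_derivative_coordinate[OF dq cq'] has_C1_derivative_mult[OF CP CP]])
  have F'e: "F' x e = q' ((x - a) \<bullet> e) * (P x)\<^sup>2" for x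
    by (simp add: F'_def P'0 ee power2_eq_square)
  define S where "S = {x. \<forall>e\<in>B. 0 \<le> (x - a) \<bullet> e \<and> (x - a) \<bullet> e \<le> L e}"
  have S: "compact S"
    unfolding S_def using box_bounded[OF B] box_closed by (simp add: compact_eq_bounded_closed)
  have out: "\<beta> ((x - a) \<bullet> e) * P x = 0" "\<beta>' ((x - a) \<bullet> e) * P x = 0" if notin: "x \<notin> half_open_box B a L" for x
  proof -
    obtain f where f: "f \<in> B" "\<not> (0 \<le> (x - a) \<bullet> f \<and> (x - a) \<bullet> f < L f)"
      using notin unfolding half_open_box_def by blast
    have no: "\<not> (0 < (x - a) \<bullet> f \<and> (x - a) \<bullet> f < L f)" using f by auto
    have "\<beta> ((x - a) \<bullet> e) * P x = 0 \<and> \<beta>' ((x - a) \<bullet> e) * P x = 0"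
    proof (cases "f = e")
      case True
      then show ?thesis using bump_outside[OF \<delta> no] by (simp add: \<beta>_def \<beta>'_def)
    next
      case False
      then have "P x = 0"
        unfolding P_def using f orthonormal_basis_finite[OF B] sine_bump_outside[OF \<delta> no]
        by (intro prod_zero) auto
      then show ?thesis by simp
    qed
    then show "\<beta> ((x - a) \<bullet> e) * P x = 0" "\<beta>' ((x - a) \<bullet> e) * P x = 0" by auto
  qed
  have outS: "\<beta> ((x - a) \<bullet> e) * P x = 0" "\<beta>' ((x - a) \<bullet> e) * P x = 0" if "x \<notin> S" for x
    using out[of x] that half_open_box_subset[of B a L] by (auto simp: S_def)
  have cx: "continuous_on UNIV (\<lambda>x. g ((x - a) \<bullet> e))" if "continuous_on UNIV g" for g :: "real \<Rightarrow> real"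
    by (rule continuous_on_compose2[OF that]) (auto intro!: continuous_intros)
  have cP: "continuous_on UNIV P" using has_C1_derivativeD(3)[OF CP] .
  define R where "R x = (sin (k * ((x - a) \<bullet> e)) * \<beta>' ((x - a) \<bullet> e) * P x)\<^sup>2" for x
  have iR: "integrable lebesgue R"
  proof (rule integrable_continuous_compact_support[OF _ S])
    show "continuous_on UNIV R"
      unfolding R_def[abs_def] by (intro continuous_intros cP cx[OF c\<beta>'])
    show "R x = 0" if "x \<notin> S" for x using outS[OF that] by (auto simp: R_def)
  qed
  have i\<phi>: "integrable lebesgue (\<lambda>x. (\<phi> x)\<^sup>2)"
  proof (rule integrable_continuous_compact_support[OF _ S])
    show "continuous_on UNIV (\<lambda>x. (\<phi> x)\<^sup>2)"
      by (intro continuous_intros has_C1_derivativeD(3)[OF C\<phi>])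
    show "(\<phi> x)\<^sup>2 = 0" if "x \<notin> S" for x using outS[OF that] by (auto simp: \<phi>_eq \<psi>_def)
  qed
  have F0: "F x = 0" if "x \<notin> S" for x
    using outS(1)[OF that] by (auto simp: F_def q_def)
  have F'0: "F' x e = 0" if "x \<notin> S" for x
    using outS[OF that] unfolding F'e q'_def by (auto simp: power2_eq_square)
  have iF: "integrable lebesgue (\<lambda>x. F' x e)"
    by (rule integrable_continuous_compact_support[OF has_C1_derivativeD(2)[OF CF] S F'0])
  have intF: "(LINT x|lebesgue. F' x e) = 0"
    by (rule integral_directional_derivative_zero[OF CF compact_supp_bounded[OF S F0]])
  have "(LINT x|lebesgue. (grad \<phi> x \<bullet> e)\<^sup>2) = (LINT x|lebesgue. k\<^sup>2 * (\<phi> x)\<^sup>2 + R x + F' x e)"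
    unfolding grad_e F'e R_def \<phi>_eq power_mult_distrib identity by (simp add: algebra_simps)
  also have "\<dots> = k\<^sup>2 * (LINT x|lebesgue. (\<phi> x)\<^sup>2) + (LINT x|lebesgue. R x)"
    using iR i\<phi> iF intF by simp
  also have "(LINT x|lebesgue. R x)
      \<le> (LINT x:half_open_box B a L|lebesgue. (sin (k * ((x - a) \<bullet> e)) * \<beta>' ((x - a) \<bullet> e))\<^sup>2)"
    unfolding set_lebesgue_integral_def
  proof (rule integral_mono[OF iR])
    have "continuous_on UNIV (\<lambda>x. (sin (k * ((x - a) \<bullet> e)) * \<beta>' ((x - a) \<bullet> e))\<^sup>2)"
      by (intro continuous_intros cx[OF c\<beta>'])
    from set_integrable_continuous_bounded[OF this half_open_box_bounded[OF B], of a L]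
    show "integrable lebesgue (\<lambda>x. indicator (half_open_box B a L) x *\<^sub>R
        (sin (k * ((x - a) \<bullet> e)) * \<beta>' ((x - a) \<bullet> e))\<^sup>2)"
      using half_open_box_borel[OF B, of a L] by (simp add: set_integrable_def)
    show "R x \<le> indicator (half_open_box B a L) x *\<^sub>R (sin (k * ((x - a) \<bullet> e)) * \<beta>' ((x - a) \<bullet> e))\<^sup>2" for x
    proof (cases "x \<in> half_open_box B a L")
      case True
      have "(P x)\<^sup>2 \<le> 1" using P1[of x] by (simp add: abs_square_le_1)
      then show ?thesis
        using True mult_left_le[of "(P x)\<^sup>2" "(sin (k * ((x - a) \<bullet> e)) * \<beta>' ((x - a) \<bullet> e))\<^sup>2"]
        by (simp add: R_def power_mult_distrib)
    next
      case False
      then show ?thesis using out(2)[OF False] by (auto simp: R_def)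
    qed
  qed
  finally show ?thesis by (simp add: k_def \<beta>'_def)
qed

lemma box_boundary_term_tendsto_0:
  fixes a :: "'a::euclidean_space"
  assumes B: "orthonormal_basis B" and e: "e \<in> B" and L: "\<And>e. e \<in> B \<Longrightarrow> L e > 0"
  shows "(\<lambda>n. LINT x:half_open_box B a L|lebesgue. (sin (pi / L e * ((x - a) \<bullet> e))
      * bump' (1 / real (Suc n)) (L e) ((x - a) \<bullet> e))\<^sup>2) \<longlonglongrightarrow> 0"
proof -
  define S where "S = half_open_box B a L"
  have S: "bounded S" "S \<in> sets lebesgue" "S \<in> lmeasurable"
    unfolding S_def using half_open_box_bounded[OF B] half_open_box_borel[OF B] half_open_box_lmeasurable[OF B] by auto
  define r where "r n x = (sin (pi / L e * ((x - a) \<bullet> e)) * bump' (1 / real (Suc n)) (L e) ((x - a) \<bullet> e))" for n x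
  have "(\<lambda>n. LINT x|lebesgue. indicator S x *\<^sub>R (r n x)\<^sup>2) \<longlonglongrightarrow> (LINT (x::'a)|lebesgue. (0::real))"
  proof (rule integral_dominated_convergence[where w="\<lambda>x. indicator S x *\<^sub>R (2 * (pi / L e))\<^sup>2"])
    show "(\<lambda>x. indicator S x *\<^sub>R (r n x)\<^sup>2) \<in> borel_measurable lebesgue" for n
    proof -
      have "continuous_on UNIV (\<lambda>x. (r n x)\<^sup>2)"
        unfolding r_def
        by (intro continuous_intros continuous_on_compose2[OF continuous_on_bump']) auto
      from set_integrable_continuous_bounded[OF this S(1,2)] show ?thesis
        unfolding set_integrable_def by (rule borel_measurable_integrable)
    qed
    show "integrable lebesgue (\<lambda>x. indicator S x *\<^sub>R (2 * (pi / L e))\<^sup>2)"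
      by (rule integrable_scaleR_left, rule integrable_real_indicator)
         (use S(3) in \<open>auto simp: fmeasurable_def\<close>)
    have inside: "0 < (x - a) \<bullet> e \<and> (x - a) \<bullet> e < L e \<or> r n x = 0" for n x
      using bump_outside(2)[of "1 / real (Suc n)" "(x - a) \<bullet> e" "L e"] by (auto simp: r_def)
    show "AE x in lebesgue. norm (indicator S x *\<^sub>R (r n x)\<^sup>2) \<le> indicator S x *\<^sub>R (2 * (pi / L e))\<^sup>2" for n
    proof (rule AE_I2)
      fix x
      have "\<bar>r n x\<bar> \<le> 2 * (pi / L e)"
        using inside[of x n] sin_bump'_bound(1)[of "1 / real (Suc n)" "(x - a) \<bullet> e" "L e"] L[OF e]
        by (auto simp: r_def)
      then have "(r n x)\<^sup>2 \<le> (2 * (pi / L e))\<^sup>2"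
        using power_mono[of "\<bar>r n x\<bar>" "2 * (pi / L e)" 2] by simp
      then show "norm (indicator S x *\<^sub>R (r n x)\<^sup>2) \<le> indicator S x *\<^sub>R (2 * (pi / L e))\<^sup>2"
        by (auto simp: indicator_def)
    qed
    show "AE x in lebesgue. (\<lambda>n. indicator S x *\<^sub>R (r n x)\<^sup>2) \<longlonglongrightarrow> 0"
    proof (rule AE_I2)
      fix x
      have "(\<lambda>n. r n x) \<longlonglongrightarrow> 0"
      proof (cases "0 < (x - a) \<bullet> e \<and> (x - a) \<bullet> e < L e")
        case True
        define t where "t = (x - a) \<bullet> e"
        show ?thesis
        proof (rule Lim_null_comparison)
          show "eventually (\<lambda>n. norm (r n x) \<le> pi / L e * (1 / real (Suc n) / t + 1 / real (Suc n) / (L e - t))) sequentially"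
            using True sin_bump'_bound(2)[of "1 / real (Suc _)" t "L e"] by (simp add: r_def t_def del: of_nat_Suc)
          have "(\<lambda>n. pi / L e * (1 / real (Suc n) / t + 1 / real (Suc n) / (L e - t)))
              \<longlonglongrightarrow> pi / L e * (0 / t + 0 / (L e - t))"
            using True by (intro tendsto_intros LIMSEQ_Suc[OF lim_1_over_n]) (auto simp: t_def)
          then show "(\<lambda>n. pi / L e * (1 / real (Suc n) / t + 1 / real (Suc n) / (L e - t))) \<longlonglongrightarrow> 0" by simp
        qed
      next
        case False
        then have "r n x = 0" for n using inside[of x n] by blast
        then show ?thesis by simp
      qed
      then have "(\<lambda>n. indicator S x *\<^sub>R (r n x)\<^sup>2) \<longlonglongrightarrow> indicator S x *\<^sub>R 0\<^sup>2"
        by (intro tendsto_intros)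
      then show "(\<lambda>n. indicator S x *\<^sub>R (r n x)\<^sup>2) \<longlonglongrightarrow> 0" by simp
    qed
  qed simp
  then show ?thesis by (simp add: r_def S_def set_lebesgue_integral_def)
qed

text \<open>
  The mass increases as \<open>\<delta>\<close> decreases, so its value at \<open>\<delta> = 1\<close> is a positive lower bound for all
  \<open>\<delta> \<le> 1\<close>.
\<close>
lemma box_test_function_mass:
  fixes a :: "'a::euclidean_space"
  assumes B: "orthonormal_basis B" and L: "\<And>e. e \<in> B \<Longrightarrow> L e > 0"
  shows "0 < (LINT x|lebesgue. (box_test_function B a L 1 x)\<^sup>2)"
    and "0 < \<delta> \<Longrightarrow> \<delta> \<le> 1 \<Longrightarrow>
      (LINT x|lebesgue. (box_test_function B a L 1 x)\<^sup>2) \<le> (LINT x|lebesgue. (box_test_function B a L \<delta> x)\<^sup>2)"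
proof -
  have fin: "finite B" by (rule orthonormal_basis_finite[OF B])
  have int: "integrable lebesgue (\<lambda>x. (box_test_function B a L \<delta> x)\<^sup>2)" if "\<delta> > 0" for \<delta>
  proof -
    note D = Cc_infD[OF box_test_function_Cc_inf[where a=a and L=L, OF B that subset_UNIV]]
    show ?thesis
      by (rule integrable_continuous_compact_support[OF _ D(2)])
         (auto intro!: continuous_intros has_C1_derivativeD(3)[OF D(1)] simp: supp_outside)
  qed
  show "(LINT x|lebesgue. (box_test_function B a L 1 x)\<^sup>2) \<le> (LINT x|lebesgue. (box_test_function B a L \<delta> x)\<^sup>2)"
    if \<delta>: "0 < \<delta>" "\<delta> \<le> 1"
  proof (rule integral_mono[OF int int])
    fix x
    have "\<bar>box_test_function B a L 1 x\<bar> \<le> \<bar>box_test_function B a L \<delta> x\<bar>"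
      unfolding box_test_function_def abs_prod
    proof (intro prod_mono conjI abs_ge_zero)
      fix e
      show "\<bar>sine_bump 1 (L e) ((x - a) \<bullet> e)\<bar> \<le> \<bar>sine_bump \<delta> (L e) ((x - a) \<bullet> e)\<bar>"
        unfolding sine_bump_def abs_mult using bump_antimono[OF \<delta>] bump_bounds
        by (intro mult_left_mono) auto
    qed
    then show "(box_test_function B a L 1 x)\<^sup>2 \<le> (box_test_function B a L \<delta> x)\<^sup>2"
      by (simp add: abs_le_square_iff)
  qed (use \<delta> in auto)
  define U where "U = {x. \<forall>e\<in>B. 0 < (x - a) \<bullet> e \<and> (x - a) \<bullet> e < L e}"
  have U: "open U" "U \<noteq> {}"
    unfolding U_def using open_box_open[OF B] open_box_nonempty[OF B L] by auto
  have pos: "box_test_function B a L 1 x \<noteq> 0" if "x \<in> U" for x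
  proof -
    have "sine_bump 1 (L e) ((x - a) \<bullet> e) \<noteq> 0" if "e \<in> B" for e
    proof -
      have t: "0 < (x - a) \<bullet> e" "(x - a) \<bullet> e < L e" using \<open>x \<in> U\<close> that by (auto simp: U_def)
      have "pi / L e * ((x - a) \<bullet> e) < pi" using t by (simp add: field_simps)
      then have "sin (pi / L e * ((x - a) \<bullet> e)) > 0" using t L[OF that] by (intro sin_gt_zero) auto
      then show ?thesis using bump_pos[OF _ t, of 1] by (simp add: sine_bump_def)
    qed
    then show ?thesis using fin by (simp add: box_test_function_def)
  qed
  show "0 < (LINT x|lebesgue. (box_test_function B a L 1 x)\<^sup>2)"
  proof (rule ccontr)
    assume "\<not> ?thesis"
    moreover have "(LINT x|lebesgue. (box_test_function B a L 1 x)\<^sup>2) \<ge> 0" by simp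
    ultimately have "(LINT x|lebesgue. (box_test_function B a L 1 x)\<^sup>2) = 0" by linarith
    then have "AE x in lebesgue. (box_test_function B a L 1 x)\<^sup>2 = 0"
      by (subst (asm) integral_nonneg_eq_0_iff_AE[OF int]) auto
    then have "AE x in lebesgue. x \<notin> U"
      by (rule AE_mp) (use pos in auto)
    then have "U \<in> null_sets lebesgue"
      using U(1) by (subst AE_iff_null_sets) auto
    then show False using open_not_negligible[OF U] by (simp add: negligible_iff_null_sets)
  qed
qed

text \<open>
  Summing the directional energies over the basis gives the Rayleigh quotient
  \<open>\<Sum>\<^sub>e (\<pi>/L\<^sub>e)\<^sup>2\<close> up to the boundary terms, which vanish with \<open>\<delta>\<close>.
\<close>
lemma lambda1_le_box:
  fixes a :: "'a::euclidean_space"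
  assumes B: "orthonormal_basis B" and L: "\<And>e. e \<in> B \<Longrightarrow> L e > 0" and \<Omega>: "open \<Omega>"
    and sub: "{x. \<forall>e\<in>B. 0 \<le> (x - a) \<bullet> e \<and> (x - a) \<bullet> e \<le> L e} \<subseteq> \<Omega>"
  shows "lambda1 \<Omega> \<le> (\<Sum>e\<in>B. (pi / L e)\<^sup>2)"
proof -
  define M where "M = (LINT x|lebesgue. (box_test_function B a L 1 x)\<^sup>2)"
  have M: "M > 0" unfolding M_def by (rule box_test_function_mass(1)[OF B L])
  define R where "R e n = (LINT x:half_open_box B a L|lebesgue. (sin (pi / L e * ((x - a) \<bullet> e))
      * bump' (1 / real (Suc n)) (L e) ((x - a) \<bullet> e))\<^sup>2)" for e n
  have R0: "R e n \<ge> 0" for e n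
    unfolding R_def set_lebesgue_integral_def by (rule integral_nonneg_AE) (simp add: indicator_def)
  have bound: "lambda1 \<Omega> \<le> (\<Sum>e\<in>B. (pi / L e)\<^sup>2) + (\<Sum>e\<in>B. R e n) / M" for n
  proof -
    define \<delta> where "\<delta> = 1 / real (Suc n)"
    have \<delta>: "0 < \<delta>" "\<delta> \<le> 1" by (auto simp: \<delta>_def)
    define \<phi> where "\<phi> = box_test_function B a L \<delta>"
    define N where "N = (LINT x|lebesgue. (\<phi> x)\<^sup>2)"
    have N: "M \<le> N" unfolding M_def N_def \<phi>_def by (rule box_test_function_mass(2)[OF B L \<delta>])
    have \<phi>: "\<phi> \<in> Cc_inf \<Omega>" unfolding \<phi>_def by (rule box_test_function_Cc_inf[OF B \<delta>(1) sub])
    note D = Cc_infD[OF \<phi>]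
    have int: "integrable lebesgue (\<lambda>x. (grad \<phi> x \<bullet> e)\<^sup>2)" for e
      by (rule integrable_continuous_compact_support[OF _ D(2)])
         (auto intro!: continuous_intros continuous_on_grad[OF D(1)] simp: grad_outside_supp[OF D(1)])
    have "(LINT x|lebesgue. (norm (grad \<phi> x))\<^sup>2) = (\<Sum>e\<in>B. LINT x|lebesgue. (grad \<phi> x \<bullet> e)\<^sup>2)"
      unfolding orthonormal_basis_norm_sq[OF B] using int by (rule Bochner_Integration.integral_sum)
    also have "\<dots> \<le> (\<Sum>e\<in>B. (pi / L e)\<^sup>2 * N + R e n)"
      unfolding N_def R_def \<phi>_def using box_directional_energy[where a=a, OF B _ L \<delta>(1)]
      by (intro sum_mono) (simp only: \<delta>_def)
    also have "\<dots> = (\<Sum>e\<in>B. (pi / L e)\<^sup>2) * N + (\<Sum>e\<in>B. R e n)"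
      by (simp add: sum.distrib sum_distrib_right)
    finally have E: "(LINT x|lebesgue. (norm (grad \<phi> x))\<^sup>2) \<le> (\<Sum>e\<in>B. (pi / L e)\<^sup>2) * N + (\<Sum>e\<in>B. R e n)" .
    have "lambda1 \<Omega> \<le> (LINT x|lebesgue. (norm (grad \<phi> x))\<^sup>2) / N"
      unfolding N_def by (rule lambda1_le_Cc_inf[OF \<Omega> \<phi>]) (use M N in \<open>simp add: N_def\<close>)
    also have "\<dots> \<le> ((\<Sum>e\<in>B. (pi / L e)\<^sup>2) * N + (\<Sum>e\<in>B. R e n)) / N"
      using E M N by (intro divide_right_mono) auto
    also have "\<dots> = (\<Sum>e\<in>B. (pi / L e)\<^sup>2) + (\<Sum>e\<in>B. R e n) / N"
      using M N by (simp add: add_divide_distrib)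
    also have "(\<Sum>e\<in>B. R e n) / N \<le> (\<Sum>e\<in>B. R e n) / M"
      using M N R0 by (intro divide_left_mono sum_nonneg) auto
    finally show ?thesis by simp
  qed
  have "(\<lambda>n. (\<Sum>e\<in>B. (pi / L e)\<^sup>2) + (\<Sum>e\<in>B. R e n) / M) \<longlonglongrightarrow> (\<Sum>e\<in>B. (pi / L e)\<^sup>2) + (\<Sum>e\<in>B. 0) / M"
    using M unfolding R_def by (intro tendsto_intros box_boundary_term_tendsto_0[OF B _ L]) auto
  then show ?thesis
    using bound by (intro LIMSEQ_le_const[of _ "(\<Sum>e\<in>B. (pi / L e)\<^sup>2)"]) auto
qed

lemma Cc_inf_nontrivial_box:
  fixes a :: "'a::euclidean_space"
  assumes B: "orthonormal_basis B" and L: "\<And>e. e \<in> B \<Longrightarrow> L e > 0" and \<Omega>: "open \<Omega>"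
    and sub: "{x. \<forall>e\<in>B. 0 \<le> (x - a) \<bullet> e \<and> (x - a) \<bullet> e \<le> L e} \<subseteq> \<Omega>"
  obtains v where "v \<in> Cc_inf \<Omega>" "\<not> (AE x in lebesgue. x \<in> \<Omega> \<longrightarrow> v x = 0)"
proof -
  have v: "box_test_function B a L 1 \<in> Cc_inf \<Omega>"
    by (rule box_test_function_Cc_inf[OF B _ sub]) simp
  show ?thesis
    by (rule that[OF v lambda1_le_Cc_inf(2)[OF \<Omega> v box_test_function_mass(1)[OF B L]]])
qed

section \<open>The limit for vanishing relative width\<close>

text \<open>
  With \<open>\<rho> = w / W\<close>, these are the slab and box bounds for \<open>w\<^sup>2 \<lambda>\<^sub>1\<close> and \<open>w h\<close>, whose quotient
  \<open>w\<^sup>2 \<lambda>\<^sub>1 / (w h)\<^sup>2\<close> is \<open>J\<close>: only \<open>\<rho>\<close> and \<open>\<epsilon>\<close> remain.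
\<close>
lemma J_thin_convex_body_bounds:
  fixes K :: "'a::euclidean_space set"
  assumes K: "convex_body K" and dim: "DIM('a) \<ge> 2"
  obtains \<rho> where "\<rho> > 0" "rel_width K = ereal \<rho>"
    "\<And>\<epsilon>. 0 < \<epsilon> \<Longrightarrow> \<epsilon> < 1/3 \<Longrightarrow>
      pi\<^sup>2 / (2 / ((1 - 2 * \<epsilon>) * (1 - 3 * \<epsilon>)) + 2 * (real DIM('a) - 1)\<^sup>2 / ((1 - 2 * \<epsilon>) * \<epsilon>) * \<rho>)\<^sup>2 \<le> J (interior K)"
    "\<And>\<epsilon>. 0 < \<epsilon> \<Longrightarrow> \<epsilon> < 1/3 \<Longrightarrow>
      J (interior K) \<le> ((pi / ((1 - 2 * \<epsilon>) * (1 - 3 * \<epsilon>)))\<^sup>2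
        + (real DIM('a) - 1) * (pi * (real DIM('a) - 1) / ((1 - 2 * \<epsilon>) * \<epsilon>) * \<rho>)\<^sup>2) / 4"
proof -
  obtain w W u B a0 where w: "w > 0" and W: "W > 0" and rel: "rel_width K = ereal (w / W)"
    and B: "orthonormal_basis B" "u \<in> B" "card B = DIM('a)"
    and slab: "interior K \<subseteq> {x. a0 < x \<bullet> u \<and> x \<bullet> u < a0 + w}"
    and box: "\<And>\<epsilon>. 0 < \<epsilon> \<Longrightarrow> \<epsilon> < 1/3 \<Longrightarrow> \<exists>a. {x. \<forall>e\<in>B. 0 \<le> (x - a) \<bullet> e \<and> (x - a) \<bullet> e \<le>
        (1 - 2 * \<epsilon>) * (if e = u then (1 - 3 * \<epsilon>) * w else \<epsilon> / (real DIM('a) - 1) * W)} \<subseteq> interior K"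
    by (rule convex_body_geometry[OF K dim]) (rule that)
  define m where "m = real DIM('a) - 1"
  have m: "m > 0" using dim by (simp add: m_def)
  define \<rho> where "\<rho> = w / W"
  have \<rho>: "\<rho> > 0" using w W by (simp add: \<rho>_def)
  have un: "norm u = 1" using orthonormal_basis_norm[OF B(1,2)] .
  have bK: "bounded (interior K)"
    using K by (intro bounded_subset[OF _ interior_subset]) (simp add: convex_body_def)
  define h where "h = real_of_ereal (cheeger (interior K))"
  define l where "l = lambda1 (interior K)"
  have J: "J (interior K) = l / h\<^sup>2" by (simp add: J_def h_def l_def)
  have main: "(pi / w)\<^sup>2 \<le> l \<and> l \<le> (pi / (T * w))\<^sup>2 + m * (pi / (C * W))\<^sup>2 \<and> 2 / w \<le> h \<and>
      h \<le> 2 / (T * w) + m * (2 / (C * W))"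
    if \<epsilon>: "0 < \<epsilon>" "\<epsilon> < 1/3" and T: "T = (1 - 2 * \<epsilon>) * (1 - 3 * \<epsilon>)" and C: "C = (1 - 2 * \<epsilon>) * (\<epsilon> / m)" for \<epsilon> T C
  proof -
    define L where "L e = (1 - 2 * \<epsilon>) * (if e = u then (1 - 3 * \<epsilon>) * w else \<epsilon> / m * W)" for e
    have L: "L e > 0" for e using \<epsilon> w W m by (simp add: L_def)
    obtain a where a: "{x. \<forall>e\<in>B. 0 \<le> (x - a) \<bullet> e \<and> (x - a) \<bullet> e \<le> L e} \<subseteq> interior K"
      using box[OF \<epsilon>] unfolding L_def m_def by blast
    have sumL: "(\<Sum>e\<in>B. g (L e)) = g (T * w) + m * g (C * W)" for g :: "real \<Rightarrow> real"
    proof -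
      have "(\<Sum>e\<in>B. g (L e)) = g (L u) + (\<Sum>e\<in>B - {u}. g (L e))"
        by (rule sum.remove[OF orthonormal_basis_finite[OF B(1)] B(2)])
      also have "(\<Sum>e\<in>B - {u}. g (L e)) = (\<Sum>e\<in>B - {u}. g (C * W))"
        by (rule sum.cong[OF refl]) (simp add: L_def C mult.assoc)
      also have "\<dots> = m * g (C * W)"
        using B dim orthonormal_basis_finite[OF B(1)] by (simp add: m_def of_nat_diff)
      finally show ?thesis by (simp add: L_def T mult.assoc)
    qed
    obtain v where v: "v \<in> Cc_inf (interior K)" "\<not> (AE x in lebesgue. x \<in> interior K \<longrightarrow> v x = 0)"
      using Cc_inf_nontrivial_box[OF B(1) L open_interior a] by blast
    have "(pi / w)\<^sup>2 \<le> l"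
      unfolding l_def by (rule lambda1_ge_slab[OF open_interior slab un w v])
    moreover have "l \<le> (pi / (T * w))\<^sup>2 + m * (pi / (C * W))\<^sup>2"
      using lambda1_le_box[OF B(1) L open_interior a] unfolding l_def sumL[of "\<lambda>t. (pi / t)\<^sup>2"] .
    moreover have "ereal (2 / w) \<le> cheeger (interior K)"
      by (rule cheeger_ge_slab[OF _ bK un w, of a0]) (use slab in force)
    moreover have "cheeger (interior K) \<le> ereal (2 / (T * w) + m * (2 / (C * W)))"
      using cheeger_le_box[OF B(1) L a] unfolding sumL[of "\<lambda>t. 2 / t"] .
    ultimately show ?thesis
      unfolding h_def by (cases "cheeger (interior K)") auto
  qed
  show ?thesis
  proof (rule that[OF \<rho>])
    show "rel_width K = ereal \<rho>" by (simp add: \<rho>_def rel)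
  next
    fix \<epsilon> :: real assume \<epsilon>: "0 < \<epsilon>" "\<epsilon> < 1/3"
    define T where "T = (1 - 2 * \<epsilon>) * (1 - 3 * \<epsilon>)"
    define C where "C = (1 - 2 * \<epsilon>) * (\<epsilon> / m)"
    have TC: "T > 0" "C > 0" using \<epsilon> m by (auto simp: T_def C_def)
    note M = main[OF \<epsilon> T_def C_def]
    have h: "h > 0" using M w by (meson less_le_trans divide_pos_pos zero_less_numeral)
    have l: "l > 0" using M w by (meson less_le_trans zero_less_power divide_pos_pos pi_gt_zero)
    have Cinv: "1 / C = m / ((1 - 2 * \<epsilon>) * \<epsilon>)" using m \<epsilon> by (simp add: C_def)
    have wh: "2 \<le> w * h" "w * h \<le> 2 / T + 2 * m\<^sup>2 / ((1 - 2 * \<epsilon>) * \<epsilon>) * \<rho>"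
    proof -
      show "2 \<le> w * h" using M w by (simp add: field_simps)
      have "w * h \<le> w * (2 / (T * w) + m * (2 / (C * W)))"
        using M w by (intro mult_left_mono) auto
      also have "\<dots> = 2 / T + 2 * m * (1 / C) * \<rho>"
        using w W TC by (simp add: \<rho>_def field_simps)
      also have "\<dots> = 2 / T + 2 * m\<^sup>2 / ((1 - 2 * \<epsilon>) * \<epsilon>) * \<rho>"
        by (simp add: Cinv power2_eq_square)
      finally show "w * h \<le> 2 / T + 2 * m\<^sup>2 / ((1 - 2 * \<epsilon>) * \<epsilon>) * \<rho>" .
    qed
    have wl: "pi\<^sup>2 \<le> w\<^sup>2 * l" "w\<^sup>2 * l \<le> (pi / T)\<^sup>2 + m * (pi * m / ((1 - 2 * \<epsilon>) * \<epsilon>) * \<rho>)\<^sup>2"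
    proof -
      show "pi\<^sup>2 \<le> w\<^sup>2 * l" using M w by (simp add: field_simps power_divide)
      have "w\<^sup>2 * l \<le> w\<^sup>2 * ((pi / (T * w))\<^sup>2 + m * (pi / (C * W))\<^sup>2)"
        using M by (intro mult_left_mono) auto
      also have "\<dots> = (w * (pi / (T * w)))\<^sup>2 + m * (w * (pi / (C * W)))\<^sup>2"
        by (simp only: power_mult_distrib distrib_left mult.left_commute)
      also have "w * (pi / (T * w)) = pi / T" using w by simp
      also have "w * (pi / (C * W)) = pi * (1 / C) * \<rho>" by (simp add: \<rho>_def)
      also have "pi * (1 / C) * \<rho> = pi * m / ((1 - 2 * \<epsilon>) * \<epsilon>) * \<rho>" by (simp add: Cinv)
      finally show "w\<^sup>2 * l \<le> (pi / T)\<^sup>2 + m * (pi * m / ((1 - 2 * \<epsilon>) * \<epsilon>) * \<rho>)\<^sup>2" .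
    qed
    have Jw: "J (interior K) = (w\<^sup>2 * l) / (w * h)\<^sup>2"
      using w by (simp add: J power_mult_distrib)
    have "pi\<^sup>2 / (2 / T + 2 * m\<^sup>2 / ((1 - 2 * \<epsilon>) * \<epsilon>) * \<rho>)\<^sup>2 \<le> (w\<^sup>2 * l) / (w * h)\<^sup>2"
      using wl(1) wh w h l by (intro frac_le power_mono) auto
    then show "pi\<^sup>2 / (2 / ((1 - 2 * \<epsilon>) * (1 - 3 * \<epsilon>)) + 2 * (real DIM('a) - 1)\<^sup>2 / ((1 - 2 * \<epsilon>) * \<epsilon>) * \<rho>)\<^sup>2 \<le> J (interior K)"
      unfolding Jw T_def m_def .
    have "(w\<^sup>2 * l) / (w * h)\<^sup>2 \<le> ((pi / T)\<^sup>2 + m * (pi * m / ((1 - 2 * \<epsilon>) * \<epsilon>) * \<rho>)\<^sup>2) / 2\<^sup>2"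
      using wl wh w h l m by (intro frac_le power_mono add_nonneg_nonneg) auto
    then show "J (interior K) \<le> ((pi / ((1 - 2 * \<epsilon>) * (1 - 3 * \<epsilon>)))\<^sup>2
        + (real DIM('a) - 1) * (pi * (real DIM('a) - 1) / ((1 - 2 * \<epsilon>) * \<epsilon>) * \<rho>)\<^sup>2) / 4"
      unfolding Jw T_def m_def by simp
  qed
qed

text \<open>
  The two limits are taken one after the other: \<open>\<rho> \<rightarrow> 0\<close> for fixed \<open>\<epsilon>\<close> removes the long sides of the box,
  then \<open>\<epsilon> \<rightarrow> 0\<close> makes its short side tend to the width.
\<close>
lemma J_tendsto_thin_convex_bodies:
  fixes \<Omega> :: "nat \<Rightarrow> 'a::euclidean_space set"
  assumes dim: "DIM('a) \<ge> 2" and K: "\<And>n. convex_body (\<Omega> n)"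
    and rel: "(\<lambda>n. rel_width (\<Omega> n)) \<longlonglongrightarrow> 0"
  shows "(\<lambda>n. J (interior (\<Omega> n))) \<longlonglongrightarrow> pi\<^sup>2 / 4"
proof -
  define m where "m = real DIM('a) - 1"
  define lo where "lo \<epsilon> r = pi\<^sup>2 / (2 / ((1 - 2 * \<epsilon>) * (1 - 3 * \<epsilon>)) + 2 * m\<^sup>2 / ((1 - 2 * \<epsilon>) * \<epsilon>) * r)\<^sup>2" for \<epsilon> r :: real
  define hi where "hi \<epsilon> r = ((pi / ((1 - 2 * \<epsilon>) * (1 - 3 * \<epsilon>)))\<^sup>2 + m * (pi * m / ((1 - 2 * \<epsilon>) * \<epsilon>) * r)\<^sup>2) / 4" for \<epsilon> r :: real
  have "\<exists>r>0. rel_width (\<Omega> n) = ereal r \<and>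
      (\<forall>\<epsilon>. 0 < \<epsilon> \<longrightarrow> \<epsilon> < 1/3 \<longrightarrow> lo \<epsilon> r \<le> J (interior (\<Omega> n)) \<and> J (interior (\<Omega> n)) \<le> hi \<epsilon> r)" for n
    unfolding lo_def hi_def m_def by (rule J_thin_convex_body_bounds[OF K[of n] dim]) blast
  then obtain \<rho> where \<rho>: "\<And>n. rel_width (\<Omega> n) = ereal (\<rho> n)"
    and bounds: "\<And>n \<epsilon>. 0 < \<epsilon> \<Longrightarrow> \<epsilon> < 1/3 \<Longrightarrow> lo \<epsilon> (\<rho> n) \<le> J (interior (\<Omega> n)) \<and> J (interior (\<Omega> n)) \<le> hi \<epsilon> (\<rho> n)"
    by metis
  have \<rho>0: "\<rho> \<longlonglongrightarrow> 0" using rel by (simp add: \<rho> zero_ereal_def)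
  have lo\<rho>: "(\<lambda>n. lo \<epsilon> (\<rho> n)) \<longlonglongrightarrow> lo \<epsilon> 0" if "0 < \<epsilon>" "\<epsilon> < 1/3" for \<epsilon>
    unfolding lo_def using that by (intro tendsto_intros \<rho>0) auto
  have hi\<rho>: "(\<lambda>n. hi \<epsilon> (\<rho> n)) \<longlonglongrightarrow> hi \<epsilon> 0" if "0 < \<epsilon>" "\<epsilon> < 1/3" for \<epsilon>
    unfolding hi_def using that by (intro tendsto_intros \<rho>0) auto
  have lo0: "((\<lambda>\<epsilon>. lo \<epsilon> 0) \<longlongrightarrow> pi\<^sup>2 / 4) (at_right 0)"
  proof -
    have "((\<lambda>\<epsilon>. pi\<^sup>2 / (2 / ((1 - 2 * \<epsilon>) * (1 - 3 * \<epsilon>)))\<^sup>2) \<longlongrightarrow> pi\<^sup>2 / (2 / ((1 - 2 * 0) * (1 - 3 * 0)))\<^sup>2) (at_right (0::real))"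
      by (intro tendsto_intros) auto
    then show ?thesis by (simp add: lo_def)
  qed
  have hi0: "((\<lambda>\<epsilon>. hi \<epsilon> 0) \<longlongrightarrow> pi\<^sup>2 / 4) (at_right 0)"
  proof -
    have "((\<lambda>\<epsilon>. (pi / ((1 - 2 * \<epsilon>) * (1 - 3 * \<epsilon>)))\<^sup>2 / 4) \<longlongrightarrow> (pi / ((1 - 2 * 0) * (1 - 3 * 0)))\<^sup>2 / 4) (at_right (0::real))"
      by (intro tendsto_intros) auto
    then show ?thesis by (simp add: hi_def)
  qed
  have small: "eventually (\<lambda>\<epsilon>. 0 < \<epsilon> \<and> \<epsilon> < 1/3) (at_right (0::real))"
    using eventually_at_right_real[of 0 "1/3"] by simp
  show ?thesis
  proof (rule order_tendstoI)
    fix y assume "y < pi\<^sup>2 / 4"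
    then have "eventually (\<lambda>\<epsilon>. y < lo \<epsilon> 0) (at_right 0)" using order_tendstoD(1)[OF lo0] by blast
    then have "eventually (\<lambda>\<epsilon>. y < lo \<epsilon> 0 \<and> 0 < \<epsilon> \<and> \<epsilon> < 1/3) (at_right 0)"
      using small by eventually_elim simp
    then obtain \<epsilon> where \<epsilon>: "y < lo \<epsilon> 0" "0 < \<epsilon>" "\<epsilon> < 1/3"
      using eventually_happens'[OF trivial_limit_at_right_real] by blast
    have "eventually (\<lambda>n. y < lo \<epsilon> (\<rho> n)) sequentially"
      by (rule order_tendstoD(1)[OF lo\<rho>[OF \<epsilon>(2,3)] \<epsilon>(1)])
    then show "eventually (\<lambda>n. y < J (interior (\<Omega> n))) sequentially"
      by eventually_elim (use bounds[OF \<epsilon>(2,3)] in \<open>blast intro: less_le_trans\<close>)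
  next
    fix y assume "pi\<^sup>2 / 4 < y"
    then have "eventually (\<lambda>\<epsilon>. hi \<epsilon> 0 < y) (at_right 0)" using order_tendstoD(2)[OF hi0] by blast
    then have "eventually (\<lambda>\<epsilon>. hi \<epsilon> 0 < y \<and> 0 < \<epsilon> \<and> \<epsilon> < 1/3) (at_right 0)"
      using small by eventually_elim simp
    then obtain \<epsilon> where \<epsilon>: "hi \<epsilon> 0 < y" "0 < \<epsilon>" "\<epsilon> < 1/3"
      using eventually_happens'[OF trivial_limit_at_right_real] by blast
    have "eventually (\<lambda>n. hi \<epsilon> (\<rho> n) < y) sequentially"
      by (rule order_tendstoD(2)[OF hi\<rho>[OF \<epsilon>(2,3)] \<epsilon>(1)])
    then show "eventually (\<lambda>n. J (interior (\<Omega> n)) < y) sequentially"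
      by eventually_elim (use bounds[OF \<epsilon>(2,3)] in \<open>blast intro: le_less_trans\<close>)
  qed
qed

theorem theorem5p1:
  fixes \<Omega> :: "nat \<Rightarrow> (real ^ 3) set"
  assumes "\<And>n. convex_body (\<Omega> n)"
    and "(\<lambda>n. rel_width (\<Omega> n)) \<longlonglongrightarrow> 0"
  shows "(\<lambda>n. J (interior (\<Omega> n))) \<longlonglongrightarrow> pi\<^sup>2 / 4"
  by (rule J_tendsto_thin_convex_bodies[OF _ assms]) simp

end
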